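(* Let $\mu,\nu:\mathbb P\to\mathbf g$ be meromorphic maps regular along $\partial D$. Then, as operators on ${}_D\mathcal W$, $[{}_DJ^\mu,{}_DJ^\nu]-{}_DJ^{[\mu,\nu]}=0$ if either (a) both $\mu$ and $\nu$ are regular in $D'$, or (b) both $\mu$ and $\nu$ are regular in $D$. In general, $$[{}_DJ^\mu,{}_DJ^\nu]-{}_DJ^{[\mu,\nu]}=\frac1{2\pi i}\int_{\partial D}(\mu,d\nu).$$
   Context: $\mathbb P$ is a complex projective line; $D\subset\mathbb P$ is a domain biholomorphic to a disc with smooth boundary $\partial D$ oriented counterclockwise around $D$, $D'$ the complement of its closure. $\mathbf g$ is a complex Lie algebra with a nondegenerate invariant symmetric bilinear form $(\cdot,\cdot)$. $z_1,\dots,z_n$ are distinct points of $\mathbb P$ not on $\partial D$, and $W_1,\dots,W_n$ representations of $\mathbf g$. $\mathfrak g$ is the Lie algebra of meromorphic maps $\mathbb P\to\mathbf g$ (with $\mathbf g\subset\mathfrak g$ the constant maps), ${}_D\mathfrak g$ the subalgebra of maps with all poles in $D$, and ${}_D\mathcal W=U({}_D\mathfrak g)\otimes_{U\mathbf g}(W_1\otimes\cdots\otimes W_n)$. For $\nu\in\mathfrak g$ regular along $\partial D$ the operator ${}_DJ^\nu:{}_D\mathcal W\to{}_D\mathcal W$, linear in $\nu$, is defined inductively (simultaneously for all such $\nu$) by $$[{}_DJ^\nu,\alpha]={}_DJ^{[\nu,\alpha]}+\frac1{2\pi i}\int_{\partial D}(\nu,d\alpha),\qquad\alpha\in{}_D\mathfrak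 g$$ ($\alpha$ acting by left multiplication) together with: if $\nu$ is regular in $D'$, $${}_DJ^\nu(w_1\otimes\cdots\otimes w_n)=\nu\otimes_{U\mathbf g}(w_1\otimes\cdots\otimes w_n)-\sum_{z_k\in D'}w_1\otimes\cdots\otimes\nu(z_k)(w_k)\otimes\cdots\otimes w_n,$$ and if $\nu$ is regular in $D$, $${}_DJ^\nu(w_1\otimes\cdots\otimes w_n)=\sum_{z_k\in D}w_1\otimes\cdots\otimes\nu(z_k)(w_k)\otimes\cdots\otimes w_n .$$ Every $\nu$ regular along $\partial D$ is a sum of maps of these two types, unique up to constant maps, on which the two formulas agree. *)

theory Defs
  imports
    "HOL-Complex_Analysis.Complex_Analysis"
    "HOL-Library.Poly_Mapping"
    "HOL-Algebra.QuotRing"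
    "HOL-Algebra.Module"
begin

section \<open>The complex projective line\<close>

text \<open>A point is \<open>Some z\<close> with \<open>z\<close> complex, or the point at infinity \<open>None\<close>.\<close>

type_synonym p1 = "complex option"

definition p1_top :: "p1 topology" where
  "p1_top = Alexandroff_compactification (euclidean :: complex topology)"

text \<open>\<open>loc_par p\<close> is a holomorphic parametrisation of a neighbourhood of \<open>p\<close> by a neighbourhood of
  \<open>0\<close>, taking \<open>0\<close> to \<open>p\<close>: it inverts the coordinate \<open>z - a\<close> at \<open>Some a\<close> and \<open>1 / z\<close> at infinity.
  Analyticity, poles, smoothness on the projective line are all read off in these coordinates.\<close>

definition loc_par :: "p1 \<Rightarrow> complex \<Rightarrow> p1" where
  "loc_par p u = (case p of
      Some a \<Rightarrow> Some (a + u)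
    | None \<Rightarrow> (if u = 0 then None else Some (inverse u)))"

definition biholomorphic_to_disc :: "p1 set \<Rightarrow> bool" where
  "biholomorphic_to_disc D \<longleftrightarrow> (\<exists>h k.
      bij_betw h (ball 0 1) D \<and> (\<forall>w\<in>ball 0 1. k (h w) = w) \<and>
      (\<forall>w\<in>ball 0 1. \<exists>g. g analytic_on {w} \<and> (\<forall>\<^sub>F u in nhds w. h u = loc_par (h w) (g u))) \<and>
      (\<forall>p\<in>D. (k \<circ> loc_par p) analytic_on {0}))"

definition smooth_at :: "(real \<Rightarrow> complex) \<Rightarrow> real \<Rightarrow> bool" where
  "smooth_at g t \<longleftrightarrow> (\<exists>e>0. \<forall>n. \<forall>s\<in>ball t e.
      ((\<lambda>h x. vector_derivative h (at x)) ^^ n) g differentiable (at s))"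

text \<open>\<open>pos_boundary D \<gamma>\<close>: the 1-periodic map \<open>\<gamma>\<close> is a smooth embedding of the circle
  with image the boundary of \<open>D\<close>, and it runs counterclockwise around \<open>D\<close>. The last clause says that
  \<open>D\<close> lies to the left: the tangent vector rotated by \<open>\<i>\<close> points into \<open>D\<close>. It does not depend on the
  holomorphic coordinate and so makes sense for curves through infinity.\<close>

definition pos_boundary :: "p1 set \<Rightarrow> (real \<Rightarrow> p1) \<Rightarrow> bool" where
  "pos_boundary D \<gamma> \<longleftrightarrow>
      (\<forall>t. \<gamma> (t + 1) = \<gamma> t) \<and> inj_on \<gamma> {0..<1} \<and> \<gamma> ` {0..<1} = p1_top frontier_of D \<and>
      (\<forall>t. \<exists>g. smooth_at g t \<and> (\<forall>\<^sub>F s in nhds t. \<gamma> s = loc_par (\<gamma> t) (g s)) \<and>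
           vector_derivative g (at t) \<noteq> 0 \<and>
           (\<forall>\<^sub>F \<epsilon> in at_right 0. loc_par (\<gamma> t) (of_real \<epsilon> * (\<i> * vector_derivative g (at t))) \<in> D))"

definition outer :: "p1 set \<Rightarrow> p1 set" where
  "outer D = UNIV - p1_top closure_of D"


section \<open>Complex Lie algebras with an invariant form\<close>

locale quadratic_lie_algebra = vector_space sg
  for sg :: "complex \<Rightarrow> 'g::ab_group_add \<Rightarrow> 'g" +
  fixes br :: "'g \<Rightarrow> 'g \<Rightarrow> 'g" and B :: "'g \<Rightarrow> 'g \<Rightarrow> complex"
  assumes br_linear: "\<And>x. Vector_Spaces.linear sg sg (br x)" "\<And>y. Vector_Spaces.linear sg sg (\<lambda>x. br x y)"
    and br_alternating: "\<And>x. br x x = 0"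
    and jacobi: "\<And>x y t. br x (br y t) + br y (br t x) + br t (br x y) = 0"
    and form_linear: "\<And>x. Vector_Spaces.linear sg (*) (B x)"
    and form_sym: "\<And>x y. B x y = B y x"
    and form_invariant: "\<And>x y t. B (br x y) t = B x (br y t)"
    and form_nondegenerate: "\<And>x. (\<forall>y. B x y = 0) \<Longrightarrow> x = 0"

record 'a lie_alg = "(complex, 'a) module" +
  lie_bracket :: "'a \<Rightarrow> 'a \<Rightarrow> 'a"

text \<open>As for modules, the ring fields \<open>mult\<close> and \<open>one\<close> of the record carry no information.\<close>

definition lie_of_type :: "(complex \<Rightarrow> 'g::ab_group_add \<Rightarrow> 'g) \<Rightarrow> ('g \<Rightarrow> 'g \<Rightarrow> 'g) \<Rightarrow> 'g lie_alg" where
  "lie_of_type sg br = \<lparr>carrier = UNIV, mult = undefined, one = undefined, zero = 0, add = (+),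
     smult = sg, lie_bracket = br\<rparr>"

definition complex_field :: "complex ring" where
  "complex_field = \<lparr>carrier = UNIV, mult = (*), one = 1, zero = 0, add = (+)\<rparr>"

definition lie_rep :: "(complex \<Rightarrow> 'g::ab_group_add \<Rightarrow> 'g) \<Rightarrow> ('g \<Rightarrow> 'g \<Rightarrow> 'g) \<Rightarrow>
    (complex, 'w) module \<Rightarrow> ('g \<Rightarrow> 'w \<Rightarrow> 'w) \<Rightarrow> bool" where
  "lie_rep sg br W \<rho> \<longleftrightarrow> Module.module complex_field W \<and>
     (\<forall>x. \<forall>v\<in>carrier W. \<rho> x v \<in> carrier W) \<and>
     (\<forall>x. \<forall>v\<in>carrier W. \<forall>v'\<in>carrier W. \<rho> x (v \<oplus>\<^bsub>W\<^esub> v') = \<rho> x v \<oplus>\<^bsub>W\<^esub> \<rho> x v') \<and>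
     (\<forall>x c. \<forall>v\<in>carrier W. \<rho> x (c \<odot>\<^bsub>W\<^esub> v) = c \<odot>\<^bsub>W\<^esub> \<rho> x v) \<and>
     (\<forall>x y. \<forall>v\<in>carrier W. \<rho> (x + y) v = \<rho> x v \<oplus>\<^bsub>W\<^esub> \<rho> y v) \<and>
     (\<forall>x c. \<forall>v\<in>carrier W. \<rho> (sg c x) v = c \<odot>\<^bsub>W\<^esub> \<rho> x v) \<and>
     (\<forall>x y. \<forall>v\<in>carrier W. \<rho> (br x y) v = \<rho> x (\<rho> y v) \<ominus>\<^bsub>W\<^esub> \<rho> y (\<rho> x v))"


section \<open>Meromorphic maps to a complex vector space\<close>

text \<open>Everything is tested on linear functionals. For an infinite-dimensional target a
  meromorphic map is required to take its values in a finite-dimensional subspace, so that the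
  meromorphic maps form the algebraic tensor product with the field of rational functions; for a
  finite-dimensional target this requirement is void.

  Meromorphic maps are represented by total functions, made unique by the convention that the value
  at every pole is \<open>0\<close> (as in \<^const>\<open>nicely_meromorphic_on\<close>).\<close>

definition regular_at :: "(complex \<Rightarrow> 'g::ab_group_add \<Rightarrow> 'g) \<Rightarrow> (p1 \<Rightarrow> 'g) \<Rightarrow> p1 \<Rightarrow> bool" where
  "regular_at sg f p \<longleftrightarrow>
     (\<forall>l. Vector_Spaces.linear sg (*) l \<longrightarrow> (l \<circ> f \<circ> loc_par p) analytic_on {0})"

definition merom_maps :: "(complex \<Rightarrow> 'g::ab_group_add \<Rightarrow> 'g) \<Rightarrow> (p1 \<Rightarrow> 'g) set" where
  "merom_maps sg = {f. (\<exists>S. finite S \<and> range f \<subseteq> Modules.module.span sg S) \<and>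
     (\<forall>p. (\<forall>l. Vector_Spaces.linear sg (*) l \<longrightarrow> (l \<circ> f \<circ> loc_par p) meromorphic_on {0}) \<and>
          (regular_at sg f p \<or>
           f p = 0 \<and> (\<exists>l. Vector_Spaces.linear sg (*) l \<and> is_pole (l \<circ> f \<circ> loc_par p) 0)))}"

text \<open>A pointwise sum or bracket can have a removable singularity at a pole of its arguments;
  \<open>regularise\<close> puts in the right value there (and \<open>0\<close> at the true poles).\<close>

definition regularise :: "(complex \<Rightarrow> 'g::ab_group_add \<Rightarrow> 'g) \<Rightarrow> (p1 \<Rightarrow> 'g) \<Rightarrow> (p1 \<Rightarrow> 'g)" where
  "regularise sg h = (THE f. f \<in> merom_maps sg \<and> finite {p. f p \<noteq> h p})"

definition merom_lie :: "(complex \<Rightarrow> 'g::ab_group_add \<Rightarrow> 'g) \<Rightarrow> ('g \<Rightarrow> 'g \<Rightarrow> 'g) \<Rightarrow> (p1 \<Rightarrow> 'g) lie_alg" where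
  "merom_lie sg br = \<lparr>carrier = merom_maps sg, mult = undefined, one = undefined,
     zero = (\<lambda>_. 0),
     add = (\<lambda>f h. regularise sg (\<lambda>p. f p + h p)),
     smult = (\<lambda>c f. regularise sg (\<lambda>p. sg c (f p))),
     lie_bracket = (\<lambda>f h. regularise sg (\<lambda>p. br (f p) (h p)))\<rparr>"

definition merom_lie_poles_in ::
  "(complex \<Rightarrow> 'g::ab_group_add \<Rightarrow> 'g) \<Rightarrow> ('g \<Rightarrow> 'g \<Rightarrow> 'g) \<Rightarrow> p1 set \<Rightarrow> (p1 \<Rightarrow> 'g) lie_alg" where
  "merom_lie_poles_in sg br D =
     (merom_lie sg br)\<lparr>carrier := {f \<in> merom_maps sg. \<forall>p. \<not> regular_at sg f p \<longrightarrow> p \<in> D}\<rparr>"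

definition regular_on_boundary :: "(complex \<Rightarrow> 'g::ab_group_add \<Rightarrow> 'g) \<Rightarrow> p1 set \<Rightarrow> (p1 \<Rightarrow> 'g) set" where
  "regular_on_boundary sg D = {f \<in> merom_maps sg. \<forall>p \<in> p1_top frontier_of D. regular_at sg f p}"

text \<open>The number \<open>1 / (2 \<pi> \<i>)\<close> times the integral of the 1-form \<open>(\<mu>, d\<nu>)\<close> along \<open>\<gamma>\<close>. The
  integrand is the pullback of the form: only the argument of \<open>\<nu>\<close> is differentiated, and no
  coordinate on the projective line and no topology on the target are needed.\<close>

definition boundary_pairing ::
  "('g \<Rightarrow> 'g \<Rightarrow> complex) \<Rightarrow> (real \<Rightarrow> p1) \<Rightarrow> (p1 \<Rightarrow> 'g) \<Rightarrow> (p1 \<Rightarrow> 'g) \<Rightarrow> complex" where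
  "boundary_pairing B \<gamma> \<mu> \<nu> = 1 / (2 * of_real pi * \<i>) *
     integral {0..1} (\<lambda>t. vector_derivative (\<lambda>s. B (\<mu> (\<gamma> t)) (\<nu> (\<gamma> s))) (at t))"


section \<open>Free vector spaces and quotients\<close>

definition scale_pm :: "complex \<Rightarrow> ('b \<Rightarrow>\<^sub>0 complex) \<Rightarrow> ('b \<Rightarrow>\<^sub>0 complex)" where
  "scale_pm c f = Poly_Mapping.map ((*) c) f"

abbreviation basis_el :: "'b \<Rightarrow> ('b \<Rightarrow>\<^sub>0 complex)" where
  "basis_el b \<equiv> Poly_Mapping.single b 1"

definition free_vs :: "'b set \<Rightarrow> (complex, 'b \<Rightarrow>\<^sub>0 complex) module" where
  "free_vs S = \<lparr>carrier = {f. Poly_Mapping.keys f \<subseteq> S}, mult = undefined, one = undefined,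
     zero = 0, add = (+), smult = scale_pm\<rparr>"

text \<open>Linear extension of a map given on basis vectors.\<close>

definition lin_ext :: "('b \<Rightarrow> ('c \<Rightarrow>\<^sub>0 complex)) \<Rightarrow> ('b \<Rightarrow>\<^sub>0 complex) \<Rightarrow> ('c \<Rightarrow>\<^sub>0 complex)" where
  "lin_ext h f = (\<Sum>b\<in>Poly_Mapping.keys f. scale_pm (Poly_Mapping.lookup f b) (h b))"

definition subspace_gen :: "(complex, 'a) module \<Rightarrow> 'a set \<Rightarrow> 'a set" where
  "subspace_gen M S = \<Inter>{N. submodule N complex_field M \<and> S \<subseteq> N}"

text \<open>The quotient of a vector space by a subspace, or of an algebra by a two-sided ideal. In the
  first case the multiplication is irrelevant.\<close>

definition quot :: "(complex, 'a) module \<Rightarrow> 'a set \<Rightarrow> (complex, 'a set) module" where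
  "quot M N = \<lparr>carrier = carrier (M Quot N), mult = mult (M Quot N), one = one (M Quot N),
     zero = zero (M Quot N), add = add (M Quot N),
     smult = (\<lambda>c X. \<Union>x\<in>X. N +>\<^bsub>M\<^esub> (c \<odot>\<^bsub>M\<^esub> x))\<rparr>"

text \<open>The map into the quotient of \<open>M\<close> by \<open>N\<close> that a map \<open>\<phi>\<close> into \<open>M\<close> induces on cosets.\<close>

definition quot_map :: "(complex, 'a) module \<Rightarrow> 'a set \<Rightarrow> ('b \<Rightarrow> 'a) \<Rightarrow> 'b set \<Rightarrow> 'a set" where
  "quot_map M N \<phi> X = (\<Union>x\<in>X. N +>\<^bsub>M\<^esub> \<phi> x)"


section \<open>Universal enveloping algebras\<close>

datatype 'a letters = Letters (letters: "'a list")

instantiation letters :: (type) monoid_add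
begin

definition zero_letters :: "'a letters" where
  "zero_letters = Letters []"

definition plus_letters :: "'a letters \<Rightarrow> 'a letters \<Rightarrow> 'a letters" where
  "plus_letters u v = Letters (letters u @ letters v)"

instance
  by standard (simp_all add: zero_letters_def plus_letters_def)

end

text \<open>The free associative unital algebra on the set \<open>L\<close>. Its multiplication is the convolution
  product on finitely supported functions on the free monoid.\<close>

definition free_alg :: "'a set \<Rightarrow> (complex, 'a letters \<Rightarrow>\<^sub>0 complex) module" where
  "free_alg L = \<lparr>carrier = {f. \<forall>u\<in>Poly_Mapping.keys f. set (letters u) \<subseteq> L}, mult = (*), one = 1,
     zero = 0, add = (+), smult = scale_pm\<rparr>"

abbreviation gen :: "'a \<Rightarrow> ('a letters \<Rightarrow>\<^sub>0 complex)" where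
  "gen x \<equiv> basis_el (Letters [x])"

definition env_ideal :: "'a lie_alg \<Rightarrow> ('a letters \<Rightarrow>\<^sub>0 complex) set" where
  "env_ideal L = genideal (free_alg (carrier L))
     ({gen (x \<oplus>\<^bsub>L\<^esub> y) - gen x - gen y | x y. x \<in> carrier L \<and> y \<in> carrier L}
    \<union> {gen (c \<odot>\<^bsub>L\<^esub> x) - scale_pm c (gen x) | c x. x \<in> carrier L}
    \<union> {gen x * gen y - gen y * gen x - gen (lie_bracket L x y) | x y. x \<in> carrier L \<and> y \<in> carrier L})"

definition env :: "'a lie_alg \<Rightarrow> (complex, ('a letters \<Rightarrow>\<^sub>0 complex) set) module" where
  "env L = quot (free_alg (carrier L)) (env_ideal L)"

definition env_in :: "'a lie_alg \<Rightarrow> 'a \<Rightarrow> ('a letters \<Rightarrow>\<^sub>0 complex) set" where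
  "env_in L x = env_ideal L +>\<^bsub>free_alg (carrier L)\<^esub> gen x"

text \<open>The algebra homomorphism to \<open>env L'\<close> induced by a Lie algebra homomorphism \<open>j\<close> to \<open>L'\<close>.\<close>

definition env_map :: "'b lie_alg \<Rightarrow> ('a \<Rightarrow> 'b) \<Rightarrow>
    ('a letters \<Rightarrow>\<^sub>0 complex) set \<Rightarrow> ('b letters \<Rightarrow>\<^sub>0 complex) set" where
  "env_map L' j = quot_map (free_alg (carrier L')) (env_ideal L')
     (lin_ext (\<lambda>u. basis_el (Letters (map j (letters u)))))"

text \<open>The action of the enveloping algebra on a space \<open>V\<close> on which the Lie algebra acts by \<open>r\<close>;
  it is independent of the chosen representative.\<close>

definition env_act :: "(complex, 'v) module \<Rightarrow> ('a \<Rightarrow> 'v \<Rightarrow> 'v) \<Rightarrow>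
    ('a letters \<Rightarrow>\<^sub>0 complex) set \<Rightarrow> 'v \<Rightarrow> 'v" where
  "env_act V r X v = (let f = (SOME f. f \<in> X) in
     \<Oplus>\<^bsub>V\<^esub>u\<in>Poly_Mapping.keys f. Poly_Mapping.lookup f u \<odot>\<^bsub>V\<^esub> foldr r (letters u) v)"


section \<open>Tensor products\<close>

definition tuples :: "('n \<Rightarrow> (complex, 'w) module) \<Rightarrow> ('n \<Rightarrow> 'w) set" where
  "tuples W = {w. \<forall>k. w k \<in> carrier (W k)}"

definition multi_tensor_rel :: "('n::finite \<Rightarrow> (complex, 'w) module) \<Rightarrow> (('n \<Rightarrow> 'w) \<Rightarrow>\<^sub>0 complex) set" where
  "multi_tensor_rel W = subspace_gen (free_vs (tuples W))
     ({basis_el (w(k := a \<oplus>\<^bsub>W k\<^esub> b)) - basis_el (w(k := a)) - basis_el (w(k := b)) | w k a b.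
         w \<in> tuples W \<and> a \<in> carrier (W k) \<and> b \<in> carrier (W k)}
    \<union> {basis_el (w(k := c \<odot>\<^bsub>W k\<^esub> a)) - scale_pm c (basis_el (w(k := a))) | w k c a.
         w \<in> tuples W \<and> a \<in> carrier (W k)})"

definition multi_tensor :: "('n::finite \<Rightarrow> (complex, 'w) module) \<Rightarrow>
    (complex, (('n \<Rightarrow> 'w) \<Rightarrow>\<^sub>0 complex) set) module" where
  "multi_tensor W = quot (free_vs (tuples W)) (multi_tensor_rel W)"

definition pure_tensor :: "('n::finite \<Rightarrow> (complex, 'w) module) \<Rightarrow> ('n \<Rightarrow> 'w) \<Rightarrow>
    (('n \<Rightarrow> 'w) \<Rightarrow>\<^sub>0 complex) set" where
  "pure_tensor W w = multi_tensor_rel W +>\<^bsub>free_vs (tuples W)\<^esub> basis_el w"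

text \<open>Action of a Lie algebra element on a tensor product of representations.\<close>

definition tensor_act :: "('n::finite \<Rightarrow> (complex, 'w) module) \<Rightarrow> ('n \<Rightarrow> 'g \<Rightarrow> 'w \<Rightarrow> 'w) \<Rightarrow> 'g \<Rightarrow>
    (('n \<Rightarrow> 'w) \<Rightarrow>\<^sub>0 complex) set \<Rightarrow> (('n \<Rightarrow> 'w) \<Rightarrow>\<^sub>0 complex) set" where
  "tensor_act W \<rho> x = quot_map (free_vs (tuples W)) (multi_tensor_rel W)
     (lin_ext (\<lambda>w. \<Sum>k\<in>UNIV. basis_el (w(k := \<rho> k x (w k)))))"

text \<open>The tensor product, over an algebra with underlying set \<open>A\<close>, of \<open>M\<close> with right action \<open>ra\<close>
  and \<open>N\<close> with left action \<open>la\<close>.\<close>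

definition tensor_over_rel :: "(complex, 'm) module \<Rightarrow> 'a set \<Rightarrow> ('m \<Rightarrow> 'a \<Rightarrow> 'm) \<Rightarrow>
    (complex, 'v) module \<Rightarrow> ('a \<Rightarrow> 'v \<Rightarrow> 'v) \<Rightarrow> (('m \<times> 'v) \<Rightarrow>\<^sub>0 complex) set" where
  "tensor_over_rel M A ra N la = subspace_gen (free_vs (carrier M \<times> carrier N))
     ({basis_el (m \<oplus>\<^bsub>M\<^esub> m', v) - basis_el (m, v) - basis_el (m', v) | m m' v.
         m \<in> carrier M \<and> m' \<in> carrier M \<and> v \<in> carrier N}
    \<union> {basis_el (m, v \<oplus>\<^bsub>N\<^esub> v') - basis_el (m, v) - basis_el (m, v') | m v v'.
         m \<in> carrier M \<and> v \<in> carrier N \<and> v' \<in> carrier N}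
    \<union> {basis_el (c \<odot>\<^bsub>M\<^esub> m, v) - scale_pm c (basis_el (m, v)) | c m v. m \<in> carrier M \<and> v \<in> carrier N}
    \<union> {basis_el (m, c \<odot>\<^bsub>N\<^esub> v) - scale_pm c (basis_el (m, v)) | c m v. m \<in> carrier M \<and> v \<in> carrier N}
    \<union> {basis_el (ra m a, v) - basis_el (m, la a v) | m a v. m \<in> carrier M \<and> a \<in> A \<and> v \<in> carrier N})"


section \<open>The induced module and its operators\<close>

definition DW_rel :: "(complex \<Rightarrow> 'g::ab_group_add \<Rightarrow> 'g) \<Rightarrow> ('g \<Rightarrow> 'g \<Rightarrow> 'g) \<Rightarrow>
    ('n::finite \<Rightarrow> (complex, 'w) module) \<Rightarrow> ('n \<Rightarrow> 'g \<Rightarrow> 'w \<Rightarrow> 'w) \<Rightarrow> p1 set \<Rightarrow>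
    ((((p1 \<Rightarrow> 'g) letters \<Rightarrow>\<^sub>0 complex) set \<times> (('n \<Rightarrow> 'w) \<Rightarrow>\<^sub>0 complex) set) \<Rightarrow>\<^sub>0 complex) set" where
  "DW_rel sg br W \<rho> D = (let U = env (merom_lie_poles_in sg br D) in
     tensor_over_rel U (carrier (env (lie_of_type sg br)))
       (\<lambda>u a. u \<otimes>\<^bsub>U\<^esub> env_map (merom_lie_poles_in sg br D) (\<lambda>x p. x) a)
       (multi_tensor W) (env_act (multi_tensor W) (tensor_act W \<rho>)))"

definition DW_free :: "(complex \<Rightarrow> 'g::ab_group_add \<Rightarrow> 'g) \<Rightarrow> ('g \<Rightarrow> 'g \<Rightarrow> 'g) \<Rightarrow>
    ('n::finite \<Rightarrow> (complex, 'w) module) \<Rightarrow> p1 set \<Rightarrow>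
    (complex, (((p1 \<Rightarrow> 'g) letters \<Rightarrow>\<^sub>0 complex) set \<times> (('n \<Rightarrow> 'w) \<Rightarrow>\<^sub>0 complex) set) \<Rightarrow>\<^sub>0 complex) module" where
  "DW_free sg br W D = free_vs (carrier (env (merom_lie_poles_in sg br D)) \<times> carrier (multi_tensor W))"

definition DW :: "(complex \<Rightarrow> 'g::ab_group_add \<Rightarrow> 'g) \<Rightarrow> ('g \<Rightarrow> 'g \<Rightarrow> 'g) \<Rightarrow>
    ('n::finite \<Rightarrow> (complex, 'w) module) \<Rightarrow> ('n \<Rightarrow> 'g \<Rightarrow> 'w \<Rightarrow> 'w) \<Rightarrow> p1 set \<Rightarrow>
    (complex, ((((p1 \<Rightarrow> 'g) letters \<Rightarrow>\<^sub>0 complex) set \<times> (('n \<Rightarrow> 'w) \<Rightarrow>\<^sub>0 complex) set) \<Rightarrow>\<^sub>0 complex) set) module" where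
  "DW sg br W \<rho> D = quot (DW_free sg br W D) (DW_rel sg br W \<rho> D)"

definition DW_tensor :: "(complex \<Rightarrow> 'g::ab_group_add \<Rightarrow> 'g) \<Rightarrow> ('g \<Rightarrow> 'g \<Rightarrow> 'g) \<Rightarrow>
    ('n::finite \<Rightarrow> (complex, 'w) module) \<Rightarrow> ('n \<Rightarrow> 'g \<Rightarrow> 'w \<Rightarrow> 'w) \<Rightarrow> p1 set \<Rightarrow>
    ((p1 \<Rightarrow> 'g) letters \<Rightarrow>\<^sub>0 complex) set \<Rightarrow> (('n \<Rightarrow> 'w) \<Rightarrow>\<^sub>0 complex) set \<Rightarrow>
    ((((p1 \<Rightarrow> 'g) letters \<Rightarrow>\<^sub>0 complex) set \<times> (('n \<Rightarrow> 'w) \<Rightarrow>\<^sub>0 complex) set) \<Rightarrow>\<^sub>0 complex) set" where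
  "DW_tensor sg br W \<rho> D u v = DW_rel sg br W \<rho> D +>\<^bsub>DW_free sg br W D\<^esub> basis_el (u, v)"

text \<open>Left multiplication by an element \<open>\<alpha>\<close> of \<open>merom_lie_poles_in sg br D\<close>.\<close>

definition DW_lmult :: "(complex \<Rightarrow> 'g::ab_group_add \<Rightarrow> 'g) \<Rightarrow> ('g \<Rightarrow> 'g \<Rightarrow> 'g) \<Rightarrow>
    ('n::finite \<Rightarrow> (complex, 'w) module) \<Rightarrow> ('n \<Rightarrow> 'g \<Rightarrow> 'w \<Rightarrow> 'w) \<Rightarrow> p1 set \<Rightarrow> (p1 \<Rightarrow> 'g) \<Rightarrow>
    ((((p1 \<Rightarrow> 'g) letters \<Rightarrow>\<^sub>0 complex) set \<times> (('n \<Rightarrow> 'w) \<Rightarrow>\<^sub>0 complex) set) \<Rightarrow>\<^sub>0 complex) set \<Rightarrow>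
    ((((p1 \<Rightarrow> 'g) letters \<Rightarrow>\<^sub>0 complex) set \<times> (('n \<Rightarrow> 'w) \<Rightarrow>\<^sub>0 complex) set) \<Rightarrow>\<^sub>0 complex) set" where
  "DW_lmult sg br W \<rho> D \<alpha> = (let L = merom_lie_poles_in sg br D in
     quot_map (DW_free sg br W D) (DW_rel sg br W \<rho> D)
       (lin_ext (\<lambda>(u, v). basis_el (env_in L \<alpha> \<otimes>\<^bsub>env L\<^esub> u, v))))"

definition lin_operator :: "(complex, 'a) module \<Rightarrow> ('a \<Rightarrow> 'a) \<Rightarrow> bool" where
  "lin_operator M T \<longleftrightarrow> (\<forall>X\<in>carrier M. T X \<in> carrier M) \<and>
     (\<forall>X\<in>carrier M. \<forall>Y\<in>carrier M. T (X \<oplus>\<^bsub>M\<^esub> Y) = T X \<oplus>\<^bsub>M\<^esub> T Y) \<and>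
     (\<forall>c. \<forall>X\<in>carrier M. T (c \<odot>\<^bsub>M\<^esub> X) = c \<odot>\<^bsub>M\<^esub> T X)"

text \<open>\<open>J\<close> is the family of operators on \<open>DW\<close> given by the inductive definition: every \<open>\<nu>\<close> regular
  along the boundary is a sum of maps of the two types in the last two clauses, which
  therefore fix \<open>J \<nu>\<close> on the tensors \<open>1 \<otimes> w\<close>; the commutation relation then fixes it everywhere.
  Nothing is said about \<open>J\<close> outside its domain.\<close>

definition is_DJ :: "(complex \<Rightarrow> 'g::ab_group_add \<Rightarrow> 'g) \<Rightarrow> ('g \<Rightarrow> 'g \<Rightarrow> 'g) \<Rightarrow> ('g \<Rightarrow> 'g \<Rightarrow> complex) \<Rightarrow>
    ('n::finite \<Rightarrow> (complex, 'w) module) \<Rightarrow> ('n \<Rightarrow> 'g \<Rightarrow> 'w \<Rightarrow> 'w) \<Rightarrow> ('n \<Rightarrow> p1) \<Rightarrow> p1 set \<Rightarrow> (real \<Rightarrow> p1) \<Rightarrow>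
    ((p1 \<Rightarrow> 'g) \<Rightarrow>
      ((((p1 \<Rightarrow> 'g) letters \<Rightarrow>\<^sub>0 complex) set \<times> (('n \<Rightarrow> 'w) \<Rightarrow>\<^sub>0 complex) set) \<Rightarrow>\<^sub>0 complex) set \<Rightarrow>
      ((((p1 \<Rightarrow> 'g) letters \<Rightarrow>\<^sub>0 complex) set \<times> (('n \<Rightarrow> 'w) \<Rightarrow>\<^sub>0 complex) set) \<Rightarrow>\<^sub>0 complex) set) \<Rightarrow> bool" where
  "is_DJ sg br B W \<rho> z D \<gamma> J \<longleftrightarrow>
    (let G = merom_lie sg br; L = merom_lie_poles_in sg br D; R = regular_on_boundary sg D;
         M = DW sg br W \<rho> D; act = DW_lmult sg br W \<rho> D;
         one_tensor = (\<lambda>w. DW_tensor sg br W \<rho> D \<one>\<^bsub>env L\<^esub> (pure_tensor W w))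
     in
      (\<forall>\<nu>\<in>R. lin_operator M (J \<nu>)) \<and>
      (\<forall>\<nu>\<in>R. \<forall>\<nu>'\<in>R. \<forall>X\<in>carrier M. J (\<nu> \<oplus>\<^bsub>G\<^esub> \<nu>') X = J \<nu> X \<oplus>\<^bsub>M\<^esub> J \<nu>' X) \<and>
      (\<forall>c. \<forall>\<nu>\<in>R. \<forall>X\<in>carrier M. J (c \<odot>\<^bsub>G\<^esub> \<nu>) X = c \<odot>\<^bsub>M\<^esub> J \<nu> X) \<and>
      (\<forall>\<nu>\<in>R. \<forall>\<alpha>\<in>carrier L. \<forall>X\<in>carrier M.
         J \<nu> (act \<alpha> X) \<ominus>\<^bsub>M\<^esub> act \<alpha> (J \<nu> X) =
         J (lie_bracket G \<nu> \<alpha>) X \<oplus>\<^bsub>M\<^esub> boundary_pairing B \<gamma> \<nu> \<alpha> \<odot>\<^bsub>M\<^esub> X) \<and>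
      (\<forall>\<nu>\<in>R. \<forall>w\<in>tuples W. (\<forall>p\<in>outer D. regular_at sg \<nu> p) \<longrightarrow>
         J \<nu> (one_tensor w) =
         DW_tensor sg br W \<rho> D (env_in L \<nu>) (pure_tensor W w) \<ominus>\<^bsub>M\<^esub>
         (\<Oplus>\<^bsub>M\<^esub>k\<in>{k. z k \<in> outer D}. one_tensor (w(k := \<rho> k (\<nu> (z k)) (w k))))) \<and>
      (\<forall>\<nu>\<in>R. \<forall>w\<in>tuples W. (\<forall>p\<in>D. regular_at sg \<nu> p) \<longrightarrow>
         J \<nu> (one_tensor w) =
         (\<Oplus>\<^bsub>M\<^esub>k\<in>{k. z k \<in> D}. one_tensor (w(k := \<rho> k (\<nu> (z k)) (w k))))))"

end

theory Submission
  imports Defs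
begin

text \<open>Write \<open>c(\<mu>, \<nu>)\<close> for the boundary integral and
  \<open>C(\<mu>, \<nu>) = [J\<^sup>\<mu>, J\<^sup>\<nu>] - J\<^sup>[\<mu>\<^sup>,\<nu>\<^sup>] - c(\<mu>, \<nu>)\<close>. Integrating \<open>d(\<mu>, \<nu>)\<close> and \<open>d([\<mu>, \<nu>], \<alpha>)\<close>
  over the closed curve shows that \<open>c\<close> is an antisymmetric cocycle, and then the Jacobi identity
  gives \<open>[C(\<mu>, \<nu>), \<alpha>] = C(\<mu>, [\<nu>, \<alpha>]) - C(\<nu>, [\<mu>, \<alpha>])\<close>. Hence \<open>C\<close> vanishes as soon as it kills the
  vectors \<open>1 \<otimes> w\<close>. Splitting off principal parts, one may take each of \<open>\<mu>\<close>, \<open>\<nu>\<close> regular either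
  outside or inside \<open>D\<close>; the four cases follow from the formulas for \<open>J\<close> on these vectors,
  given that \<open>c(\<mu>, \<nu>) = 0\<close> if \<open>\<mu>\<close> and \<open>\<nu>\<close> are regular on the same side.

  The latter is Cauchy's theorem: send a point of the side \<open>E\<close> that contains the poles to infinity.
  The winding number of the boundary is locally constant and vanishes near infinity, so it
  vanishes on the connected set \<open>E\<close>. That the outer side is connected is the Jordan curve theorem.\<close>


section \<open>Finitely supported functions and cosets\<close>

text \<open>The central term comes from the mixed case alone. If \<open>\<mu>\<close> is regular
  inside and \<open>\<nu>\<close> outside, then \<open>J\<^sup>\<nu>\<close> on
  \<open>1 \<otimes> w\<close> is left multiplication by \<open>\<nu>\<close> up to terms at marked
  points outside, and the defining commutation relation with \<open>\<alpha> = \<nu>\<close> already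
  contains both \<open>J\<^sup>[\<mu>\<^sup>,\<nu>\<^sup>]\<close> and
  \<open>c(\<mu>, \<nu>)\<close>. On equal sides the claim is the representation property at the
  marked points, with vanishing constant. Since \<open>[\<nu>, \<alpha>]\<close> may have poles on
  both sides even when \<open>\<nu>\<close> does not, the vanishing of \<open>C\<close> has to be
  carried through the induction for all pairs simultaneously.

  Two features of the objects shape everything else. The induced module is a quotient whose elements
  are cosets, so it is embedded linearly in a type before the commutator computation. The target of
  the meromorphic maps has no topology, so analyticity, derivatives and integrals are handled
  through finitely many linear coordinates.\<close>

lemma lookup_scale_pm: "Poly_Mapping.lookup (scale_pm c f) k = c * Poly_Mapping.lookup f k"
  by (simp add: scale_pm_def map.rep_eq when_def)

global_interpretation pm: vector_space "scale_pm :: complex \<Rightarrow> ('b \<Rightarrow>\<^sub>0 complex) \<Rightarrow> ('b \<Rightarrow>\<^sub>0 complex)"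
  by unfold_locales (auto intro!: poly_mapping_eqI simp: lookup_scale_pm lookup_add algebra_simps)

global_interpretation pmp: vector_space_pair
  "scale_pm :: complex \<Rightarrow> ('b \<Rightarrow>\<^sub>0 complex) \<Rightarrow> ('b \<Rightarrow>\<^sub>0 complex)"
  "scale_pm :: complex \<Rightarrow> ('c \<Rightarrow>\<^sub>0 complex) \<Rightarrow> ('c \<Rightarrow>\<^sub>0 complex)"
  by unfold_locales

abbreviation pm_linear :: "(('b \<Rightarrow>\<^sub>0 complex) \<Rightarrow> ('c \<Rightarrow>\<^sub>0 complex)) \<Rightarrow> bool" where
  "pm_linear \<equiv> Vector_Spaces.linear scale_pm scale_pm"

lemma pm_expand: "f = (\<Sum>k\<in>Poly_Mapping.keys f. scale_pm (Poly_Mapping.lookup f k) (basis_el k))"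
proof (rule poly_mapping_eqI)
  fix k
  have "(\<Sum>x\<in>Poly_Mapping.keys f. Poly_Mapping.lookup f x * (1 when x = k))
      = (\<Sum>x\<in>Poly_Mapping.keys f. if x = k then Poly_Mapping.lookup f x else 0)"
    by (rule sum.cong) (auto simp: when_def)
  then show "Poly_Mapping.lookup f k =
      Poly_Mapping.lookup (\<Sum>k\<in>Poly_Mapping.keys f. scale_pm (Poly_Mapping.lookup f k) (basis_el k)) k"
    by (simp add: lookup_sum lookup_scale_pm lookup_single in_keys_iff)
qed

text \<open>Seen as a span, the carrier is open to the principles that a linear map is determined,
  or confined to a subspace, by its values on basis vectors.\<close>

lemma carrier_free_vs: "{f :: 'b \<Rightarrow>\<^sub>0 complex. Poly_Mapping.keys f \<subseteq> S} = pm.span (basis_el ` S)"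
proof (intro equalityI subsetI)
  fix f :: "'b \<Rightarrow>\<^sub>0 complex" assume "f \<in> {f. Poly_Mapping.keys f \<subseteq> S}"
  then show "f \<in> pm.span (basis_el ` S)"
    by (subst pm_expand) (auto intro!: pm.span_sum pm.span_scale intro: pm.span_base)
next
  fix f assume "f \<in> pm.span (basis_el ` S :: ('b \<Rightarrow>\<^sub>0 complex) set)"
  then show "f \<in> {f. Poly_Mapping.keys f \<subseteq> S}"
  proof (induction rule: pm.span_induct_alt)
    case base
    then show ?case by simp
  next
    case (step c x y)
    then obtain b where "b \<in> S" "x = basis_el b" by auto
    then have "Poly_Mapping.keys (scale_pm c x) \<subseteq> S"
      by (auto simp: in_keys_iff lookup_scale_pm lookup_single when_def split: if_splits)
    then show ?case
      using step keys_add[of "scale_pm c x" y] by auto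
  qed
qed

text \<open>The index set of \<open>lin_ext\<close> varies with its argument; additivity becomes
  visible once both arguments are summed over a common finite set.\<close>

lemma lin_ext_superset:
  assumes "finite K" "Poly_Mapping.keys f \<subseteq> K"
  shows "lin_ext h f = (\<Sum>b\<in>K. scale_pm (Poly_Mapping.lookup f b) (h b))"
  unfolding lin_ext_def using assms
  by (intro sum.mono_neutral_left) (auto simp: in_keys_iff)

lemma pm_linearI:
  fixes f :: "('b \<Rightarrow>\<^sub>0 complex) \<Rightarrow> ('c \<Rightarrow>\<^sub>0 complex)"
  assumes "\<And>x y. f (x + y) = f x + f y" "\<And>c x. f (scale_pm c x) = scale_pm c (f x)"
  shows "pm_linear f"
  using assms by (simp add: Vector_Spaces.linear_iff pm.vector_space_axioms)

lemma lin_ext_linear: "pm_linear (lin_ext h)"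
proof (rule pm_linearI)
  fix f g :: "'a \<Rightarrow>\<^sub>0 complex" and c
  let ?K = "Poly_Mapping.keys f \<union> Poly_Mapping.keys g"
  show "lin_ext h (f + g) = lin_ext h f + lin_ext h g"
    using keys_add[of f g]
    by (simp add: lin_ext_superset[of ?K] lookup_add pm.scale_left_distrib sum.distrib)
  have "Poly_Mapping.keys (scale_pm c f) \<subseteq> Poly_Mapping.keys f"
    by (auto simp: in_keys_iff lookup_scale_pm)
  then show "lin_ext h (scale_pm c f) = scale_pm c (lin_ext h f)"
    by (simp add: lin_ext_superset[of "Poly_Mapping.keys f"] lookup_scale_pm pm.scale_sum_right)
qed

lemma lin_ext_basis_el [simp]: "lin_ext h (basis_el b) = h b"
  by (simp add: lin_ext_def)

lemma pm_linear_eqI: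
  assumes "pm_linear f" "pm_linear g" "\<And>b. f (basis_el b) = g (basis_el b)"
  shows "f = g"
proof
  fix x :: "'a \<Rightarrow>\<^sub>0 complex"
  have "x \<in> pm.span (range basis_el)"
    using carrier_free_vs[of UNIV] by auto
  then show "f x = g x"
    by (rule pmp.linear_eq_on_span[OF assms(1,2), rotated]) (auto simp: assms(3))
qed

lemma pm_linear_into_subspace:
  assumes "pm_linear f" "pm.subspace N" "\<And>x. x \<in> G \<Longrightarrow> f x \<in> N" "x \<in> pm.span G"
  shows "f x \<in> N"
proof -
  have "pm.span G \<subseteq> f -` N"
    using assms by (intro pm.span_minimal pmp.linear_subspace_vimage) auto
  then show ?thesis using assms(4) by auto
qed

text \<open>A basis \<open>b\<close> of \<open>N\<close> is extended to a basis \<open>e\<close> of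
  the whole space; the map kills \<open>b\<close> and fixes the rest of \<open>e\<close>.\<close>

lemma exists_linear_with_kernel:
  assumes N: "pm.subspace (N :: ('b \<Rightarrow>\<^sub>0 complex) set)"
  obtains \<pi> :: "('b \<Rightarrow>\<^sub>0 complex) \<Rightarrow> ('b \<Rightarrow>\<^sub>0 complex)"
  where "pm_linear \<pi>" "\<And>x. \<pi> x = 0 \<longleftrightarrow> x \<in> N"
proof -
  obtain b where b: "b \<subseteq> N" "pm.independent b" "N \<subseteq> pm.span b"
    using pm.maximal_independent_subset by blast
  then have span_b: "pm.span b = N"
    using N by (metis pm.span_minimal subset_antisym)
  define e where "e = pm.extend_basis b"
  have e: "b \<subseteq> e" "pm.independent e" "pm.span e = UNIV"
    unfolding e_def using b pm.extend_basis_superset pm.independent_extend_basis pm.span_extend_basis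
    by blast+
  define \<pi> where "\<pi> = pmp.construct e (\<lambda>x. if x \<in> b then 0 else x)"
  have lin: "pm_linear \<pi>"
    unfolding \<pi>_def by (rule pmp.linear_construct[OF e(2)])
  have \<pi>_e: "\<pi> x = (if x \<in> b then 0 else x)" if "x \<in> e" for x
    unfolding \<pi>_def by (subst pmp.construct_basis[OF e(2) that]) simp
  \<comment> \<open>On \<open>e\<close> this difference is either a vector of \<open>b\<close> or
    \<open>0\<close>. So it always lies in \<open>N\<close>, and \<open>\<pi> x = 0\<close> forces
    \<open>x \<in> N\<close>.\<close>
  have "pm_linear (\<lambda>x. x - \<pi> x)"
    by (rule pm_linearI) (simp_all add: pmp.linear_add[OF lin] pmp.linear_scale[OF lin]
        pm.scale_right_diff_distrib)
  then have diff: "x - \<pi> x \<in> N" for x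
    by (rule pm_linear_into_subspace[where G = e])
       (use N e b in \<open>auto simp: \<pi>_e pm.subspace_0\<close>)
  have zero: "\<pi> x \<in> {0}" if "x \<in> N" for x
    by (rule pm_linear_into_subspace[OF lin, where G = b])
       (use that e(1) span_b in \<open>auto simp: \<pi>_e subset_iff\<close>)
  show ?thesis
    using that[OF lin] diff zero by (metis diff_zero singletonD)
qed

section \<open>Modules over the complex numbers in record form\<close>

lemma cring_complex_field: "cring complex_field"
proof (rule cringI)
  show "abelian_group complex_field"
    by (rule abelian_groupI)
       (auto simp: complex_field_def add.commute add.assoc intro: exI[of _ "- x" for x] ab_left_minus)
  show "Group.comm_monoid complex_field"
    by (rule comm_monoidI) (auto simp: complex_field_def)
qed (auto simp: complex_field_def algebra_simps)

lemma complex_field_simps [simp]: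
  "carrier complex_field = UNIV" "mult complex_field = (*)" "add complex_field = (+)"
  "one complex_field = 1" "zero complex_field = 0"
  by (simp_all add: complex_field_def)

lemma smult_minus_one:
  assumes "Module.module complex_field M" "x \<in> carrier M"
  shows "(-1) \<odot>\<^bsub>M\<^esub> x = \<ominus>\<^bsub>M\<^esub> x"
proof -
  interpret Module.module complex_field M by fact
  have "(-1) \<odot>\<^bsub>M\<^esub> x \<oplus>\<^bsub>M\<^esub> x = ((-1) + 1) \<odot>\<^bsub>M\<^esub> x"
    using smult_l_distr[of "-1" 1 x] smult_one[of x] assms(2) by simp
  also have "\<dots> = \<zero>\<^bsub>M\<^esub>"
    using smult_l_null[of x] assms(2) by simp
  finally show ?thesis
    using assms(2) M.minus_equality[of "(-1) \<odot>\<^bsub>M\<^esub> x" x] smult_closed[of "-1" x] by simp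
qed

text \<open>Record modules whose operations are those of the ambient type. Their submodules are then
  subspaces in the sense of the vector space theory, and generated submodules are spans.\<close>

locale pm_space =
  fixes M :: "(complex, 'b \<Rightarrow>\<^sub>0 complex) module"
  assumes add: "add M = (+)" and zero: "zero M = 0" and smult: "smult M = scale_pm"
    and subspace_carrier: "pm.subspace (carrier M)"
begin

lemma abelian_group: "abelian_group M"
  using subspace_carrier
  by (intro abelian_groupI) (auto simp: add zero pm.subspace_add pm.subspace_0 algebra_simps
       intro!: bexI[of _ "- _"] pm.subspace_neg)

lemma a_inv: "x \<in> carrier M \<Longrightarrow> \<ominus>\<^bsub>M\<^esub> x = - x"
  using abelian_group.minus_equality[OF abelian_group, of "- x" x] subspace_carrier
  by (simp add: add zero pm.subspace_neg)

lemma module: "Module.module complex_field M"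
  using subspace_carrier
  by (intro moduleI cring_complex_field abelian_group)
     (auto simp: add smult pm.subspace_scale algebra_simps pm.scale_left_distrib pm.scale_right_distrib)

lemma submodule_iff: "submodule N complex_field M \<longleftrightarrow> pm.subspace N \<and> N \<subseteq> carrier M"
proof
  assume N: "submodule N complex_field M"
  note E = module.submoduleE[OF module N]
  have "\<zero>\<^bsub>M\<^esub> \<in> N"
    using subgroup.one_closed[OF submodule.axioms(1)[OF N]] by simp
  then show "pm.subspace N \<and> N \<subseteq> carrier M"
    using E by (auto intro!: pm.subspaceI simp: zero add smult)
next
  assume N: "pm.subspace N \<and> N \<subseteq> carrier M"
  then show "submodule N complex_field M"
    by (intro module.submoduleI[OF module])
       (auto simp: zero add smult pm.subspace_0 pm.subspace_add pm.subspace_scale a_inv subset_iff pm.subspace_neg)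
qed

lemma subspace_gen_eq_span:
  assumes "G \<subseteq> carrier M"
  shows "subspace_gen M G = pm.span G"
proof -
  have "pm.span G \<subseteq> carrier M"
    using assms subspace_carrier by (rule pm.span_minimal)
  then show ?thesis
    unfolding subspace_gen_def submodule_iff
    by (intro equalityI Inter_greatest Inter_lower)
       (auto simp: pm.span_superset intro: subsetD[OF pm.span_minimal])
qed

end

section \<open>Quotients by a subspace, computed on representatives\<close>

locale pm_quotient = pm_space M for M :: "(complex, 'b \<Rightarrow>\<^sub>0 complex) module" +
  fixes N :: "('b \<Rightarrow>\<^sub>0 complex) set"
  assumes subspace: "pm.subspace N" and subset: "N \<subseteq> carrier M"
begin

abbreviation cos :: "('b \<Rightarrow>\<^sub>0 complex) \<Rightarrow> ('b \<Rightarrow>\<^sub>0 complex) set" where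
  "cos x \<equiv> N +>\<^bsub>M\<^esub> x"

lemma cos_image: "cos x = (\<lambda>n. n + x) ` N"
  by (auto simp: a_r_coset_def' add)

lemma mem_cos: "y \<in> cos x \<longleftrightarrow> y - x \<in> N"
  by (force simp: cos_image image_iff)

lemma cos_eq_iff: "cos x = cos y \<longleftrightarrow> x - y \<in> N"
proof
  assume "cos x = cos y"
  then show "x - y \<in> N"
    using mem_cos[of x x] mem_cos[of x y] subspace by (simp add: pm.subspace_0)
next
  assume xy: "x - y \<in> N"
  have "u - x \<in> N \<longleftrightarrow> u - y \<in> N" for u
    using pm.subspace_add[OF subspace xy, of "u - x"] pm.subspace_diff[OF subspace _ xy, of "u - y"]
    by (auto simp: algebra_simps)
  then show "cos x = cos y"
    by (auto simp: mem_cos)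
qed

lemma carrier_quot: "carrier (quot M N) = cos ` carrier M"
  by (auto simp: quot_def FactRing_def A_RCOSETS_def')

lemma cos_closed: "x \<in> carrier M \<Longrightarrow> cos x \<in> carrier (quot M N)"
  by (simp add: carrier_quot)

lemma zero_quot: "\<zero>\<^bsub>quot M N\<^esub> = cos 0"
  by (simp add: quot_def FactRing_def cos_image)

lemma add_quot: "cos x \<oplus>\<^bsub>quot M N\<^esub> cos y = cos (x + y)"
proof -
  have eq: "cos x \<oplus>\<^bsub>quot M N\<^esub> cos y = (\<Union>u\<in>cos x. \<Union>v\<in>cos y. {u + v})"
    by (simp add: quot_def FactRing_def set_add_def set_mult_def add)
  show ?thesis
    unfolding eq
  proof (rule Set.set_eqI, rule iffI)
    fix w assume "w \<in> (\<Union>u\<in>cos x. \<Union>v\<in>cos y. {u + v})"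
    then obtain u v where w: "u - x \<in> N" "v - y \<in> N" "w = u + v"
      by (auto simp: mem_cos)
    have eq: "w - (x + y) = (u - x) + (v - y)"
      using w(3) by (rule ssubst) (rule add_diff_add)
    show "w \<in> cos (x + y)"
      unfolding mem_cos eq by (rule pm.subspace_add[OF subspace w(1,2)])
  next
    fix w assume "w \<in> cos (x + y)"
    then have "w - y \<in> cos x" "y \<in> cos y"
      using pm.subspace_0[OF subspace] by (simp_all add: mem_cos diff_diff_eq add.commute)
    then have "w - y + y \<in> (\<Union>u\<in>cos x. \<Union>v\<in>cos y. {u + v})"
      by blast
    then show "w \<in> (\<Union>u\<in>cos x. \<Union>v\<in>cos y. {u + v})"
      by simp
  qed
qed

text \<open>\<open>quot\<close> and \<open>quot_map\<close> are unions over all representatives of a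
  coset. The union collapses when its members do not depend on the representative; the coset is
  nonempty because it contains \<open>x\<close>.\<close>

lemma UN_cos:
  assumes "\<And>y. y - x \<in> N \<Longrightarrow> F y = A"
  shows "(\<Union>y\<in>cos x. F y) = A"
proof -
  have "x \<in> cos x" using subspace by (simp add: mem_cos pm.subspace_0)
  then have "(\<Union>y\<in>cos x. F y) = (\<Union>y\<in>cos x. A)"
    using assms by (auto simp: mem_cos)
  then show ?thesis using \<open>x \<in> cos x\<close> by auto
qed

lemma smult_quot: "c \<odot>\<^bsub>quot M N\<^esub> cos x = cos (scale_pm c x)"
proof -
  have "(\<Union>y\<in>cos x. N +>\<^bsub>M\<^esub> scale_pm c y) = cos (scale_pm c x)"
    using pm.subspace_scale[OF subspace, of "_ - x" c]
    by (intro UN_cos) (simp add: cos_eq_iff pm.scale_right_diff_distrib)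
  then show ?thesis by (simp add: quot_def smult)
qed

lemma quot_cases:
  assumes "X \<in> carrier (quot M N)"
  obtains x where "x \<in> carrier M" "X = cos x"
  using assms by (auto simp: carrier_quot)

lemma add_quot_closed: "x \<in> carrier M \<Longrightarrow> y \<in> carrier M \<Longrightarrow> cos x \<oplus>\<^bsub>quot M N\<^esub> cos y \<in> carrier (quot M N)"
  by (simp add: add_quot cos_closed pm.subspace_add[OF subspace_carrier])

lemma abelian_group_quot: "abelian_group (quot M N)"
proof (rule abelian_groupI)
  show "\<zero>\<^bsub>quot M N\<^esub> \<in> carrier (quot M N)"
    by (simp add: zero_quot cos_closed pm.subspace_0[OF subspace_carrier])
next
  fix X assume "X \<in> carrier (quot M N)"
  then obtain x where x: "x \<in> carrier M" "X = cos x" by (rule quot_cases)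
  show "\<zero>\<^bsub>quot M N\<^esub> \<oplus>\<^bsub>quot M N\<^esub> X = X"
    by (simp only: x zero_quot add_quot add_0)
  have "cos (- x) \<oplus>\<^bsub>quot M N\<^esub> X = \<zero>\<^bsub>quot M N\<^esub>"
    by (simp only: x zero_quot add_quot left_minus)
  then show "\<exists>Y\<in>carrier (quot M N). Y \<oplus>\<^bsub>quot M N\<^esub> X = \<zero>\<^bsub>quot M N\<^esub>"
    using cos_closed[OF pm.subspace_neg[OF subspace_carrier x(1)]] by (rule bexI)
next
  fix X Y assume "X \<in> carrier (quot M N)" "Y \<in> carrier (quot M N)"
  then obtain x y where x: "x \<in> carrier M" "X = cos x" "y \<in> carrier M" "Y = cos y"
    by (metis quot_cases)
  show "X \<oplus>\<^bsub>quot M N\<^esub> Y \<in> carrier (quot M N)"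
    using x by (simp add: add_quot_closed)
  show "X \<oplus>\<^bsub>quot M N\<^esub> Y = Y \<oplus>\<^bsub>quot M N\<^esub> X"
    by (simp only: x add_quot add.commute)
next
  fix X Y Z assume "X \<in> carrier (quot M N)" "Y \<in> carrier (quot M N)" "Z \<in> carrier (quot M N)"
  then obtain x y z where x: "X = cos x" "Y = cos y" "Z = cos z"
    by (metis quot_cases)
  show "X \<oplus>\<^bsub>quot M N\<^esub> Y \<oplus>\<^bsub>quot M N\<^esub> Z = X \<oplus>\<^bsub>quot M N\<^esub> (Y \<oplus>\<^bsub>quot M N\<^esub> Z)"
    by (simp only: x add_quot add.assoc)
qed

lemma module_quot: "Module.module complex_field (quot M N)"
proof (intro moduleI cring_complex_field abelian_group_quot)
  fix a X assume "X \<in> carrier (quot M N)"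
  then obtain x where x: "x \<in> carrier M" "X = cos x" by (rule quot_cases)
  show "a \<odot>\<^bsub>quot M N\<^esub> X \<in> carrier (quot M N)"
    using x by (simp add: smult_quot cos_closed pm.subspace_scale[OF subspace_carrier])
  show "(a \<oplus>\<^bsub>complex_field\<^esub> b) \<odot>\<^bsub>quot M N\<^esub> X = a \<odot>\<^bsub>quot M N\<^esub> X \<oplus>\<^bsub>quot M N\<^esub> b \<odot>\<^bsub>quot M N\<^esub> X" for b
    by (simp add: x smult_quot add_quot pm.scale_left_distrib)
  show "(a \<otimes>\<^bsub>complex_field\<^esub> b) \<odot>\<^bsub>quot M N\<^esub> X = a \<odot>\<^bsub>quot M N\<^esub> (b \<odot>\<^bsub>quot M N\<^esub> X)" for b
    by (simp add: x smult_quot)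
  show "\<one>\<^bsub>complex_field\<^esub> \<odot>\<^bsub>quot M N\<^esub> X = X"
    by (simp add: x smult_quot)
  fix Y assume "Y \<in> carrier (quot M N)"
  then obtain y where y: "Y = cos y" by (rule quot_cases)
  show "a \<odot>\<^bsub>quot M N\<^esub> (X \<oplus>\<^bsub>quot M N\<^esub> Y) = a \<odot>\<^bsub>quot M N\<^esub> X \<oplus>\<^bsub>quot M N\<^esub> a \<odot>\<^bsub>quot M N\<^esub> Y"
    by (simp add: x y smult_quot add_quot pm.scale_right_distrib)
qed

text \<open>The condition that \<open>\<phi>\<close> carries \<open>N\<close> into \<open>N'\<close>
  is what makes the induced map well defined.\<close>

lemma quot_map_cos:
  assumes "pm_quotient M' N'" and "pm_linear \<phi>" and "\<And>n. n \<in> N \<Longrightarrow> \<phi> n \<in> N'"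
  shows "quot_map M' N' \<phi> (cos x) = N' +>\<^bsub>M'\<^esub> \<phi> x"
proof -
  interpret Q: pm_quotient M' N' by fact
  show ?thesis
    unfolding quot_map_def
    by (rule UN_cos) (use assms(3) pmp.linear_diff[OF assms(2)] in \<open>force simp: Q.cos_eq_iff\<close>)
qed

end

lemma pm_space_free_vs: "pm_space (free_vs S)"
  by unfold_locales (auto simp: free_vs_def carrier_free_vs pm.subspace_span)

lemma free_vs_carrier: "carrier (free_vs S) = pm.span (basis_el ` S)"
  by (simp add: free_vs_def carrier_free_vs)

lemma basis_el_in_free_vs: "b \<in> S \<Longrightarrow> basis_el b \<in> carrier (free_vs S)"
  by (simp add: free_vs_def)

lemma pm_quotient_span:
  assumes "pm_space M" "G \<subseteq> carrier M"
  shows "pm_quotient M (pm.span G)"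
  using assms pm.span_minimal[OF assms(2) pm_space.subspace_carrier[OF assms(1)]]
  by (simp add: pm_quotient_def pm_quotient_axioms_def pm.subspace_span)


section \<open>Transfer of a quotient space to a type\<close>

text \<open>A quotient space embeds linearly into the ambient type, by a linear map whose kernel is the
  subspace divided out. Identities in the quotient can thus be checked in a type of
  class \<open>ab_group_add\<close>.\<close>

lemma (in pm_quotient) embedding:
  obtains R :: "('b \<Rightarrow>\<^sub>0 complex) \<Rightarrow> ('b \<Rightarrow>\<^sub>0 complex) set" and E
  where "\<And>v. R v \<in> carrier (quot M N)"
    and "\<And>X. X \<in> carrier (quot M N) \<Longrightarrow> R (E X) = X"
    and "\<And>X Y. X \<in> carrier (quot M N) \<Longrightarrow> Y \<in> carrier (quot M N) \<Longrightarrow> E (X \<oplus>\<^bsub>quot M N\<^esub> Y) = E X + E Y"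
    and "\<And>c X. X \<in> carrier (quot M N) \<Longrightarrow> E (c \<odot>\<^bsub>quot M N\<^esub> X) = scale_pm c (E X)"
    and "\<And>u v. R (u + v) = R u \<oplus>\<^bsub>quot M N\<^esub> R v"
    and "\<And>c v. R (scale_pm c v) = c \<odot>\<^bsub>quot M N\<^esub> R v"
proof -
  obtain \<pi> :: "('b \<Rightarrow>\<^sub>0 complex) \<Rightarrow> ('b \<Rightarrow>\<^sub>0 complex)"
    where \<pi>: "pm_linear \<pi>" "\<And>x. \<pi> x = 0 \<longleftrightarrow> x \<in> N"
    using exists_linear_with_kernel[OF subspace] by blast
  have "pm.subspace (\<pi> ` carrier M)"
    by (rule pmp.linear_subspace_image[OF \<pi>(1) subspace_carrier])
  \<comment> \<open>\<open>q\<close> is a linear projection of the ambient type onto the image of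
    the carrier. It makes \<open>R\<close> linear and defined on every vector, including those
    outside the range of \<open>E\<close>.\<close>
  from pmp.linear_exists_left_inverse_on[OF pm.linear_id this]
  obtain q where q: "range q \<subseteq> \<pi> ` carrier M" "pm_linear q" "\<And>v. v \<in> \<pi> ` carrier M \<Longrightarrow> q v = v"
    by auto
  \<comment> \<open>The chosen representative does not matter, because \<open>\<pi>\<close> vanishes
    on differences of representatives; likewise \<open>cos (s v)\<close> depends only on
    \<open>q v\<close>.\<close>
  define E where "E X = \<pi> (SOME x. X = cos x)" for X
  define s where "s v = (SOME x. x \<in> carrier M \<and> \<pi> x = q v)" for v
  have s: "s v \<in> carrier M \<and> \<pi> (s v) = q v" for v
  proof -
    have "q v \<in> \<pi> ` carrier M" using q(1) by blast
    then have "\<exists>x. x \<in> carrier M \<and> \<pi> x = q v" by auto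
    then show ?thesis unfolding s_def by (rule someI_ex)
  qed
  have E_cos: "E (cos x) = \<pi> x" for x
  proof -
    have "cos x = cos (SOME y. cos x = cos y)"
      by (rule someI[of "\<lambda>y. cos x = cos y"]) (rule refl)
    then have "\<pi> (x - (SOME y. cos x = cos y)) = 0"
      unfolding \<pi>(2) by (simp only: cos_eq_iff[symmetric])
    then show ?thesis
      by (simp add: E_def pmp.linear_diff[OF \<pi>(1)])
  qed
  have cos_s: "cos (s v) = cos x" if "\<pi> x = q v" for v x
    unfolding cos_eq_iff \<pi>(2)[symmetric] using s that by (simp add: pmp.linear_diff[OF \<pi>(1)])
  show ?thesis
  proof (rule that[of "\<lambda>v. cos (s v)" E])
    show "cos (s v) \<in> carrier (quot M N)" for v
      using s cos_closed by blast
    show "cos (s (E X)) = X" if X: "X \<in> carrier (quot M N)" for X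
    proof -
      obtain x where x: "x \<in> carrier M" "X = cos x" using X by (rule quot_cases)
      then show ?thesis using q(3) by (simp add: E_cos cos_s)
    qed
    show "E (X \<oplus>\<^bsub>quot M N\<^esub> Y) = E X + E Y" if X: "X \<in> carrier (quot M N)" and Y: "Y \<in> carrier (quot M N)" for X Y
    proof -
      obtain x where x: "X = cos x" using X by (rule quot_cases)
      obtain y where y: "Y = cos y" using Y by (rule quot_cases)
      show ?thesis by (simp add: x y add_quot E_cos pmp.linear_add[OF \<pi>(1)])
    qed
    show "E (c \<odot>\<^bsub>quot M N\<^esub> X) = scale_pm c (E X)" if X: "X \<in> carrier (quot M N)" for c X
    proof -
      obtain x where x: "X = cos x" using X by (rule quot_cases)
      show ?thesis by (simp add: x smult_quot E_cos pmp.linear_scale[OF \<pi>(1)])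
    qed
    show "cos (s (u + v)) = cos (s u) \<oplus>\<^bsub>quot M N\<^esub> cos (s v)" for u v
      unfolding add_quot by (rule cos_s) (simp add: pmp.linear_add[OF \<pi>(1)] pmp.linear_add[OF q(2)] s)
    show "cos (s (scale_pm c v)) = c \<odot>\<^bsub>quot M N\<^esub> cos (s v)" for c v
      unfolding smult_quot by (rule cos_s) (simp add: pmp.linear_scale[OF \<pi>(1)] pmp.linear_scale[OF q(2)] s)
  qed
qed

section \<open>Free and enveloping algebras\<close>

lemma scale_pm_basis_el: "scale_pm c (basis_el b) = Poly_Mapping.single b c"
  by (rule poly_mapping_eqI) (simp add: lookup_scale_pm lookup_single when_def)

text \<open>Scalars sit in the monoid algebra at the neutral word and are central there. Hence a
  two-sided ideal of the free algebra is automatically a subspace.\<close>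

lemma scale_pm_eq_mult:
  fixes f :: "'a::monoid_add \<Rightarrow>\<^sub>0 complex"
  shows "Poly_Mapping.single 0 c * f = scale_pm c f" "f * Poly_Mapping.single 0 c = scale_pm c f"
proof -
  have f: "f = (\<Sum>k\<in>Poly_Mapping.keys f. Poly_Mapping.single k (Poly_Mapping.lookup f k))"
    using pm_expand[of f] by (simp add: scale_pm_basis_el)
  have single: "scale_pm c (Poly_Mapping.single k a) = Poly_Mapping.single k (c * a)" for k :: 'a and a
    by (rule poly_mapping_eqI) (simp add: lookup_scale_pm lookup_single when_def)
  have "scale_pm c f = (\<Sum>k\<in>Poly_Mapping.keys f. Poly_Mapping.single k (c * Poly_Mapping.lookup f k))"
    by (subst f) (simp only: pm.scale_sum_right single)
  moreover have "Poly_Mapping.single 0 c * f = (\<Sum>k\<in>Poly_Mapping.keys f. Poly_Mapping.single k (c * Poly_Mapping.lookup f k))"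
    by (subst f) (simp only: sum_distrib_left mult_single add_0_left)
  moreover have "f * Poly_Mapping.single 0 c = (\<Sum>k\<in>Poly_Mapping.keys f. Poly_Mapping.single k (c * Poly_Mapping.lookup f k))"
    by (subst f) (simp only: sum_distrib_right mult_single add_0_right mult.commute)
  ultimately show "Poly_Mapping.single 0 c * f = scale_pm c f" "f * Poly_Mapping.single 0 c = scale_pm c f"
    by simp_all
qed

lemma scale_pm_mult_left: "scale_pm c f * g = scale_pm c (f * g)"
  for f g :: "'a::monoid_add \<Rightarrow>\<^sub>0 complex"
  by (simp only: scale_pm_eq_mult(1)[symmetric] mult.assoc)

lemma scale_pm_mult_right: "f * scale_pm c g = scale_pm c (f * g)"
  for f g :: "'a::monoid_add \<Rightarrow>\<^sub>0 complex"
  by (simp only: scale_pm_eq_mult(2)[symmetric] mult.assoc)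

lemma pm_linear_mult: "pm_linear (\<lambda>f. f * g)" "pm_linear (\<lambda>f. g * f)"
  for g :: "'a::monoid_add \<Rightarrow>\<^sub>0 complex"
  by (auto intro!: pm_linearI simp: algebra_simps scale_pm_mult_left scale_pm_mult_right)

lemma Letters_zero: "(0::'a letters) = Letters []" and Letters_plus: "Letters u + Letters v = Letters (u @ v)"
  by (simp_all add: zero_letters_def plus_letters_def)

lemma letters_plus [simp]: "letters (u + v) = letters u @ letters v" and letters_0 [simp]: "letters 0 = []"
  by (simp_all add: zero_letters_def plus_letters_def)

lemma free_alg_simps [simp]:
  "mult (free_alg L) = (*)" "one (free_alg L) = 1" "add (free_alg L) = (+)" "zero (free_alg L) = 0"
  "smult (free_alg L) = scale_pm"
  by (simp_all add: free_alg_def)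

lemma free_alg_carrier: "carrier (free_alg L) = pm.span (basis_el ` {u. set (letters u) \<subseteq> L})"
  by (auto simp: free_alg_def carrier_free_vs[symmetric])

lemma pm_space_free_alg: "pm_space (free_alg L)"
  by unfold_locales (auto simp: free_alg_carrier pm.subspace_span)

lemma gen_in_free_alg: "x \<in> L \<Longrightarrow> gen x \<in> carrier (free_alg L)"
  by (simp add: free_alg_def)

lemma one_in_free_alg: "1 \<in> carrier (free_alg L)"
  by (simp add: free_alg_def)

lemma mult_in_free_alg:
  assumes "f \<in> carrier (free_alg L)" "g \<in> carrier (free_alg L)"
  shows "f * g \<in> carrier (free_alg L)"
  using assms keys_mult[of f g] by (fastforce simp: free_alg_def)

lemma ring_free_alg: "ring (free_alg L)"
proof (rule ringI)
  show "abelian_group (free_alg L)"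
    by (rule pm_space.abelian_group[OF pm_space_free_alg])
  show "Group.monoid (free_alg L)"
    by (rule monoidI) (auto simp: mult_in_free_alg one_in_free_alg mult.assoc)
qed (auto simp: algebra_simps)

section \<open>The enveloping algebra by generators and relators\<close>

locale closed_lie_alg =
  fixes L :: "'a lie_alg"
  assumes add_closed: "x \<in> carrier L \<Longrightarrow> y \<in> carrier L \<Longrightarrow> x \<oplus>\<^bsub>L\<^esub> y \<in> carrier L"
    and smult_closed: "x \<in> carrier L \<Longrightarrow> c \<odot>\<^bsub>L\<^esub> x \<in> carrier L"
    and bracket_closed: "x \<in> carrier L \<Longrightarrow> y \<in> carrier L \<Longrightarrow> lie_bracket L x y \<in> carrier L"
begin

definition env_relators :: "('a letters \<Rightarrow>\<^sub>0 complex) set" where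
  "env_relators = {gen (x \<oplus>\<^bsub>L\<^esub> y) - gen x - gen y | x y. x \<in> carrier L \<and> y \<in> carrier L}
    \<union> {gen (c \<odot>\<^bsub>L\<^esub> x) - scale_pm c (gen x) | c x. x \<in> carrier L}
    \<union> {gen x * gen y - gen y * gen x - gen (lie_bracket L x y) | x y. x \<in> carrier L \<and> y \<in> carrier L}"

abbreviation "F \<equiv> free_alg (carrier L)"

lemma env_relators_subset: "env_relators \<subseteq> carrier F"
proof -
  note sub = pm_space.subspace_carrier[OF pm_space_free_alg]
  note [intro!] = pm.subspace_diff[OF sub] pm.subspace_scale[OF sub] gen_in_free_alg mult_in_free_alg
    add_closed smult_closed bracket_closed
  show ?thesis by (auto simp: env_relators_def)
qed

lemma env_ideal_eq: "env_ideal L = genideal F env_relators"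
  by (simp only: env_ideal_def env_relators_def)

lemma ideal_env: "ideal (env_ideal L) F"
  unfolding env_ideal_eq by (rule ring.genideal_ideal[OF ring_free_alg env_relators_subset])

lemma env_relators_in_ideal: "r \<in> env_relators \<Longrightarrow> r \<in> env_ideal L"
  unfolding env_ideal_eq using ring.genideal_self[OF ring_free_alg env_relators_subset] by blast

lemma env_ideal_minimal: "ideal I F \<Longrightarrow> env_relators \<subseteq> I \<Longrightarrow> env_ideal L \<subseteq> I"
  unfolding env_ideal_eq by (rule ring.genideal_minimal[OF ring_free_alg])

lemma scalar_in_free_alg: "Poly_Mapping.single 0 c \<in> carrier (free_alg K)"
  by (simp add: free_alg_def)

sublocale env: pm_quotient F "env_ideal L"
proof -
  interpret I: ideal "env_ideal L" F by (rule ideal_env)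
  have "pm.subspace (env_ideal L)"
  proof (rule pm.subspaceI)
    show "0 \<in> env_ideal L" using additive_subgroup.zero_closed[OF I.is_additive_subgroup] by simp
    show "x + y \<in> env_ideal L" if "x \<in> env_ideal L" "y \<in> env_ideal L" for x y
      using additive_subgroup.a_closed[OF I.is_additive_subgroup that] by simp
    show "scale_pm c x \<in> env_ideal L" if "x \<in> env_ideal L" for c x
      using I.I_l_closed[OF that scalar_in_free_alg[of c]] by (simp add: scale_pm_eq_mult)
  qed
  then show "pm_quotient F (env_ideal L)"
    using I.a_subset by (intro pm_quotient.intro pm_space_free_alg pm_quotient_axioms.intro)
qed

lemma mult_env:
  "x \<in> carrier F \<Longrightarrow> y \<in> carrier F \<Longrightarrow> env.cos x \<otimes>\<^bsub>env L\<^esub> env.cos y = env.cos (x * y)"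
  using ideal.rcoset_mult_add[OF ideal_env, of x y] by (simp add: env_def quot_def FactRing_def)

lemma one_env: "\<one>\<^bsub>env L\<^esub> = env.cos 1"
  by (simp add: env_def quot_def FactRing_def)

lemma env_in_eq: "env_in L x = env.cos (gen x)"
  by (simp add: env_in_def)

lemma env_cases:
  assumes "X \<in> carrier (env L)"
  obtains x where "x \<in> carrier F" "X = env.cos x"
  using assms unfolding env_def by (rule env.quot_cases)

lemma env_cos_closed: "x \<in> carrier F \<Longrightarrow> env.cos x \<in> carrier (env L)"
  unfolding env_def by (rule env.cos_closed)

lemma env_in_closed: "x \<in> carrier L \<Longrightarrow> env_in L x \<in> carrier (env L)"
  by (simp add: env_in_eq env_cos_closed gen_in_free_alg)

lemma env_mult_closed:
  assumes "X \<in> carrier (env L)" "Y \<in> carrier (env L)"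
  shows "X \<otimes>\<^bsub>env L\<^esub> Y \<in> carrier (env L)"
proof -
  obtain x where x: "x \<in> carrier F" "X = env.cos x" using assms(1) by (rule env_cases)
  obtain y where y: "y \<in> carrier F" "Y = env.cos y" using assms(2) by (rule env_cases)
  have "env.cos x \<otimes>\<^bsub>env L\<^esub> env.cos y = env.cos (x * y)"
    by (rule mult_env[OF x(1) y(1)])
  moreover have "env.cos (x * y) \<in> carrier (env L)"
    by (rule env_cos_closed[OF mult_in_free_alg[OF x(1) y(1)]])
  ultimately show ?thesis
    by (simp only: x(2) y(2))
qed

lemma env_bracket:
  assumes "x \<in> carrier L" "y \<in> carrier L"
  shows "env.cos (gen (lie_bracket L x y)) = env.cos (gen x * gen y - gen y * gen x)"
proof -
  have "gen x * gen y - gen y * gen x - gen (lie_bracket L x y) \<in> env_ideal L"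
    by (rule env_relators_in_ideal, unfold env_relators_def) (use assms in blast)
  then show ?thesis
    by (simp only: env.cos_eq_iff[symmetric])
qed

end

text \<open>\<open>j\<close> extends to a homomorphism \<open>\<phi>\<close> of free algebras. It
  descends to the enveloping algebras because the preimage of the target ideal is an ideal
  containing all relators. The case of interest is the inclusion of the constant maps.\<close>

lemma env_map_closed:
  assumes "closed_lie_alg L" "closed_lie_alg L'"
    and j: "\<And>x. x \<in> carrier L \<Longrightarrow> j x \<in> carrier L'"
    and "\<And>x y. x \<in> carrier L \<Longrightarrow> y \<in> carrier L \<Longrightarrow> j (x \<oplus>\<^bsub>L\<^esub> y) = j x \<oplus>\<^bsub>L'\<^esub> j y"
    and "\<And>c x. x \<in> carrier L \<Longrightarrow> j (c \<odot>\<^bsub>L\<^esub> x) = c \<odot>\<^bsub>L'\<^esub> j x"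
    and "\<And>x y. x \<in> carrier L \<Longrightarrow> y \<in> carrier L \<Longrightarrow> j (lie_bracket L x y) = lie_bracket L' (j x) (j y)"
    and X: "X \<in> carrier (env L)"
  shows "env_map L' j X \<in> carrier (env L')"
proof -
  interpret L: closed_lie_alg L by fact
  interpret L': closed_lie_alg L' by fact
  define \<phi> where "\<phi> = lin_ext (\<lambda>u. basis_el (Letters (map j (letters u))) :: 'b letters \<Rightarrow>\<^sub>0 complex)"
  have lin: "pm_linear \<phi>" unfolding \<phi>_def by (rule lin_ext_linear)
  have \<phi>_basis: "\<phi> (basis_el u) = basis_el (Letters (map j (letters u)))" for u
    by (simp add: \<phi>_def)
  have \<phi>_gen: "\<phi> (gen x) = gen (j x)" for x by (simp add: \<phi>_basis)
  \<comment> \<open>Both sides are linear in each factor, so multiplicativity is checked on words,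
    one factor at a time; there it is the compatibility of \<open>map\<close> with
    concatenation.\<close>
  have \<phi>_mult: "\<phi> (f * g) = \<phi> f * \<phi> g" for f g
  proof -
    have 1: "\<phi> (basis_el u * g) = \<phi> (basis_el u) * \<phi> g" for u
    proof -
      have "(\<lambda>g. \<phi> (basis_el u * g)) = (\<lambda>g. \<phi> (basis_el u) * \<phi> g)"
      proof (rule pm_linear_eqI)
        show "pm_linear (\<lambda>g. \<phi> (basis_el u * g))"
          using Vector_Spaces.linear_compose[OF pm_linear_mult(2) lin] by (simp add: o_def)
        show "pm_linear (\<lambda>g. \<phi> (basis_el u) * \<phi> g)"
          using Vector_Spaces.linear_compose[OF lin pm_linear_mult(2)] by (simp add: o_def)
      qed (simp add: \<phi>_basis mult_single Letters_plus)
      then show ?thesis by meson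
    qed
    have "(\<lambda>f. \<phi> (f * g)) = (\<lambda>f. \<phi> f * \<phi> g)"
    proof (rule pm_linear_eqI)
      show "pm_linear (\<lambda>f. \<phi> (f * g))"
        using Vector_Spaces.linear_compose[OF pm_linear_mult(1) lin] by (simp add: o_def)
      show "pm_linear (\<lambda>f. \<phi> f * \<phi> g)"
        using Vector_Spaces.linear_compose[OF lin pm_linear_mult(1)] by (simp add: o_def)
    qed (simp add: 1)
    then show ?thesis by meson
  qed
  have \<phi>_carrier: "\<phi> f \<in> carrier L'.F" if "f \<in> carrier L.F" for f
    by (rule pm_linear_into_subspace[OF lin L'.env.subspace_carrier _ that[unfolded free_alg_carrier]])
       (use j in \<open>auto simp: \<phi>_basis free_alg_def subset_iff\<close>)
  \<comment> \<open>\<open>I\<close> is the preimage of the target ideal. By minimality it contains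
    \<open>env_ideal L\<close> as soon as it is an ideal containing the relators.\<close>
  define I where "I = {f \<in> carrier L.F. \<phi> f \<in> env_ideal L'}"
  have sub_I: "pm.subspace I"
    unfolding I_def using L.env.subspace_carrier L'.env.subspace
    by (auto intro!: pm.subspaceI simp: pmp.linear_0[OF lin] pmp.linear_add[OF lin] pmp.linear_scale[OF lin]
        pm.subspace_0 pm.subspace_add pm.subspace_scale)
  have "ideal I L.F"
  proof (rule idealI[OF ring_free_alg])
    show "subgroup I (add_monoid L.F)"
      using L.env.submodule_iff[of I] sub_I unfolding submodule_def by (auto simp: I_def)
    fix a x assume "a \<in> I" "x \<in> carrier L.F"
    then have ax: "a \<in> carrier L.F" "\<phi> a \<in> env_ideal L'" "x \<in> carrier L.F" "\<phi> x \<in> carrier L'.F"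
      by (simp_all add: I_def \<phi>_carrier)
    show "x \<otimes>\<^bsub>L.F\<^esub> a \<in> I" "a \<otimes>\<^bsub>L.F\<^esub> x \<in> I"
      using ideal.I_l_closed[OF L'.ideal_env ax(2,4)] ideal.I_r_closed[OF L'.ideal_env ax(2,4)]
      by (simp_all add: I_def \<phi>_mult mult_in_free_alg ax)
  qed
  moreover have "\<phi> r \<in> L'.env_relators" if r: "r \<in> L.env_relators" for r
    using r unfolding L.env_relators_def Un_iff
  proof (elim disjE)
    assume "r \<in> {gen (x \<oplus>\<^bsub>L\<^esub> y) - gen x - gen y | x y. x \<in> carrier L \<and> y \<in> carrier L}"
    then obtain x y where xy: "x \<in> carrier L" "y \<in> carrier L" "r = gen (x \<oplus>\<^bsub>L\<^esub> y) - gen x - gen y"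
      by blast
    have "\<phi> r = gen (j x \<oplus>\<^bsub>L'\<^esub> j y) - gen (j x) - gen (j y)"
      by (simp only: xy(3) pmp.linear_diff[OF lin] \<phi>_gen assms(4)[OF xy(1,2)])
    then show ?thesis unfolding L'.env_relators_def using j xy(1,2) by blast
  next
    assume "r \<in> {gen (c \<odot>\<^bsub>L\<^esub> x) - scale_pm c (gen x) | c x. x \<in> carrier L}"
    then obtain c x where xy: "x \<in> carrier L" "r = gen (c \<odot>\<^bsub>L\<^esub> x) - scale_pm c (gen x)"
      by blast
    have "\<phi> r = gen (c \<odot>\<^bsub>L'\<^esub> j x) - scale_pm c (gen (j x))"
      by (simp only: xy(2) pmp.linear_diff[OF lin] pmp.linear_scale[OF lin] \<phi>_gen assms(5)[OF xy(1)])
    then show ?thesis unfolding L'.env_relators_def using j xy(1) by blast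
  next
    assume "r \<in> {gen x * gen y - gen y * gen x - gen (lie_bracket L x y) | x y. x \<in> carrier L \<and> y \<in> carrier L}"
    then obtain x y where xy: "x \<in> carrier L" "y \<in> carrier L"
        "r = gen x * gen y - gen y * gen x - gen (lie_bracket L x y)"
      by blast
    have "\<phi> r = gen (j x) * gen (j y) - gen (j y) * gen (j x) - gen (lie_bracket L' (j x) (j y))"
      by (simp only: xy(3) pmp.linear_diff[OF lin] \<phi>_gen \<phi>_mult assms(6)[OF xy(1,2)])
    then show ?thesis unfolding L'.env_relators_def using j xy(1,2) by blast
  qed
  then have "L.env_relators \<subseteq> I"
    using L.env_relators_subset L'.env_relators_in_ideal unfolding I_def by blast
  ultimately have ker: "\<phi> n \<in> env_ideal L'" if "n \<in> env_ideal L" for n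
    using L.env_ideal_minimal that by (auto simp: I_def)
  obtain x where x: "x \<in> carrier L.F" "X = L.env.cos x" using X by (rule L.env_cases)
  have "env_map L' j X = L'.env.cos (\<phi> x)"
    unfolding x(2) env_map_def \<phi>_def[symmetric]
    by (rule L.env.quot_map_cos[OF L'.env.pm_quotient_axioms lin ker])
  then show ?thesis
    using L'.env_cos_closed[OF \<phi>_carrier[OF x(1)]] by simp
qed


context closed_lie_alg
begin

lemma env_smult: "c \<odot>\<^bsub>env L\<^esub> env.cos x = env.cos (scale_pm c x)"
  unfolding env_def by (rule env.smult_quot)

lemma env_add: "env.cos x \<oplus>\<^bsub>env L\<^esub> env.cos y = env.cos (x + y)"
  unfolding env_def by (rule env.add_quot)

lemma env_module: "Module.module complex_field (env L)"
  unfolding env_def by (rule env.module_quot)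

lemma env_add_closed:
  assumes "X \<in> carrier (env L)" "Y \<in> carrier (env L)"
  shows "X \<oplus>\<^bsub>env L\<^esub> Y \<in> carrier (env L)"
proof -
  interpret Module.module complex_field "env L" by (rule env_module)
  show ?thesis using assms by (rule M.add.m_closed)
qed

lemma env_smult_closed:
  assumes "X \<in> carrier (env L)"
  shows "c \<odot>\<^bsub>env L\<^esub> X \<in> carrier (env L)"
proof -
  interpret Module.module complex_field "env L" by (rule env_module)
  show ?thesis using assms by (intro smult_closed) simp
qed

lemma env_mult_add:
  assumes "X \<in> carrier (env L)" "Y \<in> carrier (env L)" "Z \<in> carrier (env L)"
  shows "X \<otimes>\<^bsub>env L\<^esub> (Y \<oplus>\<^bsub>env L\<^esub> Z) = X \<otimes>\<^bsub>env L\<^esub> Y \<oplus>\<^bsub>env L\<^esub> X \<otimes>\<^bsub>env L\<^esub> Z"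
proof -
  obtain x where x: "x \<in> carrier F" "X = env.cos x" using assms(1) by (rule env_cases)
  obtain y where y: "y \<in> carrier F" "Y = env.cos y" using assms(2) by (rule env_cases)
  obtain z where z: "z \<in> carrier F" "Z = env.cos z" using assms(3) by (rule env_cases)
  show ?thesis
    by (simp only: x(2) y(2) z(2) env_add mult_env x(1) y(1) z(1) distrib_left
        pm.subspace_add[OF env.subspace_carrier])
qed

lemma env_mult_smult:
  assumes "X \<in> carrier (env L)" "Y \<in> carrier (env L)"
  shows "X \<otimes>\<^bsub>env L\<^esub> (c \<odot>\<^bsub>env L\<^esub> Y) = c \<odot>\<^bsub>env L\<^esub> (X \<otimes>\<^bsub>env L\<^esub> Y)"
proof -
  obtain x where x: "x \<in> carrier F" "X = env.cos x" using assms(1) by (rule env_cases)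
  obtain y where y: "y \<in> carrier F" "Y = env.cos y" using assms(2) by (rule env_cases)
  show ?thesis
    by (simp only: x(2) y(2) env_smult mult_env x(1) y(1) scale_pm_mult_right
        pm.subspace_scale[OF env.subspace_carrier])
qed

lemma env_mult_assoc:
  assumes "X \<in> carrier (env L)" "Y \<in> carrier (env L)" "Z \<in> carrier (env L)"
  shows "(X \<otimes>\<^bsub>env L\<^esub> Y) \<otimes>\<^bsub>env L\<^esub> Z = X \<otimes>\<^bsub>env L\<^esub> (Y \<otimes>\<^bsub>env L\<^esub> Z)"
proof -
  obtain x where x: "x \<in> carrier F" "X = env.cos x" using assms(1) by (rule env_cases)
  obtain y where y: "y \<in> carrier F" "Y = env.cos y" using assms(2) by (rule env_cases)
  obtain z where z: "z \<in> carrier F" "Z = env.cos z" using assms(3) by (rule env_cases)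
  show ?thesis
    by (simp only: x(2) y(2) z(2) mult_env x(1) y(1) z(1) mult_in_free_alg mult.assoc)
qed

lemma one_env_closed: "\<one>\<^bsub>env L\<^esub> \<in> carrier (env L)"
  unfolding one_env by (rule env_cos_closed[OF one_in_free_alg])

lemma env_in_mult_one:
  assumes "x \<in> carrier L"
  shows "env_in L x \<otimes>\<^bsub>env L\<^esub> \<one>\<^bsub>env L\<^esub> = env_in L x"
  by (simp only: env_in_eq one_env mult_env gen_in_free_alg[OF assms] one_in_free_alg mult_1_right)

text \<open>The relation \<open>[x, y] = x y - y x\<close>, multiplied by \<open>U\<close> and
  written without subtraction. In this form it matches a left additivity relator of the induced
  module.\<close>

lemma env_in_bracket_mult:
  assumes "x \<in> carrier L" "y \<in> carrier L" "U \<in> carrier (env L)"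
  shows "env_in L (lie_bracket L x y) \<otimes>\<^bsub>env L\<^esub> U \<oplus>\<^bsub>env L\<^esub> env_in L y \<otimes>\<^bsub>env L\<^esub> (env_in L x \<otimes>\<^bsub>env L\<^esub> U)
       = env_in L x \<otimes>\<^bsub>env L\<^esub> (env_in L y \<otimes>\<^bsub>env L\<^esub> U)"
proof -
  obtain u where u: "u \<in> carrier F" "U = env.cos u" using assms(3) by (rule env_cases)
  note g = gen_in_free_alg[OF assms(1)] gen_in_free_alg[OF assms(2)]
  have "gen x * gen y - gen y * gen x \<in> carrier F"
    by (intro pm.subspace_diff[OF env.subspace_carrier] mult_in_free_alg g)
  then have "env_in L (lie_bracket L x y) \<otimes>\<^bsub>env L\<^esub> U = env.cos ((gen x * gen y - gen y * gen x) * u)"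
    by (simp only: u(2) env_in_eq env_bracket[OF assms(1,2)] mult_env u(1))
  moreover have "env_in L y \<otimes>\<^bsub>env L\<^esub> (env_in L x \<otimes>\<^bsub>env L\<^esub> U) = env.cos (gen y * gen x * u)"
    by (simp only: u(2) env_in_eq mult_env u(1) g mult_in_free_alg mult.assoc)
  moreover have "env_in L x \<otimes>\<^bsub>env L\<^esub> (env_in L y \<otimes>\<^bsub>env L\<^esub> U) = env.cos (gen x * gen y * u)"
    by (simp only: u(2) env_in_eq mult_env u(1) g mult_in_free_alg mult.assoc)
  ultimately show ?thesis
    by (simp only: env_add left_diff_distrib diff_add_cancel)
qed

end

section \<open>Tensor products of representations\<close>

lemma lie_rep_module: "lie_rep sg br W \<rho> \<Longrightarrow> Module.module complex_field W"
  and lie_rep_closed: "lie_rep sg br W \<rho> \<Longrightarrow> v \<in> carrier W \<Longrightarrow> \<rho> x v \<in> carrier W"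
  and lie_rep_add: "lie_rep sg br W \<rho> \<Longrightarrow> v \<in> carrier W \<Longrightarrow> v' \<in> carrier W \<Longrightarrow> \<rho> x (v \<oplus>\<^bsub>W\<^esub> v') = \<rho> x v \<oplus>\<^bsub>W\<^esub> \<rho> x v'"
  and lie_rep_smult: "lie_rep sg br W \<rho> \<Longrightarrow> v \<in> carrier W \<Longrightarrow> \<rho> x (c \<odot>\<^bsub>W\<^esub> v) = c \<odot>\<^bsub>W\<^esub> \<rho> x v"
  and lie_rep_bracket: "lie_rep sg br W \<rho> \<Longrightarrow> v \<in> carrier W \<Longrightarrow> \<rho> (br x y) v = \<rho> x (\<rho> y v) \<ominus>\<^bsub>W\<^esub> \<rho> y (\<rho> x v)"
  unfolding lie_rep_def by blast+

locale lie_reps =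
  fixes sg :: "complex \<Rightarrow> 'g::ab_group_add \<Rightarrow> 'g" and br
    and W :: "'n::finite \<Rightarrow> (complex, 'w) module" and \<rho> :: "'n \<Rightarrow> 'g \<Rightarrow> 'w \<Rightarrow> 'w"
  assumes rep: "\<And>k. lie_rep sg br (W k) (\<rho> k)"
begin

text \<open>Names the generating set of \<open>multi_tensor_rel\<close>, so that its relators can be
  produced and distinguished by cases.\<close>

definition multi_relators :: "(('n \<Rightarrow> 'w) \<Rightarrow>\<^sub>0 complex) set" where
  "multi_relators =
     {basis_el (w(k := a \<oplus>\<^bsub>W k\<^esub> b)) - basis_el (w(k := a)) - basis_el (w(k := b)) | w k a b.
         w \<in> tuples W \<and> a \<in> carrier (W k) \<and> b \<in> carrier (W k)}
    \<union> {basis_el (w(k := c \<odot>\<^bsub>W k\<^esub> a)) - scale_pm c (basis_el (w(k := a))) | w k c a.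
         w \<in> tuples W \<and> a \<in> carrier (W k)}"

lemma add_relator: "w \<in> tuples W \<Longrightarrow> a \<in> carrier (W k) \<Longrightarrow> b \<in> carrier (W k) \<Longrightarrow>
    basis_el (w(k := a \<oplus>\<^bsub>W k\<^esub> b)) - basis_el (w(k := a)) - basis_el (w(k := b)) \<in> multi_relators"
  unfolding multi_relators_def by blast

lemma smult_relator: "w \<in> tuples W \<Longrightarrow> a \<in> carrier (W k) \<Longrightarrow>
    basis_el (w(k := c \<odot>\<^bsub>W k\<^esub> a)) - scale_pm c (basis_el (w(k := a))) \<in> multi_relators"
  unfolding multi_relators_def by blast

lemma multi_relator_cases:
  assumes "r \<in> multi_relators"
  obtains (add) w k a b where "w \<in> tuples W" "a \<in> carrier (W k)" "b \<in> carrier (W k)"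
      "r = basis_el (w(k := a \<oplus>\<^bsub>W k\<^esub> b)) - basis_el (w(k := a)) - basis_el (w(k := b))"
    | (smult) w k c a where "w \<in> tuples W" "a \<in> carrier (W k)"
      "r = basis_el (w(k := c \<odot>\<^bsub>W k\<^esub> a)) - scale_pm c (basis_el (w(k := a)))"
  using assms unfolding multi_relators_def by blast

lemma W_add_closed: "a \<in> carrier (W k) \<Longrightarrow> b \<in> carrier (W k) \<Longrightarrow> a \<oplus>\<^bsub>W k\<^esub> b \<in> carrier (W k)"
proof -
  interpret Module.module complex_field "W k" by (rule lie_rep_module[OF rep])
  show "a \<in> carrier (W k) \<Longrightarrow> b \<in> carrier (W k) \<Longrightarrow> a \<oplus>\<^bsub>W k\<^esub> b \<in> carrier (W k)" by (rule M.add.m_closed)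
qed

lemma W_smult_closed: "a \<in> carrier (W k) \<Longrightarrow> c \<odot>\<^bsub>W k\<^esub> a \<in> carrier (W k)"
proof -
  interpret Module.module complex_field "W k" by (rule lie_rep_module[OF rep])
  show "a \<in> carrier (W k) \<Longrightarrow> c \<odot>\<^bsub>W k\<^esub> a \<in> carrier (W k)" by (intro smult_closed) simp
qed

lemma tuples_upd: "w \<in> tuples W \<Longrightarrow> a \<in> carrier (W k) \<Longrightarrow> w(k := a) \<in> tuples W"
  by (auto simp: tuples_def)

lemma tuples_rho: "w \<in> tuples W \<Longrightarrow> \<rho> k x (w k) \<in> carrier (W k)"
  using lie_rep_closed[OF rep] by (auto simp: tuples_def)

lemma multi_relators_subset: "multi_relators \<subseteq> carrier (free_vs (tuples W))"
proof
  fix r assume "r \<in> multi_relators"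
  note sub = pm_space.subspace_carrier[OF pm_space_free_vs]
  from \<open>r \<in> multi_relators\<close> show "r \<in> carrier (free_vs (tuples W))"
  proof (cases rule: multi_relator_cases)
    case (add w k a b)
    show ?thesis
      unfolding add(4)
      by (intro pm.subspace_diff[OF sub] basis_el_in_free_vs tuples_upd W_add_closed add(1,2,3))
  next
    case (smult w k c a)
    show ?thesis
      unfolding smult(3)
      by (intro pm.subspace_diff[OF sub] pm.subspace_scale[OF sub] basis_el_in_free_vs tuples_upd
          W_smult_closed smult(1,2))
  qed
qed

lemma multi_tensor_rel_eq: "multi_tensor_rel W = pm.span multi_relators"
  unfolding multi_tensor_rel_def multi_relators_def[symmetric]
  by (rule pm_space.subspace_gen_eq_span[OF pm_space_free_vs multi_relators_subset])

sublocale mt: pm_quotient "free_vs (tuples W)" "multi_tensor_rel W"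
  unfolding multi_tensor_rel_eq by (rule pm_quotient_span[OF pm_space_free_vs multi_relators_subset])

lemma multi_relator_in_rel: "r \<in> multi_relators \<Longrightarrow> r \<in> multi_tensor_rel W"
  unfolding multi_tensor_rel_eq by (rule pm.span_base)

definition act_sum :: "'g \<Rightarrow> ('n \<Rightarrow> 'w) \<Rightarrow> ('n \<Rightarrow> 'w) \<Rightarrow>\<^sub>0 complex" where
  "act_sum x w = (\<Sum>k\<in>UNIV. basis_el (w(k := \<rho> k x (w k))))"

text \<open>Separates the slot \<open>k\<close> in which a relator varies from the other slots,
  where the updates commute with the one at \<open>k\<close>.\<close>

lemma act_sum_upd:
  "act_sum x (w(k := a)) = basis_el (w(k := \<rho> k x a)) + (\<Sum>i\<in>-{k}. basis_el ((w(i := \<rho> i x (w i)))(k := a)))"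
proof -
  have "act_sum x (w(k := a)) = basis_el (w(k := \<rho> k x a)) +
      (\<Sum>i\<in>UNIV-{k}. basis_el ((w(k := a))(i := \<rho> i x ((w(k := a)) i))))"
    unfolding act_sum_def by (subst sum.remove[of UNIV k]) (simp_all del: fun_upd_apply add: fun_upd_same)
  also have "(\<Sum>i\<in>UNIV-{k}. basis_el ((w(k := a))(i := \<rho> i x ((w(k := a)) i)))) =
      (\<Sum>i\<in>-{k}. basis_el ((w(i := \<rho> i x (w i)))(k := a)) :: _ \<Rightarrow>\<^sub>0 complex)"
    by (intro sum.cong) (auto simp: fun_upd_twist)
  finally show ?thesis .
qed

text \<open>By the Leibniz rule, a relator in slot \<open>k\<close> is sent to a sum of relators in
  the same slot: one with its entries acted upon, and for every \<open>i\<close> other than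
  \<open>k\<close> one with the same entries and a changed factor at \<open>i\<close>.\<close>

lemma tensor_act_relators:
  assumes "r \<in> multi_tensor_rel W"
  shows "lin_ext (act_sum x) r \<in> multi_tensor_rel W"
proof (rule pm_linear_into_subspace[OF lin_ext_linear mt.subspace _ assms[unfolded multi_tensor_rel_eq]])
  fix r assume "r \<in> multi_relators"
  then show "lin_ext (act_sum x) r \<in> multi_tensor_rel W"
  proof (cases rule: multi_relator_cases)
    case (add w k a b)
    let ?R = "\<lambda>w a b. basis_el (w(k := a \<oplus>\<^bsub>W k\<^esub> b)) - basis_el (w(k := a)) - basis_el (w(k := b))"
    have "lin_ext (act_sum x) r = ?R w (\<rho> k x a) (\<rho> k x b) + (\<Sum>i\<in>-{k}. ?R (w(i := \<rho> i x (w i))) a b)"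
      unfolding add(4) pmp.linear_diff[OF lin_ext_linear] lin_ext_basis_el act_sum_upd
      by (simp add: lie_rep_add[OF rep add(2,3)] sum_subtractf)
    also have "\<dots> \<in> multi_tensor_rel W"
      by (intro pm.subspace_add[OF mt.subspace] pm.subspace_sum[OF mt.subspace] multi_relator_in_rel
          add_relator add lie_rep_closed[OF rep] tuples_upd tuples_rho)
    finally show ?thesis .
  next
    case (smult w k c a)
    let ?R = "\<lambda>w a. basis_el (w(k := c \<odot>\<^bsub>W k\<^esub> a)) - scale_pm c (basis_el (w(k := a)))"
    have "lin_ext (act_sum x) r = ?R w (\<rho> k x a) + (\<Sum>i\<in>-{k}. ?R (w(i := \<rho> i x (w i))) a)"
      unfolding smult(3) pmp.linear_diff[OF lin_ext_linear] pmp.linear_scale[OF lin_ext_linear]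
        lin_ext_basis_el act_sum_upd
      by (simp add: lie_rep_smult[OF rep smult(2)] sum_subtractf pm.scale_right_distrib pm.scale_sum_right)
    also have "\<dots> \<in> multi_tensor_rel W"
      by (intro pm.subspace_add[OF mt.subspace] pm.subspace_sum[OF mt.subspace] multi_relator_in_rel
          smult_relator smult lie_rep_closed[OF rep] tuples_upd tuples_rho)
    finally show ?thesis .
  qed
qed

lemma tensor_act_closed:
  assumes "v \<in> carrier (multi_tensor W)"
  shows "tensor_act W \<rho> x v \<in> carrier (multi_tensor W)"
proof -
  obtain f where f: "f \<in> carrier (free_vs (tuples W))" "v = mt.cos f"
    using assms unfolding multi_tensor_def by (rule mt.quot_cases)
  have "tensor_act W \<rho> x v = mt.cos (lin_ext (act_sum x) f)"
    unfolding f(2) tensor_act_def act_sum_def[symmetric]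
    by (rule mt.quot_map_cos[OF mt.pm_quotient_axioms lin_ext_linear tensor_act_relators])
  moreover have "lin_ext (act_sum x) f \<in> carrier (free_vs (tuples W))"
  proof (rule pm_linear_into_subspace[OF lin_ext_linear mt.subspace_carrier _ f(1)[unfolded free_vs_carrier]])
    fix b :: "('n \<Rightarrow> 'w) \<Rightarrow>\<^sub>0 complex" assume "b \<in> basis_el ` tuples W"
    then obtain w where w: "w \<in> tuples W" "b = basis_el w" by blast
    show "lin_ext (act_sum x) b \<in> carrier (free_vs (tuples W))"
      unfolding w(2) lin_ext_basis_el act_sum_def
      by (intro pm.subspace_sum[OF mt.subspace_carrier] basis_el_in_free_vs tuples_upd tuples_rho w(1))
  qed
  ultimately show ?thesis
    unfolding multi_tensor_def by (simp only: mt.cos_closed)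
qed

text \<open>\<open>env_act\<close> picks a representative of the coset; whichever it picks, its
  words act by operators preserving the carrier.\<close>

lemma env_act_closed:
  assumes "v \<in> carrier (multi_tensor W)"
  shows "env_act (multi_tensor W) (tensor_act W \<rho>) X v \<in> carrier (multi_tensor W)"
proof -
  interpret Module.module complex_field "multi_tensor W"
    unfolding multi_tensor_def by (rule mt.module_quot)
  have "foldr (tensor_act W \<rho>) xs v \<in> carrier (multi_tensor W)" for xs
    by (induction xs) (simp_all add: assms tensor_act_closed)
  then show ?thesis
    unfolding env_act_def Let_def by (intro M.finsum_closed Pi_I smult_closed) simp_all
qed

lemma pure_tensor_closed: "w \<in> tuples W \<Longrightarrow> pure_tensor W w \<in> carrier (multi_tensor W)"
  unfolding pure_tensor_def multi_tensor_def by (intro mt.cos_closed basis_el_in_free_vs)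

lemma pure_tensor_add:
  assumes "w \<in> tuples W" "a \<in> carrier (W k)" "b \<in> carrier (W k)"
  shows "pure_tensor W (w(k := a \<oplus>\<^bsub>W k\<^esub> b)) = pure_tensor W (w(k := a)) \<oplus>\<^bsub>multi_tensor W\<^esub> pure_tensor W (w(k := b))"
  unfolding pure_tensor_def multi_tensor_def mt.add_quot mt.cos_eq_iff
  using multi_relator_in_rel[OF add_relator[OF assms]] by (simp only: diff_diff_eq)

lemma pure_tensor_diff:
  assumes "w \<in> tuples W" "a \<in> carrier (W k)" "b \<in> carrier (W k)"
  shows "pure_tensor W (w(k := a)) = pure_tensor W (w(k := a \<ominus>\<^bsub>W k\<^esub> b)) \<oplus>\<^bsub>multi_tensor W\<^esub> pure_tensor W (w(k := b))"
proof -
  interpret Module.module complex_field "W k" by (rule lie_rep_module[OF rep])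
  have "a \<ominus>\<^bsub>W k\<^esub> b \<in> carrier (W k)" using assms by simp
  moreover have "a \<ominus>\<^bsub>W k\<^esub> b \<oplus>\<^bsub>W k\<^esub> b = a"
    using assms by (simp add: a_minus_def M.a_assoc M.l_neg)
  ultimately show ?thesis using pure_tensor_add[OF assms(1) _ assms(3)] by metis
qed

end


section \<open>The induced module\<close>

text \<open>\<open>const_closed\<close> puts the image of the enveloping algebra of the constants
  into the algebra it multiplies. As an assumption it keeps this algebra free of complex analysis;
  \<open>const_env_closed\<close> supplies it.\<close>

locale induced_module =
  lie_reps sg br W \<rho> + L: closed_lie_alg "merom_lie_poles_in sg br D"
  for sg :: "complex \<Rightarrow> 'g::ab_group_add \<Rightarrow> 'g" and br
    and W :: "'n::finite \<Rightarrow> (complex, 'w) module" and \<rho> :: "'n \<Rightarrow> 'g \<Rightarrow> 'w \<Rightarrow> 'w"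
    and D :: "p1 set" +
  assumes const_closed: "\<And>a. a \<in> carrier (env (lie_of_type sg br)) \<Longrightarrow>
    env_map (merom_lie_poles_in sg br D) (\<lambda>x p. x) a \<in> carrier (env (merom_lie_poles_in sg br D))"
begin

abbreviation "LD \<equiv> merom_lie_poles_in sg br D"
abbreviation "UL \<equiv> env LD"
abbreviation "MT \<equiv> multi_tensor W"
abbreviation "M \<equiv> DW sg br W \<rho> D"
abbreviation "FM \<equiv> DW_free sg br W D"

definition DW_relators ::
  "((((p1 \<Rightarrow> 'g) letters \<Rightarrow>\<^sub>0 complex) set \<times> (('n \<Rightarrow> 'w) \<Rightarrow>\<^sub>0 complex) set) \<Rightarrow>\<^sub>0 complex) set" where
  "DW_relators =
     {basis_el (m \<oplus>\<^bsub>UL\<^esub> m', v) - basis_el (m, v) - basis_el (m', v) | m m' v.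
         m \<in> carrier UL \<and> m' \<in> carrier UL \<and> v \<in> carrier MT}
    \<union> {basis_el (m, v \<oplus>\<^bsub>MT\<^esub> v') - basis_el (m, v) - basis_el (m, v') | m v v'.
         m \<in> carrier UL \<and> v \<in> carrier MT \<and> v' \<in> carrier MT}
    \<union> {basis_el (c \<odot>\<^bsub>UL\<^esub> m, v) - scale_pm c (basis_el (m, v)) | c m v. m \<in> carrier UL \<and> v \<in> carrier MT}
    \<union> {basis_el (m, c \<odot>\<^bsub>MT\<^esub> v) - scale_pm c (basis_el (m, v)) | c m v. m \<in> carrier UL \<and> v \<in> carrier MT}
    \<union> {basis_el (m \<otimes>\<^bsub>UL\<^esub> env_map LD (\<lambda>x p. x) a, v) - basis_el (m, env_act MT (tensor_act W \<rho>) a v) | m a v.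
         m \<in> carrier UL \<and> a \<in> carrier (env (lie_of_type sg br)) \<and> v \<in> carrier MT}"

lemma DW_relator_cases:
  assumes "r \<in> DW_relators"
  obtains (add_left) m m' v where "m \<in> carrier UL" "m' \<in> carrier UL" "v \<in> carrier MT"
      "r = basis_el (m \<oplus>\<^bsub>UL\<^esub> m', v) - basis_el (m, v) - basis_el (m', v)"
    | (add_right) m v v' where "m \<in> carrier UL" "v \<in> carrier MT" "v' \<in> carrier MT"
      "r = basis_el (m, v \<oplus>\<^bsub>MT\<^esub> v') - basis_el (m, v) - basis_el (m, v')"
    | (smult_left) c m v where "m \<in> carrier UL" "v \<in> carrier MT"
      "r = basis_el (c \<odot>\<^bsub>UL\<^esub> m, v) - scale_pm c (basis_el (m, v))"
    | (smult_right) c m v where "m \<in> carrier UL" "v \<in> carrier MT"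
      "r = basis_el (m, c \<odot>\<^bsub>MT\<^esub> v) - scale_pm c (basis_el (m, v))"
    | (balance) m a v where "m \<in> carrier UL" "a \<in> carrier (env (lie_of_type sg br))" "v \<in> carrier MT"
      "r = basis_el (m \<otimes>\<^bsub>UL\<^esub> env_map LD (\<lambda>x p. x) a, v) - basis_el (m, env_act MT (tensor_act W \<rho>) a v)"
  using assms unfolding DW_relators_def by blast

lemma
  shows add_left_relator: "m \<in> carrier UL \<Longrightarrow> m' \<in> carrier UL \<Longrightarrow> v \<in> carrier MT \<Longrightarrow>
      basis_el (m \<oplus>\<^bsub>UL\<^esub> m', v) - basis_el (m, v) - basis_el (m', v) \<in> DW_relators"
    and add_right_relator: "m \<in> carrier UL \<Longrightarrow> v \<in> carrier MT \<Longrightarrow> v' \<in> carrier MT \<Longrightarrow>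
      basis_el (m, v \<oplus>\<^bsub>MT\<^esub> v') - basis_el (m, v) - basis_el (m, v') \<in> DW_relators"
    and smult_left_relator: "m \<in> carrier UL \<Longrightarrow> v \<in> carrier MT \<Longrightarrow>
      basis_el (c \<odot>\<^bsub>UL\<^esub> m, v) - scale_pm c (basis_el (m, v)) \<in> DW_relators"
    and smult_right_relator: "m \<in> carrier UL \<Longrightarrow> v \<in> carrier MT \<Longrightarrow>
      basis_el (m, c \<odot>\<^bsub>MT\<^esub> v) - scale_pm c (basis_el (m, v)) \<in> DW_relators"
    and balance_relator: "m \<in> carrier UL \<Longrightarrow> a \<in> carrier (env (lie_of_type sg br)) \<Longrightarrow> v \<in> carrier MT \<Longrightarrow>
      basis_el (m \<otimes>\<^bsub>UL\<^esub> env_map LD (\<lambda>x p. x) a, v) - basis_el (m, env_act MT (tensor_act W \<rho>) a v) \<in> DW_relators"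
  unfolding DW_relators_def by blast+

lemma MT_module: "Module.module complex_field MT"
  unfolding multi_tensor_def by (rule mt.module_quot)

lemma MT_add_closed: "v \<in> carrier MT \<Longrightarrow> v' \<in> carrier MT \<Longrightarrow> v \<oplus>\<^bsub>MT\<^esub> v' \<in> carrier MT"
  and MT_smult_closed: "v \<in> carrier MT \<Longrightarrow> c \<odot>\<^bsub>MT\<^esub> v \<in> carrier MT"
proof -
  interpret Module.module complex_field MT by (rule MT_module)
  show "v \<in> carrier MT \<Longrightarrow> v' \<in> carrier MT \<Longrightarrow> v \<oplus>\<^bsub>MT\<^esub> v' \<in> carrier MT" by (rule M.add.m_closed)
  show "v \<in> carrier MT \<Longrightarrow> c \<odot>\<^bsub>MT\<^esub> v \<in> carrier MT" by (intro smult_closed) simp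
qed

lemma basis_el_closed: "u \<in> carrier UL \<Longrightarrow> v \<in> carrier MT \<Longrightarrow> basis_el (u, v) \<in> carrier FM"
  unfolding DW_free_def by (intro basis_el_in_free_vs SigmaI)

lemmas UL_closed = L.env_add_closed L.env_smult_closed L.env_mult_closed L.env_in_closed
  MT_add_closed MT_smult_closed env_act_closed const_closed

lemma DW_relators_subset: "DW_relators \<subseteq> carrier FM"
proof
  have sub: "pm.subspace (carrier FM)"
    unfolding DW_free_def by (rule pm_space.subspace_carrier[OF pm_space_free_vs])
  fix r assume "r \<in> DW_relators"
  then show "r \<in> carrier FM"
    by (cases rule: DW_relator_cases)
       (simp_all only:, (intro pm.subspace_diff[OF sub] pm.subspace_scale[OF sub] basis_el_closed
          UL_closed; assumption)+)
qed

lemma DW_rel_eq: "DW_rel sg br W \<rho> D = pm.span DW_relators"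
  unfolding DW_rel_def Let_def tensor_over_rel_def DW_relators_def[symmetric] DW_free_def[symmetric]
  by (rule pm_space.subspace_gen_eq_span[OF _ DW_relators_subset])
     (simp add: DW_free_def pm_space_free_vs)

sublocale dw: pm_quotient FM "DW_rel sg br W \<rho> D"
  unfolding DW_rel_eq
  by (rule pm_quotient_span[OF _ DW_relators_subset]) (simp add: DW_free_def pm_space_free_vs)

lemma DW_relator_in_rel: "r \<in> DW_relators \<Longrightarrow> r \<in> DW_rel sg br W \<rho> D"
  unfolding DW_rel_eq by (rule pm.span_base)

lemma M_module: "Module.module complex_field M"
  unfolding DW_def by (rule dw.module_quot)

abbreviation "lact \<equiv> DW_lmult sg br W \<rho> D"
abbreviation "tens \<equiv> DW_tensor sg br W \<rho> D"

definition lmult_fun where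
  "lmult_fun \<alpha> = lin_ext (\<lambda>(u, v). basis_el (env_in LD \<alpha> \<otimes>\<^bsub>UL\<^esub> u, v :: (('n \<Rightarrow> 'w) \<Rightarrow>\<^sub>0 complex) set))"

lemma lmult_fun_linear: "pm_linear (lmult_fun \<alpha>)"
  unfolding lmult_fun_def by (rule lin_ext_linear)

lemma lmult_fun_basis: "lmult_fun \<alpha> (basis_el (u, v)) = basis_el (env_in LD \<alpha> \<otimes>\<^bsub>UL\<^esub> u, v)"
  by (simp add: lmult_fun_def)

text \<open>Left multiplication turns each relator into one of the same kind. Distributivity handles
  sums on the left, and associativity handles the balancing relators, since the balancing takes
  place on the right.\<close>

lemma lmult_fun_rel:
  assumes \<alpha>: "\<alpha> \<in> carrier LD" and n: "n \<in> DW_rel sg br W \<rho> D"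
  shows "lmult_fun \<alpha> n \<in> DW_rel sg br W \<rho> D"
proof (rule pm_linear_into_subspace[OF lmult_fun_linear dw.subspace _ n[unfolded DW_rel_eq]])
  note \<alpha>' = L.env_in_closed[OF \<alpha>]
  fix r assume "r \<in> DW_relators"
  then have "lmult_fun \<alpha> r \<in> DW_relators"
  proof (cases rule: DW_relator_cases)
    case (add_left m m' v)
    show ?thesis
      unfolding add_left(4) pmp.linear_diff[OF lmult_fun_linear] lmult_fun_basis
        L.env_mult_add[OF \<alpha>' add_left(1,2)]
      by (intro add_left_relator L.env_mult_closed \<alpha>' add_left)
  next
    case (add_right m v v')
    show ?thesis
      unfolding add_right(4) pmp.linear_diff[OF lmult_fun_linear] lmult_fun_basis
      by (intro add_right_relator L.env_mult_closed \<alpha>' add_right)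
  next
    case (smult_left c m v)
    show ?thesis
      unfolding smult_left(3) pmp.linear_diff[OF lmult_fun_linear] pmp.linear_scale[OF lmult_fun_linear]
        lmult_fun_basis L.env_mult_smult[OF \<alpha>' smult_left(1)]
      by (intro smult_left_relator L.env_mult_closed \<alpha>' smult_left)
  next
    case (smult_right c m v)
    show ?thesis
      unfolding smult_right(3) pmp.linear_diff[OF lmult_fun_linear] pmp.linear_scale[OF lmult_fun_linear]
        lmult_fun_basis
      by (intro smult_right_relator L.env_mult_closed \<alpha>' smult_right)
  next
    case (balance m a v)
    show ?thesis
      unfolding balance(4) pmp.linear_diff[OF lmult_fun_linear] lmult_fun_basis
        L.env_mult_assoc[OF \<alpha>' balance(1) const_closed[OF balance(2)], symmetric]
      by (intro balance_relator L.env_mult_closed \<alpha>' balance)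
  qed
  then show "lmult_fun \<alpha> r \<in> DW_rel sg br W \<rho> D" by (rule DW_relator_in_rel)
qed

lemma lact_cos: "\<alpha> \<in> carrier LD \<Longrightarrow> lact \<alpha> (dw.cos x) = dw.cos (lmult_fun \<alpha> x)"
  unfolding DW_lmult_def Let_def lmult_fun_def[symmetric]
  by (rule dw.quot_map_cos[OF dw.pm_quotient_axioms lmult_fun_linear lmult_fun_rel])

lemma lmult_fun_closed:
  assumes "\<alpha> \<in> carrier LD" "x \<in> carrier FM"
  shows "lmult_fun \<alpha> x \<in> carrier FM"
proof (rule pm_linear_into_subspace[OF lmult_fun_linear dw.subspace_carrier])
  show "x \<in> pm.span (basis_el ` (carrier UL \<times> carrier MT))"
    using assms(2) unfolding DW_free_def free_vs_carrier .
  fix b assume "b \<in> (basis_el ` (carrier UL \<times> carrier MT) ::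
    ((((p1 \<Rightarrow> 'g) letters \<Rightarrow>\<^sub>0 complex) set \<times> (('n \<Rightarrow> 'w) \<Rightarrow>\<^sub>0 complex) set) \<Rightarrow>\<^sub>0 complex) set)"
  then obtain u v where uv: "u \<in> carrier UL" "v \<in> carrier MT" "b = basis_el (u, v)" by blast
  show "lmult_fun \<alpha> b \<in> carrier FM"
    unfolding uv(3) lmult_fun_basis
    by (intro basis_el_closed L.env_mult_closed L.env_in_closed assms(1) uv)
qed

lemma M_cases:
  assumes "X \<in> carrier M"
  obtains x where "x \<in> carrier FM" "X = dw.cos x"
  using assms unfolding DW_def by (rule dw.quot_cases)

lemma M_simps: "dw.cos x \<oplus>\<^bsub>M\<^esub> dw.cos y = dw.cos (x + y)" "c \<odot>\<^bsub>M\<^esub> dw.cos x = dw.cos (scale_pm c x)"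
  "\<zero>\<^bsub>M\<^esub> = dw.cos 0"
  unfolding DW_def by (rule dw.add_quot dw.smult_quot dw.zero_quot)+

lemma M_cos_closed: "x \<in> carrier FM \<Longrightarrow> dw.cos x \<in> carrier M"
  unfolding DW_def by (rule dw.cos_closed)

lemma lin_operator_lact:
  assumes \<alpha>: "\<alpha> \<in> carrier LD"
  shows "lin_operator M (lact \<alpha>)"
  unfolding lin_operator_def
proof (intro conjI ballI allI)
  fix X assume "X \<in> carrier M"
  then obtain x where x: "x \<in> carrier FM" "X = dw.cos x" by (rule M_cases)
  show "lact \<alpha> X \<in> carrier M"
    unfolding x(2) lact_cos[OF \<alpha>] by (intro M_cos_closed lmult_fun_closed \<alpha> x)
  show "lact \<alpha> (c \<odot>\<^bsub>M\<^esub> X) = c \<odot>\<^bsub>M\<^esub> lact \<alpha> X" for c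
    unfolding x(2) M_simps lact_cos[OF \<alpha>] pmp.linear_scale[OF lmult_fun_linear] ..
  fix Y assume "Y \<in> carrier M"
  then obtain y where y: "Y = dw.cos y" by (rule M_cases)
  show "lact \<alpha> (X \<oplus>\<^bsub>M\<^esub> Y) = lact \<alpha> X \<oplus>\<^bsub>M\<^esub> lact \<alpha> Y"
    unfolding x(2) y M_simps lact_cos[OF \<alpha>] pmp.linear_add[OF lmult_fun_linear] ..
qed

lemma tens_eq: "tens u v = dw.cos (basis_el (u, v))"
  by (simp only: DW_tensor_def)

lemma tens_closed: "u \<in> carrier UL \<Longrightarrow> v \<in> carrier MT \<Longrightarrow> tens u v \<in> carrier M"
  unfolding tens_eq by (intro M_cos_closed basis_el_closed)

lemma tens_add_left:
  "m \<in> carrier UL \<Longrightarrow> m' \<in> carrier UL \<Longrightarrow> v \<in> carrier MT \<Longrightarrow> tens (m \<oplus>\<^bsub>UL\<^esub> m') v = tens m v \<oplus>\<^bsub>M\<^esub> tens m' v"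
  unfolding tens_eq M_simps dw.cos_eq_iff
  using DW_relator_in_rel[OF add_left_relator] by (simp only: diff_diff_eq)

lemma tens_add_right:
  "m \<in> carrier UL \<Longrightarrow> v \<in> carrier MT \<Longrightarrow> v' \<in> carrier MT \<Longrightarrow> tens m (v \<oplus>\<^bsub>MT\<^esub> v') = tens m v \<oplus>\<^bsub>M\<^esub> tens m v'"
  unfolding tens_eq M_simps dw.cos_eq_iff
  using DW_relator_in_rel[OF add_right_relator] by (simp only: diff_diff_eq)

lemma tens_smult_left:
  "m \<in> carrier UL \<Longrightarrow> v \<in> carrier MT \<Longrightarrow> tens (c \<odot>\<^bsub>UL\<^esub> m) v = c \<odot>\<^bsub>M\<^esub> tens m v"
  unfolding tens_eq M_simps dw.cos_eq_iff by (rule DW_relator_in_rel[OF smult_left_relator])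

lemma tens_smult_right:
  "m \<in> carrier UL \<Longrightarrow> v \<in> carrier MT \<Longrightarrow> tens m (c \<odot>\<^bsub>MT\<^esub> v) = c \<odot>\<^bsub>M\<^esub> tens m v"
  unfolding tens_eq M_simps dw.cos_eq_iff by (rule DW_relator_in_rel[OF smult_right_relator])

lemma lact_tens: "\<alpha> \<in> carrier LD \<Longrightarrow> lact \<alpha> (tens u v) = tens (env_in LD \<alpha> \<otimes>\<^bsub>UL\<^esub> u) v"
  by (simp only: tens_eq lact_cos lmult_fun_basis)

text \<open>The difference \<open>\<phi>\<close> of the two sides is linear, and on a basis tensor
  it is the negative of a left additivity relator, by \<open>env_in_bracket_mult\<close>.\<close>

lemma lact_bracket:
  assumes \<alpha>: "\<alpha> \<in> carrier LD" and \<beta>: "\<beta> \<in> carrier LD" and X: "X \<in> carrier M"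
  shows "lact (lie_bracket LD \<alpha> \<beta>) X \<oplus>\<^bsub>M\<^esub> lact \<beta> (lact \<alpha> X) = lact \<alpha> (lact \<beta> X)"
proof -
  obtain x where x: "x \<in> carrier FM" "X = dw.cos x" using X by (rule M_cases)
  note \<alpha>\<beta> = L.bracket_closed[OF \<alpha> \<beta>]
  define \<phi> where "\<phi> x = lmult_fun (lie_bracket LD \<alpha> \<beta>) x + lmult_fun \<beta> (lmult_fun \<alpha> x)
      - lmult_fun \<alpha> (lmult_fun \<beta> x)" for x
  have lin: "pm_linear \<phi>"
    by (rule pm_linearI)
       (simp_all add: \<phi>_def pmp.linear_add[OF lmult_fun_linear] pmp.linear_scale[OF lmult_fun_linear]
         pm.scale_right_distrib pm.scale_right_diff_distrib)
  have "\<phi> x \<in> DW_rel sg br W \<rho> D"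
  proof (rule pm_linear_into_subspace[OF lin dw.subspace])
    show "x \<in> pm.span (basis_el ` (carrier UL \<times> carrier MT))"
      using x(1) unfolding DW_free_def free_vs_carrier .
    fix b assume "b \<in> (basis_el ` (carrier UL \<times> carrier MT) ::
      ((((p1 \<Rightarrow> 'g) letters \<Rightarrow>\<^sub>0 complex) set \<times> (('n \<Rightarrow> 'w) \<Rightarrow>\<^sub>0 complex) set) \<Rightarrow>\<^sub>0 complex) set)"
    then obtain u v where uv: "u \<in> carrier UL" "v \<in> carrier MT" "b = basis_el (u, v)" by blast
    let ?p = "env_in LD (lie_bracket LD \<alpha> \<beta>) \<otimes>\<^bsub>UL\<^esub> u"
    let ?q = "env_in LD \<beta> \<otimes>\<^bsub>UL\<^esub> (env_in LD \<alpha> \<otimes>\<^bsub>UL\<^esub> u)"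
    have "\<phi> b = - (basis_el (?p \<oplus>\<^bsub>UL\<^esub> ?q, v) - basis_el (?p, v) - basis_el (?q, v))"
      by (simp add: \<phi>_def uv(3) lmult_fun_basis L.env_in_bracket_mult[OF \<alpha> \<beta> uv(1)])
    also have "\<dots> \<in> DW_rel sg br W \<rho> D"
      by (intro pm.subspace_neg[OF dw.subspace] DW_relator_in_rel add_left_relator L.env_mult_closed
          L.env_in_closed \<alpha> \<beta> \<alpha>\<beta> uv)
    finally show "\<phi> b \<in> DW_rel sg br W \<rho> D" .
  qed
  then show ?thesis
    unfolding x(2) lact_cos[OF \<alpha>] lact_cos[OF \<beta>] lact_cos[OF \<alpha>\<beta>] M_simps dw.cos_eq_iff \<phi>_def .
qed

abbreviation one_tens where "one_tens w \<equiv> tens \<one>\<^bsub>UL\<^esub> (pure_tensor W w)"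

lemma one_tens_closed: "w \<in> tuples W \<Longrightarrow> one_tens w \<in> carrier M"
  by (intro tens_closed L.one_env_closed pure_tensor_closed)

lemma lact_one_tens:
  assumes "\<alpha> \<in> carrier LD"
  shows "lact \<alpha> (one_tens w) = tens (env_in LD \<alpha>) (pure_tensor W w)"
  by (simp only: lact_tens assms L.env_in_mult_one)

lemma one_tens_diff:
  assumes "w \<in> tuples W" "a \<in> carrier (W k)" "b \<in> carrier (W k)"
  shows "one_tens (w(k := a)) = one_tens (w(k := a \<ominus>\<^bsub>W k\<^esub> b)) \<oplus>\<^bsub>M\<^esub> one_tens (w(k := b))"
proof -
  interpret Wk: Module.module complex_field "W k" by (rule lie_rep_module[OF rep])
  have "a \<ominus>\<^bsub>W k\<^esub> b \<in> carrier (W k)" using assms by simp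
  then show ?thesis
    unfolding pure_tensor_diff[OF assms]
    by (intro tens_add_right L.one_env_closed pure_tensor_closed tuples_upd assms)
qed

text \<open>The module is spanned by tensors \<open>u \<otimes> v\<close>. Here \<open>v\<close> is
  a combination of pure tensors and \<open>u\<close> one of words, and a word is obtained from the
  unit by successive left multiplications by its letters.\<close>

lemma M_induct [consumes 1, case_names zero add smult one_tens lact]:
  assumes X: "X \<in> carrier M"
    and zero: "P \<zero>\<^bsub>M\<^esub>"
    and add: "\<And>X Y. X \<in> carrier M \<Longrightarrow> Y \<in> carrier M \<Longrightarrow> P X \<Longrightarrow> P Y \<Longrightarrow> P (X \<oplus>\<^bsub>M\<^esub> Y)"
    and smult: "\<And>c X. X \<in> carrier M \<Longrightarrow> P X \<Longrightarrow> P (c \<odot>\<^bsub>M\<^esub> X)"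
    and one_tens: "\<And>w. w \<in> tuples W \<Longrightarrow> P (one_tens w)"
    and lact: "\<And>\<alpha> X. \<alpha> \<in> carrier LD \<Longrightarrow> X \<in> carrier M \<Longrightarrow> P X \<Longrightarrow> P (lact \<alpha> X)"
  shows "P X"
proof -
  interpret M: Module.module complex_field M by (rule M_module)
  \<comment> \<open>A tensor with a zero factor equals \<open>0\<close> times itself by bilinearity,
    hence is the zero of \<open>M\<close>; this starts each of the span arguments below.\<close>
  have tens_zero: "P (tens u v)" if "tens u v = 0 \<odot>\<^bsub>M\<^esub> tens u v" "u \<in> carrier UL" "v \<in> carrier MT" for u v
    using that(1) M.smult_l_null[OF tens_closed[OF that(2,3)]] zero by simp
  have word: "P (tens (L.env.cos (basis_el (Letters xs))) (pure_tensor W w))"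
    if "set xs \<subseteq> carrier LD" "w \<in> tuples W" for xs w
    using that(1)
  proof (induction xs)
    case Nil
    then show ?case using one_tens[OF that(2)] by (simp add: L.one_env Letters_zero[symmetric])
  next
    case (Cons x xs)
    then have x: "x \<in> carrier LD" and xs: "basis_el (Letters xs) \<in> carrier L.F"
      by (auto simp: free_alg_def)
    have eq: "basis_el (Letters (x # xs)) = gen x * basis_el (Letters xs)"
      by (simp add: mult_single Letters_plus)
    have "tens (L.env.cos (basis_el (Letters (x # xs)))) (pure_tensor W w) =
        lact x (tens (L.env.cos (basis_el (Letters xs))) (pure_tensor W w))"
      unfolding lact_tens[OF x] eq L.env_in_eq L.mult_env[OF gen_in_free_alg[OF x] xs] ..
    then show ?case
      using lact[OF x tens_closed[OF L.env_cos_closed[OF xs] pure_tensor_closed[OF that(2)]]] Cons by simp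
  qed
  have pure: "P (tens u (pure_tensor W w))" if u: "u \<in> carrier UL" and w: "w \<in> tuples W" for u w
  proof -
    obtain f where f: "f \<in> carrier L.F" "u = L.env.cos f" using u by (rule L.env_cases)
    note pw = pure_tensor_closed[OF w]
    let ?S = "{f \<in> carrier L.F. P (tens (L.env.cos f) (pure_tensor W w))}"
    have "pm.subspace ?S"
    proof (rule pm.subspaceI)
      have "tens (L.env.cos 0) (pure_tensor W w) = 0 \<odot>\<^bsub>M\<^esub> tens (L.env.cos 0) (pure_tensor W w)"
        using tens_smult_left[OF L.env_cos_closed[OF pm.subspace_0[OF L.env.subspace_carrier]] pw, of 0]
        by (simp add: L.env_smult)
      then show "0 \<in> ?S"
        by (auto intro!: tens_zero L.env_cos_closed pw simp: pm.subspace_0[OF L.env.subspace_carrier])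
      fix x y assume xy: "x \<in> ?S" "y \<in> ?S"
      then have x: "x \<in> carrier L.F" "y \<in> carrier L.F" by auto
      have "tens (L.env.cos (x + y)) (pure_tensor W w) =
          tens (L.env.cos x) (pure_tensor W w) \<oplus>\<^bsub>M\<^esub> tens (L.env.cos y) (pure_tensor W w)"
        unfolding L.env_add[symmetric] by (intro tens_add_left L.env_cos_closed x pw)
      then show "x + y \<in> ?S"
        using xy by (auto intro!: add tens_closed L.env_cos_closed pw pm.subspace_add[OF L.env.subspace_carrier])
    next
      fix c x assume xy: "x \<in> ?S"
      then have x: "x \<in> carrier L.F" by auto
      have "tens (L.env.cos (scale_pm c x)) (pure_tensor W w) = c \<odot>\<^bsub>M\<^esub> tens (L.env.cos x) (pure_tensor W w)"
        unfolding L.env_smult[symmetric] by (intro tens_smult_left L.env_cos_closed x pw)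
      then show "scale_pm c x \<in> ?S"
        using xy by (auto intro!: smult tens_closed L.env_cos_closed pw pm.subspace_scale[OF L.env.subspace_carrier])
    qed
    moreover have "basis_el ` {u. set (letters u) \<subseteq> carrier LD} \<subseteq> ?S"
    proof
      fix b :: "(p1 \<Rightarrow> 'g) letters \<Rightarrow>\<^sub>0 complex" assume "b \<in> basis_el ` {u. set (letters u) \<subseteq> carrier LD}"
      then obtain xs where xs: "set xs \<subseteq> carrier LD" "b = basis_el (Letters xs)"
        by (metis (mono_tags, lifting) imageE letters.collapse mem_Collect_eq)
      then show "b \<in> ?S" using word[OF xs(1) w] by (auto simp: free_alg_def)
    qed
    ultimately have "f \<in> ?S"
      using pm.span_minimal f(1) unfolding free_alg_carrier by blast
    then show ?thesis using f(2) by simp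
  qed
  have tens: "P (tens u v)" if u: "u \<in> carrier UL" and v: "v \<in> carrier MT" for u v
  proof -
    obtain f where f: "f \<in> carrier (free_vs (tuples W))" "v = mt.cos f"
      using v unfolding multi_tensor_def by (rule mt.quot_cases)
    let ?S = "{f \<in> carrier (free_vs (tuples W)). P (tens u (mt.cos f))}"
    have cl: "mt.cos x \<in> carrier MT" if "x \<in> carrier (free_vs (tuples W))" for x
      unfolding multi_tensor_def using that by (rule mt.cos_closed)
    have "pm.subspace ?S"
    proof (rule pm.subspaceI)
      have "tens u (mt.cos 0) = 0 \<odot>\<^bsub>M\<^esub> tens u (mt.cos 0)"
        using tens_smult_right[OF u cl[OF pm.subspace_0[OF mt.subspace_carrier]], of 0]
        by (simp add: multi_tensor_def mt.smult_quot)
      then show "0 \<in> ?S"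
        by (auto intro!: tens_zero u cl simp: pm.subspace_0[OF mt.subspace_carrier])
      fix x y assume xy: "x \<in> ?S" "y \<in> ?S"
      then have x: "x \<in> carrier (free_vs (tuples W))" "y \<in> carrier (free_vs (tuples W))" by auto
      have "tens u (mt.cos (x + y)) = tens u (mt.cos x) \<oplus>\<^bsub>M\<^esub> tens u (mt.cos y)"
        using tens_add_right[OF u cl[OF x(1)] cl[OF x(2)]] by (simp add: multi_tensor_def mt.add_quot)
      then show "x + y \<in> ?S"
        using xy by (auto intro!: add tens_closed u cl pm.subspace_add[OF mt.subspace_carrier])
    next
      fix c x assume xy: "x \<in> ?S"
      then have x: "x \<in> carrier (free_vs (tuples W))" by auto
      have "tens u (mt.cos (scale_pm c x)) = c \<odot>\<^bsub>M\<^esub> tens u (mt.cos x)"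
        using tens_smult_right[OF u cl[OF x]] by (simp add: multi_tensor_def mt.smult_quot)
      then show "scale_pm c x \<in> ?S"
        using xy by (auto intro!: smult tens_closed u cl pm.subspace_scale[OF mt.subspace_carrier])
    qed
    moreover have "basis_el ` tuples W \<subseteq> ?S"
      using pure[OF u] by (auto simp: pure_tensor_def free_vs_def)
    ultimately have "f \<in> ?S"
      using pm.span_minimal f(1) unfolding free_vs_carrier by blast
    then show ?thesis using f(2) by simp
  qed
  obtain x where x: "x \<in> carrier FM" "X = dw.cos x" using X by (rule M_cases)
  let ?S = "{x \<in> carrier FM. P (dw.cos x)}"
  have "pm.subspace ?S"
    by (rule pm.subspaceI)
       (auto simp: M_simps[symmetric] zero pm.subspace_0[OF dw.subspace_carrier]
         intro!: add smult M_cos_closed pm.subspace_add[OF dw.subspace_carrier] pm.subspace_scale[OF dw.subspace_carrier])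
  moreover have "basis_el ` (carrier UL \<times> carrier MT) \<subseteq> ?S"
    using tens by (auto simp: tens_eq basis_el_closed)
  ultimately have "x \<in> ?S"
    using pm.span_minimal x(1) unfolding DW_free_def free_vs_carrier by blast
  then show ?thesis using x(2) by simp
qed

end


section \<open>The commutator of two operators\<close>

text \<open>The combinatorial core: \<open>V\<close> is generated from the vectors \<open>t w\<close> by the operators \<open>A \<alpha>\<close>, and
  \<open>m k \<mu> w\<close> replaces the \<open>k\<close>-th tensor factor of \<open>w\<close> by its image under the value of \<open>\<mu>\<close> at the
  \<open>k\<close>-th point. \<open>K1\<close>, \<open>K2\<close> index the points outside and inside the disc, \<open>R1\<close>, \<open>R2\<close> are the maps
  regular there.\<close>

locale current_operators = vector_space s
  for s :: "complex \<Rightarrow> 'v::ab_group_add \<Rightarrow> 'v" +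
  fixes J A :: "'r \<Rightarrow> 'v \<Rightarrow> 'v" and V :: "'v set" and R R1 R2 :: "'r set"
    and bk pl :: "'r \<Rightarrow> 'r \<Rightarrow> 'r" and c :: "'r \<Rightarrow> 'r \<Rightarrow> complex"
    and Tup :: "'t set" and t :: "'t \<Rightarrow> 'v" and m :: "'n \<Rightarrow> 'r \<Rightarrow> 't \<Rightarrow> 't" and K1 K2 :: "'n set"
  assumes R1: "R1 \<subseteq> R" and R2: "R2 \<subseteq> R"
    and bk_closed: "\<mu> \<in> R \<Longrightarrow> \<nu> \<in> R \<Longrightarrow> bk \<mu> \<nu> \<in> R"
    and bk_closed1: "\<mu> \<in> R1 \<Longrightarrow> \<nu> \<in> R1 \<Longrightarrow> bk \<mu> \<nu> \<in> R1"
    and bk_closed2: "\<mu> \<in> R2 \<Longrightarrow> \<nu> \<in> R2 \<Longrightarrow> bk \<mu> \<nu> \<in> R2"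
    and J_linear: "\<mu> \<in> R \<Longrightarrow> Vector_Spaces.linear s s (J \<mu>)"
    and A_linear: "\<alpha> \<in> R1 \<Longrightarrow> Vector_Spaces.linear s s (A \<alpha>)"
    and J_V: "\<mu> \<in> R \<Longrightarrow> x \<in> V \<Longrightarrow> J \<mu> x \<in> V"
    and t_V: "w \<in> Tup \<Longrightarrow> t w \<in> V"
    and J_pl: "\<mu> \<in> R \<Longrightarrow> \<nu> \<in> R \<Longrightarrow> x \<in> V \<Longrightarrow> J (pl \<mu> \<nu>) x = J \<mu> x + J \<nu> x"
    and J_anti: "\<mu> \<in> R \<Longrightarrow> \<nu> \<in> R \<Longrightarrow> x \<in> V \<Longrightarrow> J (bk \<nu> \<mu>) x = - J (bk \<mu> \<nu>) x"
    and J_jacobi: "\<mu> \<in> R \<Longrightarrow> \<nu> \<in> R \<Longrightarrow> \<alpha> \<in> R1 \<Longrightarrow> x \<in> V \<Longrightarrow>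
      J (bk (bk \<mu> \<nu>) \<alpha>) x = J (bk \<mu> (bk \<nu> \<alpha>)) x - J (bk \<nu> (bk \<mu> \<alpha>)) x"
    and J_bk_pl: "\<mu> \<in> R \<Longrightarrow> \<mu>' \<in> R \<Longrightarrow> \<nu> \<in> R \<Longrightarrow> x \<in> V \<Longrightarrow>
      J (bk (pl \<mu> \<mu>') \<nu>) x = J (bk \<mu> \<nu>) x + J (bk \<mu>' \<nu>) x"
    and A_bracket: "\<alpha> \<in> R1 \<Longrightarrow> \<beta> \<in> R1 \<Longrightarrow> x \<in> V \<Longrightarrow> A (bk \<alpha> \<beta>) x = A \<alpha> (A \<beta> x) - A \<beta> (A \<alpha> x)"
    and J_A: "\<nu> \<in> R \<Longrightarrow> \<alpha> \<in> R1 \<Longrightarrow> x \<in> V \<Longrightarrow> J \<nu> (A \<alpha> x) = A \<alpha> (J \<nu> x) + J (bk \<nu> \<alpha>) x + s (c \<nu> \<alpha>) x"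
    and decomposition: "\<mu> \<in> R \<Longrightarrow> \<exists>\<mu>1\<in>R1. \<exists>\<mu>2\<in>R2. \<mu> = pl \<mu>1 \<mu>2"
    and c_anti: "\<mu> \<in> R \<Longrightarrow> \<nu> \<in> R \<Longrightarrow> c \<nu> \<mu> = - c \<mu> \<nu>"
    and c_pl: "\<mu> \<in> R \<Longrightarrow> \<mu>' \<in> R \<Longrightarrow> \<nu> \<in> R \<Longrightarrow> c (pl \<mu> \<mu>') \<nu> = c \<mu> \<nu> + c \<mu>' \<nu>"
    and c_cocycle: "\<mu> \<in> R \<Longrightarrow> \<nu> \<in> R \<Longrightarrow> \<alpha> \<in> R1 \<Longrightarrow> c (bk \<mu> \<nu>) \<alpha> = c \<mu> (bk \<nu> \<alpha>) - c \<nu> (bk \<mu> \<alpha>)"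
    and c_zero1: "\<mu> \<in> R1 \<Longrightarrow> \<nu> \<in> R1 \<Longrightarrow> c \<mu> \<nu> = 0"
    and c_zero2: "\<mu> \<in> R2 \<Longrightarrow> \<nu> \<in> R2 \<Longrightarrow> c \<mu> \<nu> = 0"
    and J_t1: "\<nu> \<in> R1 \<Longrightarrow> w \<in> Tup \<Longrightarrow> J \<nu> (t w) = A \<nu> (t w) - (\<Sum>k\<in>K1. t (m k \<nu> w))"
    and J_t2: "\<nu> \<in> R2 \<Longrightarrow> w \<in> Tup \<Longrightarrow> J \<nu> (t w) = (\<Sum>k\<in>K2. t (m k \<nu> w))"
    and m_Tup: "w \<in> Tup \<Longrightarrow> m k \<nu> w \<in> Tup"
    and m_comm: "k \<noteq> l \<Longrightarrow> m k \<mu> (m l \<nu> w) = m l \<nu> (m k \<mu> w)"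
    and m_bracket1: "\<mu> \<in> R1 \<Longrightarrow> \<nu> \<in> R1 \<Longrightarrow> k \<in> K1 \<Longrightarrow> w \<in> Tup \<Longrightarrow>
      t (m k \<mu> (m k \<nu> w)) = t (m k (bk \<mu> \<nu>) w) + t (m k \<nu> (m k \<mu> w))"
    and m_bracket2: "\<mu> \<in> R2 \<Longrightarrow> \<nu> \<in> R2 \<Longrightarrow> k \<in> K2 \<Longrightarrow> w \<in> Tup \<Longrightarrow>
      t (m k \<mu> (m k \<nu> w)) = t (m k (bk \<mu> \<nu>) w) + t (m k \<nu> (m k \<mu> w))"
    and finite_K: "finite K1" "finite K2" and disjoint: "K1 \<inter> K2 = {}"
    and V_induct: "\<And>P x. x \<in> V \<Longrightarrow> P 0 \<Longrightarrow> (\<And>x y. P x \<Longrightarrow> P y \<Longrightarrow> P (x + y)) \<Longrightarrow> (\<And>a x. P x \<Longrightarrow> P (s a x)) \<Longrightarrow>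
      (\<And>w. w \<in> Tup \<Longrightarrow> P (t w)) \<Longrightarrow> (\<And>\<alpha> x. \<alpha> \<in> R1 \<Longrightarrow> x \<in> V \<Longrightarrow> P x \<Longrightarrow> P (A \<alpha> x)) \<Longrightarrow> P x"
begin

sublocale vector_space_pair s s ..

text \<open>The operator \<open>C(\<mu>, \<nu>)\<close> of the overview, applied to
  \<open>x\<close>.\<close>

definition defect :: "'r \<Rightarrow> 'r \<Rightarrow> 'v \<Rightarrow> 'v" where
  "defect \<mu> \<nu> x = J \<mu> (J \<nu> x) - J \<nu> (J \<mu> x) - J (bk \<mu> \<nu>) x - s (c \<mu> \<nu>) x"

lemmas J_add = linear_add[OF J_linear] and J_diff = linear_diff[OF J_linear]
  and J_scale = linear_scale[OF J_linear] and J_0 = linear_0[OF J_linear] and J_sum = linear_sum[OF J_linear]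
lemmas A_add = linear_add[OF A_linear] and A_diff = linear_diff[OF A_linear]
  and A_scale = linear_scale[OF A_linear] and A_sum = linear_sum[OF A_linear]

lemma R1D: "\<mu> \<in> R1 \<Longrightarrow> \<mu> \<in> R" and R2D: "\<mu> \<in> R2 \<Longrightarrow> \<mu> \<in> R"
  using R1 R2 by auto

text \<open>Moving \<open>A \<alpha>\<close> to the left produces the terms
  \<open>c(\<mu>, \<alpha>) J \<nu> x\<close> and \<open>c(\<nu>, \<alpha>) J \<mu> x\<close> in
  both orders, and they cancel. What remains regroups into two defects by \<open>J_jacobi\<close>
  and \<open>c_cocycle\<close>.\<close>

lemma defect_A:
  assumes "\<mu> \<in> R" "\<nu> \<in> R" "\<alpha> \<in> R1" "x \<in> V"
  shows "defect \<mu> \<nu> (A \<alpha> x) = A \<alpha> (defect \<mu> \<nu> x) + defect \<mu> (bk \<nu> \<alpha>) x - defect \<nu> (bk \<mu> \<alpha>) x"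
proof -
  have \<alpha>: "\<alpha> \<in> R" using assms R1 by auto
  note R = assms(1,2) bk_closed[OF assms(1) \<alpha>] bk_closed[OF assms(2) \<alpha>] bk_closed[OF assms(1,2)]
  have 1: "J \<mu> (J \<nu> (A \<alpha> x)) = A \<alpha> (J \<mu> (J \<nu> x)) + J (bk \<mu> \<alpha>) (J \<nu> x) + s (c \<mu> \<alpha>) (J \<nu> x)
      + J \<mu> (J (bk \<nu> \<alpha>) x) + s (c \<nu> \<alpha>) (J \<mu> x)"
    using assms R by (simp add: J_A J_add J_scale J_V)
  have 2: "J \<nu> (J \<mu> (A \<alpha> x)) = A \<alpha> (J \<nu> (J \<mu> x)) + J (bk \<nu> \<alpha>) (J \<mu> x) + s (c \<nu> \<alpha>) (J \<mu> x)
      + J \<nu> (J (bk \<mu> \<alpha>) x) + s (c \<mu> \<alpha>) (J \<nu> x)"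
    using assms R by (simp add: J_A J_add J_scale J_V)
  have 3: "J (bk \<mu> \<nu>) (A \<alpha> x) = A \<alpha> (J (bk \<mu> \<nu>) x) + J (bk \<mu> (bk \<nu> \<alpha>)) x - J (bk \<nu> (bk \<mu> \<alpha>)) x
      + s (c \<mu> (bk \<nu> \<alpha>)) x - s (c \<nu> (bk \<mu> \<alpha>)) x"
    using assms R by (simp add: J_A J_jacobi c_cocycle scale_left_diff_distrib)
  show ?thesis
    unfolding defect_def 1 2 3 using assms(3) by (simp add: A_add A_diff A_scale algebra_simps)
qed

lemma defect_pl_left:
  assumes "\<mu> \<in> R" "\<mu>' \<in> R" "\<nu> \<in> R" "x \<in> V"
  shows "defect (pl \<mu> \<mu>') \<nu> x = defect \<mu> \<nu> x + defect \<mu>' \<nu> x"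
  using assms by (simp add: defect_def J_pl J_V J_add J_bk_pl c_pl scale_left_distrib)

lemma defect_anti:
  assumes "\<mu> \<in> R" "\<nu> \<in> R" "x \<in> V"
  shows "defect \<nu> \<mu> x = - defect \<mu> \<nu> x"
  using assms J_anti[OF assms] c_anti[OF assms(1,2)] by (simp add: defect_def)

text \<open>Operations in different slots commute, so only the diagonal terms contribute a bracket;
  interchanging the two summations restores the order of the indices.\<close>

lemma sum_bracket:
  assumes K: "finite K" and w: "w \<in> Tup"
    and br: "\<And>k. k \<in> K \<Longrightarrow> t (m k \<mu> (m k \<nu> w)) = t (m k (bk \<mu> \<nu>) w) + t (m k \<nu> (m k \<mu> w))"
  shows "(\<Sum>k\<in>K. \<Sum>l\<in>K. t (m l \<mu> (m k \<nu> w)))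
    = (\<Sum>k\<in>K. \<Sum>l\<in>K. t (m l \<nu> (m k \<mu> w))) + (\<Sum>k\<in>K. t (m k (bk \<mu> \<nu>) w))"
proof -
  have "(\<Sum>k\<in>K. \<Sum>l\<in>K. t (m l \<mu> (m k \<nu> w)))
      = (\<Sum>k\<in>K. \<Sum>l\<in>K. t (m k \<nu> (m l \<mu> w)) + (if l = k then t (m k (bk \<mu> \<nu>) w) else 0))"
    by (intro sum.cong refl) (use br m_comm in \<open>auto simp: add.commute\<close>)
  also have "\<dots> = (\<Sum>k\<in>K. \<Sum>l\<in>K. t (m k \<nu> (m l \<mu> w))) + (\<Sum>k\<in>K. t (m k (bk \<mu> \<nu>) w))"
    using K by (simp add: sum.distrib)
  also have "(\<Sum>k\<in>K. \<Sum>l\<in>K. t (m k \<nu> (m l \<mu> w))) = (\<Sum>k\<in>K. \<Sum>l\<in>K. t (m l \<nu> (m k \<mu> w)))"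
    by (rule sum.swap)
  finally show ?thesis .
qed

text \<open>In \<open>JJ\<close> the single sums under \<open>A\<close> are symmetric in
  \<open>\<mu>\<close> and \<open>\<nu>\<close> and cancel. The rest of the commutator is
  \<open>2 J [\<mu>, \<nu>] - A [\<mu>, \<nu>]\<close> plus the bracket sum over the outer points.
  By \<open>J_t1\<close> for the bracket, the last two parts amount to
  \<open>- J [\<mu>, \<nu>]\<close>.\<close>

lemma defect_t11:
  assumes \<mu>: "\<mu> \<in> R1" and \<nu>: "\<nu> \<in> R1" and w: "w \<in> Tup"
  shows "defect \<mu> \<nu> (t w) = 0"
proof -
  have JJ: "J \<mu> (J \<nu> (t w)) = A \<nu> (A \<mu> (t w)) - A \<nu> (\<Sum>k\<in>K1. t (m k \<mu> w)) + J (bk \<mu> \<nu>) (t w)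
      - A \<mu> (\<Sum>k\<in>K1. t (m k \<nu> w)) + (\<Sum>k\<in>K1. \<Sum>l\<in>K1. t (m l \<mu> (m k \<nu> w)))"
    if \<mu>: "\<mu> \<in> R1" and \<nu>: "\<nu> \<in> R1" for \<mu> \<nu>
    using that w R1D[OF \<mu>] R1D[OF \<nu>]
    by (simp add: J_t1 J_diff J_sum J_A t_V m_Tup A_diff A_sum sum_subtractf c_zero1 algebra_simps)
  have "J (bk \<mu> \<nu>) (t w) = A (bk \<mu> \<nu>) (t w) - (\<Sum>k\<in>K1. t (m k (bk \<mu> \<nu>) w))"
    using J_t1[OF bk_closed1[OF \<mu> \<nu>] w] .
  moreover have "(\<Sum>k\<in>K1. \<Sum>l\<in>K1. t (m l \<mu> (m k \<nu> w)))
    = (\<Sum>k\<in>K1. \<Sum>l\<in>K1. t (m l \<nu> (m k \<mu> w))) + (\<Sum>k\<in>K1. t (m k (bk \<mu> \<nu>) w))"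
    by (rule sum_bracket[OF finite_K(1) w]) (rule m_bracket1[OF \<mu> \<nu> _ w])
  ultimately show ?thesis
    unfolding defect_def JJ[OF \<mu> \<nu>] JJ[OF \<nu> \<mu>] J_anti[OF R1D[OF \<mu>] R1D[OF \<nu>] t_V[OF w]]
    using A_bracket[OF \<mu> \<nu> t_V[OF w]] by (simp add: c_zero1[OF \<mu> \<nu>])
qed

lemma defect_t22:
  assumes \<mu>: "\<mu> \<in> R2" and \<nu>: "\<nu> \<in> R2" and w: "w \<in> Tup"
  shows "defect \<mu> \<nu> (t w) = 0"
proof -
  have JJ: "J \<mu> (J \<nu> (t w)) = (\<Sum>k\<in>K2. \<Sum>l\<in>K2. t (m l \<mu> (m k \<nu> w)))"
    if \<mu>: "\<mu> \<in> R2" and \<nu>: "\<nu> \<in> R2" for \<mu> \<nu>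
    using that w R2D[OF \<mu>] by (simp add: J_t2 J_sum m_Tup)
  have "J (bk \<mu> \<nu>) (t w) = (\<Sum>k\<in>K2. t (m k (bk \<mu> \<nu>) w))"
    using J_t2[OF bk_closed2[OF \<mu> \<nu>] w] .
  moreover have "(\<Sum>k\<in>K2. \<Sum>l\<in>K2. t (m l \<mu> (m k \<nu> w)))
    = (\<Sum>k\<in>K2. \<Sum>l\<in>K2. t (m l \<nu> (m k \<mu> w))) + (\<Sum>k\<in>K2. t (m k (bk \<mu> \<nu>) w))"
    by (rule sum_bracket[OF finite_K(2) w]) (rule m_bracket2[OF \<mu> \<nu> _ w])
  ultimately show ?thesis
    unfolding defect_def JJ[OF \<mu> \<nu>] JJ[OF \<nu> \<mu>] by (simp add: c_zero2[OF \<mu> \<nu>])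
qed

text \<open>Here the relation \<open>J_A\<close> for the left multiplication by \<open>\<nu>\<close>
  delivers the bracket and the constant. The leftover double sums run over inner and outer points,
  which are different slots, so they agree in either order.\<close>

lemma defect_t21:
  assumes \<mu>: "\<mu> \<in> R2" and \<nu>: "\<nu> \<in> R1" and w: "w \<in> Tup"
  shows "defect \<mu> \<nu> (t w) = 0"
proof -
  note \<mu>' = R2D[OF \<mu>] and \<nu>' = R1D[OF \<nu>]
  have "J \<mu> (J \<nu> (t w)) = A \<nu> (J \<mu> (t w)) + J (bk \<mu> \<nu>) (t w) + s (c \<mu> \<nu>) (t w)
      - (\<Sum>k\<in>K1. \<Sum>l\<in>K2. t (m l \<mu> (m k \<nu> w)))"
    using \<mu> \<nu> \<mu>' w by (simp add: J_t1 J_t2 J_diff J_sum J_A t_V m_Tup)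
  moreover have "J \<nu> (J \<mu> (t w)) = A \<nu> (J \<mu> (t w)) - (\<Sum>l\<in>K2. \<Sum>k\<in>K1. t (m k \<nu> (m l \<mu> w)))"
    using \<mu> \<nu> \<nu>' w by (simp add: J_t1 J_t2 J_sum A_sum m_Tup sum_subtractf)
  moreover have "(\<Sum>l\<in>K2. \<Sum>k\<in>K1. t (m k \<nu> (m l \<mu> w))) = (\<Sum>l\<in>K2. \<Sum>k\<in>K1. t (m l \<mu> (m k \<nu> w)))"
    using disjoint by (intro sum.cong refl arg_cong[of _ _ t] m_comm) auto
  moreover have "\<dots> = (\<Sum>k\<in>K1. \<Sum>l\<in>K2. t (m l \<mu> (m k \<nu> w)))"
    by (rule sum.swap)
  ultimately show ?thesis
    by (simp add: defect_def)
qed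

lemma defect_t:
  assumes \<mu>: "\<mu> \<in> R" and \<nu>: "\<nu> \<in> R" and w: "w \<in> Tup"
  shows "defect \<mu> \<nu> (t w) = 0"
proof -
  \<comment> \<open>Antisymmetry lets a decomposition in the first argument serve for the second one
    too, and yields the mixed case in the other order.\<close>
  have anti: "defect \<mu> \<nu> (t w) = 0 \<Longrightarrow> defect \<nu> \<mu> (t w) = 0" if "\<mu> \<in> R" "\<nu> \<in> R" for \<mu> \<nu>
    using defect_anti[OF that t_V[OF w]] by simp
  have split: "defect \<mu> \<nu> (t w) = 0"
    if "\<mu> \<in> R" "\<nu> \<in> R" "\<And>\<mu>'. \<mu>' \<in> R1 \<union> R2 \<Longrightarrow> defect \<mu>' \<nu> (t w) = 0" for \<mu> \<nu>
  proof -
    from decomposition[OF that(1)]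
    obtain \<mu>1 \<mu>2 where "\<mu>1 \<in> R1" "\<mu>2 \<in> R2" "\<mu> = pl \<mu>1 \<mu>2"
      by blast
    then show ?thesis
      using that by (simp add: defect_pl_left t_V w R1D R2D)
  qed
  have sub: "\<mu>' \<in> R" if "\<mu>' \<in> R1 \<union> R2" for \<mu>'
    using that R1D R2D by (elim UnE)
  have base: "defect \<mu>' \<nu>' (t w) = 0" if "\<mu>' \<in> R1 \<union> R2" "\<nu>' \<in> R1 \<union> R2" for \<mu>' \<nu>'
    using that
  proof (elim UnE)
    assume "\<mu>' \<in> R1" "\<nu>' \<in> R2"
    then show ?thesis by (intro anti[OF R2D R1D defect_t21] w)
  qed (intro defect_t11 defect_t22 defect_t21 w; assumption)+
  have "defect \<mu>' \<nu> (t w) = 0" if "\<mu>' \<in> R1 \<union> R2" for \<mu>'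
    by (rule anti[OF \<nu> sub[OF that] split[OF \<nu> sub[OF that]]]) (rule base[OF _ that])
  then show ?thesis
    by (rule split[OF \<mu> \<nu>])
qed

theorem commutator:
  assumes "x \<in> V" "\<mu> \<in> R" "\<nu> \<in> R"
  shows "J \<mu> (J \<nu> x) - J \<nu> (J \<mu> x) - J (bk \<mu> \<nu>) x = s (c \<mu> \<nu>) x"
proof -
  \<comment> \<open>Both maps stay quantified during the induction: by \<open>defect_A\<close>, the
    step for \<open>A \<alpha>\<close> calls for the pairs \<open>\<mu>, [\<nu>, \<alpha>]\<close>
    and \<open>\<nu>, [\<mu>, \<alpha>]\<close>.\<close>
  have "\<forall>\<mu>\<in>R. \<forall>\<nu>\<in>R. defect \<mu> \<nu> x = 0"
  proof (rule V_induct[OF assms(1)])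
    show "\<forall>\<mu>\<in>R. \<forall>\<nu>\<in>R. defect \<mu> \<nu> 0 = 0"
      by (simp add: defect_def J_0 bk_closed)
    show "\<forall>\<mu>\<in>R. \<forall>\<nu>\<in>R. defect \<mu> \<nu> (x + y) = 0"
      if "\<forall>\<mu>\<in>R. \<forall>\<nu>\<in>R. defect \<mu> \<nu> x = 0" "\<forall>\<mu>\<in>R. \<forall>\<nu>\<in>R. defect \<mu> \<nu> y = 0" for x y
    proof (intro ballI)
      fix \<mu> \<nu> assume R: "\<mu> \<in> R" "\<nu> \<in> R"
      then have "defect \<mu> \<nu> (x + y) = defect \<mu> \<nu> x + defect \<mu> \<nu> y"
        by (simp add: defect_def J_add bk_closed scale_right_distrib)
      then show "defect \<mu> \<nu> (x + y) = 0" using that R by simp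
    qed
    show "\<forall>\<mu>\<in>R. \<forall>\<nu>\<in>R. defect \<mu> \<nu> (s a x) = 0" if "\<forall>\<mu>\<in>R. \<forall>\<nu>\<in>R. defect \<mu> \<nu> x = 0" for a x
    proof (intro ballI)
      fix \<mu> \<nu> assume R: "\<mu> \<in> R" "\<nu> \<in> R"
      then have "defect \<mu> \<nu> (s a x) = s a (defect \<mu> \<nu> x)"
        by (simp add: defect_def J_scale bk_closed scale_right_diff_distrib scale_left_commute mult.commute)
      then show "defect \<mu> \<nu> (s a x) = 0" using that R by simp
    qed
    show "\<forall>\<mu>\<in>R. \<forall>\<nu>\<in>R. defect \<mu> \<nu> (t w) = 0" if "w \<in> Tup" for w
      using defect_t that by blast
    show "\<forall>\<mu>\<in>R. \<forall>\<nu>\<in>R. defect \<mu> \<nu> (A \<alpha> x) = 0"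
      if "\<alpha> \<in> R1" "x \<in> V" "\<forall>\<mu>\<in>R. \<forall>\<nu>\<in>R. defect \<mu> \<nu> x = 0" for \<alpha> x
      using that bk_closed R1D by (simp add: defect_A linear_0[OF A_linear])
  qed
  then show ?thesis using assms by (simp add: defect_def)
qed

end


section \<open>Local parameters of the projective line\<close>

lemma loc_par_0 [simp]: "loc_par p 0 = p"
  by (cases p) (auto simp: loc_par_def)

lemma loc_par_inj: "loc_par p u = loc_par p v \<Longrightarrow> u = v"
  by (cases p) (auto simp: loc_par_def split: if_splits)

text \<open>The transition from the parameter at a nearby point to the one at \<open>p\<close>. It
  transports analyticity between neighbouring points. At infinity with \<open>v \<noteq> 0\<close>
  it is \<open>1 / (1 / v + t)\<close>.\<close>

lemma loc_par_shift:
  obtains \<kappa> where "\<kappa> analytic_on {0}" "\<kappa> 0 = v" "\<forall>\<^sub>F t in nhds 0. loc_par (loc_par p v) t = loc_par p (\<kappa> t)"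
proof (cases p)
  case (Some a)
  show ?thesis
    by (rule that[of "\<lambda>t. v + t"]) (auto intro!: analytic_intros simp: Some loc_par_def)
next
  case None
  show ?thesis
  proof (cases "v = 0")
    case True
    then show ?thesis by (intro that[of "\<lambda>t. t"]) (auto intro!: analytic_intros)
  next
    case False
    have "((\<lambda>t. inverse v + t) \<longlongrightarrow> inverse v + 0) (nhds (0::complex))"
      by (intro tendsto_intros filterlim_ident)
    then have "\<forall>\<^sub>F t in nhds 0. inverse v + t \<noteq> (0::complex)"
      by (rule tendsto_imp_eventually_ne) (use False in simp)
    then have "\<forall>\<^sub>F t in nhds 0. loc_par (loc_par p v) t = loc_par p (inverse (inverse v + t))"
      by eventually_elim (use False None in \<open>simp add: loc_par_def\<close>)
    then show ?thesis
      using False by (intro that[of "\<lambda>t. inverse (inverse v + t)"]) (auto intro!: analytic_intros)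
  qed
qed

lemma eventually_loc_par_neq: "\<forall>\<^sub>F v in at 0. loc_par p v \<noteq> q"
proof (cases "\<exists>v0. loc_par p v0 = q")
  case True
  then obtain v0 where v0: "loc_par p v0 = q" by blast
  have "\<forall>\<^sub>F v in at (0::complex). v \<noteq> v0"
    by (rule eventually_neq_at_within)
  then show ?thesis
    by eventually_elim (use v0 loc_par_inj in blast)
qed (auto intro!: always_eventually)

lemma eventually_loc_par_notin:
  assumes "finite X"
  shows "\<forall>\<^sub>F v in at 0. loc_par p v \<notin> X"
proof -
  have "\<forall>\<^sub>F v in at 0. \<forall>q\<in>X. loc_par p v \<noteq> q"
    by (rule eventually_ball_finite[OF assms]) (simp add: eventually_loc_par_neq)
  then show ?thesis by eventually_elim auto
qed

text \<open>Compactness of the projective line in the form in which it is used: a property without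
  accumulation points holds at finitely many points only.\<close>

lemma finite_if_isolated:
  assumes "\<And>p. \<forall>\<^sub>F v in at 0. \<not> P (loc_par p v)"
  shows "finite {p. P p}"
proof -
  obtain r where r: "r > 0" "\<And>v. v \<noteq> 0 \<Longrightarrow> norm v < r \<Longrightarrow> \<not> P (loc_par None v)"
    using assms[of None] by (auto simp: eventually_at dist_norm)
  define S where "S = {z. P (Some z)}"
  \<comment> \<open>Isolation at infinity bounds the finite points with the property; an infinite
    bounded set would accumulate at a finite point.\<close>
  have bound: "norm z \<le> 1 / r" if "z \<in> S" for z
  proof (rule ccontr)
    assume "\<not> norm z \<le> 1 / r"
    then have *: "1 / r < norm z" by simp
    then have z: "norm z > 0" using r(1) by (smt (verit) divide_pos_pos)
    have "norm (inverse z) = 1 / norm z"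
      by (simp add: norm_inverse inverse_eq_divide[of "norm z"])
    also have "\<dots> < r"
      using * r(1) z by (simp add: field_simps)
    finally have "norm (inverse z) < r" .
    then have "\<not> P (loc_par None (inverse z))"
      using z by (intro r(2)) auto
    then show False using that z by (auto simp: S_def loc_par_def)
  qed
  have "finite S"
  proof (rule ccontr)
    assume "infinite S"
    moreover have "bounded S"
      unfolding bounded_iff using bound by blast
    ultimately obtain a where a: "a islimpt S"
      using bounded_infinite_imp_islimpt[of S S] by auto
    obtain e where "e > 0" "\<And>v. v \<noteq> 0 \<Longrightarrow> norm v < e \<Longrightarrow> \<not> P (loc_par (Some a) v)"
      using assms[of "Some a"] by (auto simp: eventually_at dist_norm)
    moreover from this(1) obtain z where "z \<in> S" "z \<noteq> a" "dist z a < e"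
      using a unfolding islimpt_approachable by blast
    ultimately have "\<not> P (loc_par (Some a) (z - a))"
      by (simp add: dist_norm)
    then show False using \<open>z \<in> S\<close> by (simp add: S_def loc_par_def)
  qed
  moreover have "{p. P p} \<subseteq> insert None (Some ` S)"
  proof
    fix p assume "p \<in> {p. P p}"
    then show "p \<in> insert None (Some ` S)" by (cases p) (auto simp: S_def)
  qed
  ultimately show ?thesis by (meson finite.insertI finite_imageI finite_subset)
qed

section \<open>Linear functionals\<close>

locale complex_vs = vector_space sg for sg :: "complex \<Rightarrow> 'g::ab_group_add \<Rightarrow> 'g"
begin

sublocale cf: vector_space_pair sg "(*) :: complex \<Rightarrow> complex \<Rightarrow> complex"
  by unfold_locales

abbreviation functional :: "('g \<Rightarrow> complex) \<Rightarrow> bool" where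
  "functional \<equiv> Vector_Spaces.linear sg (*)"

lemma functionalI:
  assumes "\<And>x y. l (x + y) = l x + l y" "\<And>c x. l (sg c x) = c * l x"
  shows "functional l"
  using assms by (simp add: Vector_Spaces.linear_iff vector_space_axioms vector_space_over_itself.vector_space_axioms)

text \<open>A basis \<open>T\<close> of the span has dual functionals, extended to the whole space.
  They reduce statements about vector-valued maps to finitely many scalar functions.\<close>

lemma coordinates:
  assumes "finite S"
  obtains T e where "finite T" "T \<subseteq> S" "\<And>b. functional (e b)" "\<And>x. x \<in> span S \<Longrightarrow> x = (\<Sum>b\<in>T. sg (e b x) b)"
proof -
  obtain T where T: "T \<subseteq> S" "independent T" "S \<subseteq> span T"
    using maximal_independent_subset by blast
  have fin: "finite T" using T(1) assms by (rule finite_subset)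
  define e where "e b = cf.construct T (\<lambda>x. if x = b then 1 else 0)" for b
  have lin: "functional (e b)" for b
    unfolding e_def by (rule cf.linear_construct[OF T(2)])
  have e_basis: "e b x = (if x = b then 1 else 0)" if "x \<in> T" for b x
    unfolding e_def by (subst cf.construct_basis[OF T(2) that]) simp
  have "subspace {x. x = (\<Sum>b\<in>T. sg (e b x) b)}"
    by (rule subspaceI)
       (simp_all add: cf.linear_0[OF lin] cf.linear_add[OF lin] cf.linear_scale[OF lin]
         scale_left_distrib sum.distrib scale_sum_right[symmetric] flip: scale_scale)
  moreover have "T \<subseteq> {x. x = (\<Sum>b\<in>T. sg (e b x) b)}"
  proof
    fix x assume x: "x \<in> T"
    have "(\<Sum>b\<in>T. sg (e b x) b) = (\<Sum>b\<in>T. if b = x then x else 0)"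
      by (intro sum.cong refl) (auto simp: e_basis[OF x])
    then show "x \<in> {x. x = (\<Sum>b\<in>T. sg (e b x) b)}"
      using x fin by simp
  qed
  ultimately have "span T \<subseteq> {x. x = (\<Sum>b\<in>T. sg (e b x) b)}"
    by (intro span_minimal)
  moreover have "span S \<subseteq> span T"
    using T(3) by (intro span_minimal) auto
  ultimately show ?thesis
    using that[of T e] fin T(1) lin by blast
qed

lemma functionals_separate:
  assumes "\<And>l. functional l \<Longrightarrow> l x = l y"
  shows "x = y"
proof (rule ccontr)
  assume "x \<noteq> y"
  then have ind: "independent {x - y}" by simp
  let ?l = "cf.construct {x - y} (\<lambda>_. 1)"
  have lin: "functional ?l" by (rule cf.linear_construct[OF ind])
  have "?l (x - y) = 1" by (rule cf.construct_basis[OF ind]) simp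
  then show False using assms[OF lin] cf.linear_diff[OF lin] by simp
qed

definition fin_dim :: "('x \<Rightarrow> 'g) \<Rightarrow> bool" where
  "fin_dim f \<longleftrightarrow> (\<exists>S. finite S \<and> range f \<subseteq> span S)"

lemma fin_dim_coordinates:
  assumes "fin_dim f"
  obtains T e where "finite T" "\<And>b. functional (e b)" "\<And>p. f p = (\<Sum>b\<in>T. sg (e b (f p)) b)"
proof -
  obtain S where S: "finite S" "range f \<subseteq> span S" using assms by (auto simp: fin_dim_def)
  obtain T e where T: "finite T" "\<And>b. functional (e b)" "\<And>x. x \<in> span S \<Longrightarrow> x = (\<Sum>b\<in>T. sg (e b x) b)"
    using coordinates[OF S(1)] by metis
  have "f p = (\<Sum>b\<in>T. sg (e b (f p)) b)" for p
    by (rule T(3)) (use S(2) in auto)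
  with T(1,2) show ?thesis by (rule that)
qed

lemma fin_dimI:
  assumes "finite T" "\<And>p. f p = (\<Sum>b\<in>T. sg (a b p) b)"
  shows "fin_dim f"
  unfolding fin_dim_def
proof (intro exI[of _ T] conjI)
  show "range f \<subseteq> span T"
    using assms(2) by (auto intro!: span_sum span_scale intro: span_base)
qed fact

lemma functional_sum: "functional l \<Longrightarrow> l (\<Sum>b\<in>T. sg (a b) (x b)) = (\<Sum>b\<in>T. a b * l (x b))"
  by (simp add: cf.linear_sum cf.linear_scale)

definition bilinear_form :: "('g \<Rightarrow> 'g \<Rightarrow> complex) \<Rightarrow> bool" where
  "bilinear_form \<beta> \<longleftrightarrow> (\<forall>x. functional (\<beta> x)) \<and> (\<forall>y. functional (\<lambda>x. \<beta> x y))"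

text \<open>The coordinates do not depend on \<open>\<beta>\<close>, and the two points may differ,
  as is needed when only one argument is differentiated.\<close>

lemma bilinear_expand:
  assumes "fin_dim f" "fin_dim h"
  obtains T T' e e' where "finite T" "finite T'" "\<And>b. functional (e b)" "\<And>b. functional (e' b)"
    "\<And>\<beta> p q. bilinear_form \<beta> \<Longrightarrow> \<beta> (f p) (h q) = (\<Sum>b\<in>T. \<Sum>b'\<in>T'. e b (f p) * (e' b' (h q) * \<beta> b b'))"
proof -
  obtain T e where T: "finite T" "\<And>b. functional (e b)" "\<And>p. f p = (\<Sum>b\<in>T. sg (e b (f p)) b)"
    using fin_dim_coordinates[OF assms(1)] by metis
  obtain T' e' where T': "finite T'" "\<And>b. functional (e' b)" "\<And>p. h p = (\<Sum>b\<in>T'. sg (e' b (h p)) b)"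
    using fin_dim_coordinates[OF assms(2)] by metis
  have "\<beta> (f p) (h q) = (\<Sum>b\<in>T. \<Sum>b'\<in>T'. e b (f p) * (e' b' (h q) * \<beta> b b'))"
    if \<beta>: "bilinear_form \<beta>" for \<beta> p q
  proof -
    have "\<beta> (f p) (h q) = (\<Sum>b\<in>T. e b (f p) * \<beta> b (h q))"
      using \<beta> functional_sum[of "\<lambda>x. \<beta> x (h q)"] arg_cong[OF T(3), of "\<lambda>x. \<beta> x (h q)" p]
      unfolding bilinear_form_def by simp
    moreover have "\<beta> b (h q) = (\<Sum>b'\<in>T'. e' b' (h q) * \<beta> b b')" for b
      using \<beta> functional_sum[of "\<beta> b"] arg_cong[OF T'(3), of "\<beta> b" q]
      unfolding bilinear_form_def by simp
    ultimately show ?thesis by (simp add: sum_distrib_left)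
  qed
  with T(1) T'(1) T(2) T'(2) show ?thesis by (rule that)
qed

section \<open>Meromorphic maps\<close>

text \<open>Meromorphic maps without a convention for the values at the poles.\<close>

definition premerom :: "(p1 \<Rightarrow> 'g) \<Rightarrow> bool" where
  "premerom f \<longleftrightarrow> fin_dim f \<and> (\<forall>p l. functional l \<longrightarrow> (\<lambda>v. l (f (loc_par p v))) meromorphic_on {0})"

lemma regular_at_iff: "regular_at sg f p \<longleftrightarrow> (\<forall>l. functional l \<longrightarrow> (\<lambda>v. l (f (loc_par p v))) analytic_on {0})"
  by (simp add: regular_at_def o_def)

lemma regular_atD: "regular_at sg f p \<Longrightarrow> functional l \<Longrightarrow> (\<lambda>v. l (f (loc_par p v))) analytic_on {0}"
  by (simp add: regular_at_iff)

lemma premeromD: "premerom f \<Longrightarrow> functional l \<Longrightarrow> (\<lambda>v. l (f (loc_par p v))) meromorphic_on {0}"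
  and premerom_fin_dim: "premerom f \<Longrightarrow> fin_dim f"
  by (simp_all add: premerom_def)

lemma merom_maps_iff: "f \<in> merom_maps sg \<longleftrightarrow> premerom f \<and>
    (\<forall>p. regular_at sg f p \<or> f p = 0 \<and> (\<exists>l. functional l \<and> is_pole (\<lambda>v. l (f (loc_par p v))) 0))"
  unfolding merom_maps_def premerom_def fin_dim_def by (auto simp: o_def)

text \<open>There are infinitely many functionals to test, but each is a combination of finitely
  many coordinates on the range of \<open>f\<close>. The coordinates have a common punctured
  neighbourhood of analyticity at each point, and compactness does the rest.\<close>

lemma finite_nonregular:
  assumes f: "premerom f"
  shows "finite {p. \<not> regular_at sg f p}"
proof (rule finite_if_isolated)
  fix p
  obtain T e where T: "finite T" "\<And>b. functional (e b)" "\<And>p. f p = (\<Sum>b\<in>T. sg (e b (f p)) b)"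
    using fin_dim_coordinates[OF premerom_fin_dim[OF f]] by metis
  have "\<forall>\<^sub>F v in at 0. (\<lambda>v. e b (f (loc_par p v))) analytic_on {v}" for b
  proof -
    have "isolated_singularity_at (\<lambda>v. e b (f (loc_par p v))) 0"
      using premeromD[OF f T(2)] by (simp add: meromorphic_at_iff)
    then obtain r where r: "r > 0" "(\<lambda>v. e b (f (loc_par p v))) analytic_on ball 0 r - {0}"
      by (auto simp: isolated_singularity_at_def)
    have "\<forall>\<^sub>F v in at 0. v \<in> ball 0 r - {0::complex}"
      using r by (intro eventually_at_in_open) auto
    then show ?thesis
      by eventually_elim (use r(2) in \<open>auto intro: analytic_on_subset\<close>)
  qed
  then have "\<forall>\<^sub>F v in at 0. \<forall>b\<in>T. (\<lambda>v. e b (f (loc_par p v))) analytic_on {v}"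
    by (intro eventually_ball_finite T(1)) auto
  then show "\<forall>\<^sub>F v in at 0. \<not> \<not> regular_at sg f (loc_par p v)"
  proof eventually_elim
    case (elim v)
    obtain \<kappa> where \<kappa>: "\<kappa> analytic_on {0}" "\<kappa> 0 = v"
        "\<forall>\<^sub>F t in nhds 0. loc_par (loc_par p v) t = loc_par p (\<kappa> t)"
      using loc_par_shift by blast
    have "(\<lambda>t. l (f (loc_par (loc_par p v) t))) analytic_on {0}" if l: "functional l" for l
    proof -
      have ev: "\<forall>\<^sub>F t in nhds 0. l (f (loc_par (loc_par p v) t)) = (\<Sum>b\<in>T. e b (f (loc_par p (\<kappa> t))) * l b)"
        using \<kappa>(3)
      proof eventually_elim
        case (elim t)
        show ?case unfolding elim by (subst T(3)) (rule functional_sum[OF l])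
      qed
      have "(\<lambda>t. e b (f (loc_par p (\<kappa> t)))) analytic_on {0}" if "b \<in> T" for b
        using analytic_on_compose[OF \<kappa>(1), of "\<lambda>v. e b (f (loc_par p v))"] \<kappa>(2) elim that by (simp add: o_def)
      then have "(\<lambda>t. \<Sum>b\<in>T. e b (f (loc_par p (\<kappa> t))) * l b) analytic_on {0}"
        by (intro analytic_intros)
      then show ?thesis
        using analytic_at_cong[OF ev refl] by simp
    qed
    then show ?case by (simp add: regular_at_iff)
  qed
qed

text \<open>Whether a point is a pole is visible in a punctured neighbourhood. At a pole both values
  are \<open>0\<close> by convention, and at a regular point every functional of the value is a
  limit of nearby ones.\<close>

lemma merom_maps_eqI:
  assumes f: "f \<in> merom_maps sg" and h: "h \<in> merom_maps sg" and fin: "finite {p. f p \<noteq> h p}"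
  shows "f = h"
proof
  fix p
  have ev: "\<forall>\<^sub>F v in at 0. f (loc_par p v) = h (loc_par p v)"
    using eventually_loc_par_notin[OF fin, of p] by simp
  have pole: "is_pole (\<lambda>v. l (f (loc_par p v))) 0 \<longleftrightarrow> is_pole (\<lambda>v. l (h (loc_par p v))) 0" for l :: "'g \<Rightarrow> complex"
    by (rule is_pole_cong[OF _ refl]) (use ev in eventually_elim, simp)
  have no_pole: "\<not> is_pole (\<lambda>v. l (u (loc_par p v))) 0" if "regular_at sg u p" "functional l" for u l
    using regular_atD[OF that] by (rule analytic_at_imp_no_pole)
  show "f p = h p"
  proof (cases "regular_at sg f p")
    case True
    then have reg: "regular_at sg h p"
      using h pole no_pole[OF True] unfolding merom_maps_iff by blast
    show ?thesis
    proof (rule functionals_separate)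
      fix l assume l: "functional l"
      have lim: "(\<lambda>v. l (u (loc_par p v))) \<midarrow>0\<rightarrow> l (u p)" if "regular_at sg u p" for u
        using analytic_at_imp_isCont[OF regular_atD[OF that l]] by (simp add: isCont_def)
      have "(\<lambda>v. l (f (loc_par p v))) \<midarrow>0\<rightarrow> l (h p)"
        by (rule Lim_transform_eventually[OF lim[OF reg]]) (use ev in eventually_elim, simp)
      with lim[OF True] show "l (f p) = l (h p)"
        by (rule LIM_unique)
    qed
  next
    case False
    then have "\<not> regular_at sg h p"
      using f pole no_pole[of h] unfolding merom_maps_iff by blast
    with f h False have "f p = 0" "h p = 0"
      unfolding merom_maps_iff by blast+
    then show ?thesis by simp
  qed
qed

section \<open>Removing singularities\<close>

lemma regular_at_cong:
  assumes "\<forall>\<^sub>F v in nhds 0. f (loc_par p v) = h (loc_par p v)"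
  shows "regular_at sg f p \<longleftrightarrow> regular_at sg h p"
proof -
  have "(\<lambda>v. l (f (loc_par p v))) analytic_on {0} \<longleftrightarrow> (\<lambda>v. l (h (loc_par p v))) analytic_on {0}"
    for l :: "'g \<Rightarrow> complex"
    by (rule analytic_at_cong[OF _ refl]) (use assms in eventually_elim, simp)
  then show ?thesis by (simp add: regular_at_iff)
qed

lemma regularise_exists:
  assumes h: "premerom h"
  obtains f where "f \<in> merom_maps sg" "finite {p. f p \<noteq> h p}" "\<And>p. regular_at sg h p \<Longrightarrow> f p = h p"
proof -
  obtain S where S: "finite S" "range h \<subseteq> span S" using premerom_fin_dim[OF h] by (auto simp: fin_dim_def)
  obtain T e where T: "finite T" "T \<subseteq> S" "\<And>b. functional (e b)" "\<And>x. x \<in> span S \<Longrightarrow> x = (\<Sum>b\<in>T. sg (e b x) b)"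
    using coordinates[OF S(1)] by metis
  \<comment> \<open>The limit value at a removable singularity, assembled from the limits of the
    coordinates so that it stays in the span of \<open>S\<close>.\<close>
  define y where "y p = (\<Sum>b\<in>T. sg (remove_sings (\<lambda>v. e b (h (loc_par p v))) 0) b)" for p
  define pole where "pole p \<longleftrightarrow> (\<exists>l. functional l \<and> is_pole (\<lambda>v. l (h (loc_par p v))) 0)" for p
  define f where "f p = (if regular_at sg h p then h p else if pole p then 0 else y p)" for p
  have fin: "finite {p. f p \<noteq> h p}"
    by (rule finite_subset[OF _ finite_nonregular[OF h]]) (auto simp: f_def)
  have "f p \<in> span S" for p
    using S(2) T(2) by (auto simp: f_def y_def intro!: span_zero span_sum span_scale intro: span_base)
  then have "fin_dim f" using S(1) by (auto simp: fin_dim_def)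
  have ev: "\<forall>\<^sub>F v in at 0. f (loc_par p v) = h (loc_par p v)" for p
    using eventually_loc_par_notin[OF fin, of p] by simp
  have ev_l: "\<forall>\<^sub>F v in at 0. l (f (loc_par p v)) = l (h (loc_par p v))" for p and l :: "'g \<Rightarrow> complex"
    using ev[of p] by eventually_elim simp
  have pre: "premerom f"
    unfolding premerom_def
  proof (intro conjI allI impI)
    fix p l assume l: "functional l"
    show "(\<lambda>v. l (f (loc_par p v))) meromorphic_on {0}"
      using premeromD[OF h l, of p] meromorphic_on_cong[of "{0}" "\<lambda>v. l (f (loc_par p v))" "\<lambda>v. l (h (loc_par p v))" "{0}"]
        ev_l by simp
  qed fact
  have "f \<in> merom_maps sg"
    unfolding merom_maps_iff
  proof (intro conjI allI pre)
    fix p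
    have ev0: "\<forall>\<^sub>F v in nhds 0. P v" if "\<forall>\<^sub>F v in at 0. P v" "P 0" for P :: "complex \<Rightarrow> bool"
      using that unfolding eventually_at_filter by (auto elim!: eventually_mono)
    consider "regular_at sg h p" | "\<not> regular_at sg h p" "pole p" | "\<not> regular_at sg h p" "\<not> pole p" by blast
    then show "regular_at sg f p \<or> f p = 0 \<and> (\<exists>l. functional l \<and> is_pole (\<lambda>v. l (f (loc_par p v))) 0)"
    proof cases
      case 1
      then have "\<forall>\<^sub>F v in nhds 0. f (loc_par p v) = h (loc_par p v)"
        by (intro ev0 ev) (simp add: f_def)
      then show ?thesis using regular_at_cong 1 by blast
    next
      case 2
      then obtain l where l: "functional l" "is_pole (\<lambda>v. l (h (loc_par p v))) 0" by (auto simp: pole_def)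
      then have "is_pole (\<lambda>v. l (f (loc_par p v))) 0"
        using is_pole_cong[OF ev_l refl] by blast
      then show ?thesis using 2 l(1) by (auto simp: f_def)
    next
      case 3
      \<comment> \<open>The coordinates are meromorphic, so their singularities are not essential,
        and no functional has a pole here. Hence they have finite limits.\<close>
      have reg: "remove_sings (\<lambda>v. e b (h (loc_par p v))) analytic_on {0}"
        and ev_rs: "\<forall>\<^sub>F v in at 0. remove_sings (\<lambda>v. e b (h (loc_par p v))) v = e b (h (loc_par p v))" for b
      proof -
        have m: "isolated_singularity_at (\<lambda>v. e b (h (loc_par p v))) 0" "not_essential (\<lambda>v. e b (h (loc_par p v))) 0"
          using premeromD[OF h T(3)] by (simp_all add: meromorphic_at_iff)
        then obtain c where "(\<lambda>v. e b (h (loc_par p v))) \<midarrow>0\<rightarrow> c"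
          using 3(2) T(3) unfolding not_essential_def pole_def by blast
        then show "remove_sings (\<lambda>v. e b (h (loc_par p v))) analytic_on {0}"
          using m(1) by (intro remove_sings_analytic_at)
        show "\<forall>\<^sub>F v in at 0. remove_sings (\<lambda>v. e b (h (loc_par p v))) v = e b (h (loc_par p v))"
          by (rule eventually_remove_sings_eq_at[OF m(1)])
      qed
      have "(\<lambda>v. l (f (loc_par p v))) analytic_on {0}" if l: "functional l" for l
      proof -
        let ?A = "\<lambda>v. \<Sum>b\<in>T. remove_sings (\<lambda>v. e b (h (loc_par p v))) v * l b"
        have "\<forall>\<^sub>F v in at 0. \<forall>b\<in>T. remove_sings (\<lambda>v. e b (h (loc_par p v))) v = e b (h (loc_par p v))"
          by (intro eventually_ball_finite T(1)) (use ev_rs in auto)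
        then have "\<forall>\<^sub>F v in at 0. l (f (loc_par p v)) = ?A v"
          using ev[of p]
        proof eventually_elim
          case (elim v)
          have "h (loc_par p v) = (\<Sum>b\<in>T. sg (e b (h (loc_par p v))) b)"
            using S(2) by (intro T(4)) auto
          from arg_cong[OF this, of l]
          have "l (h (loc_par p v)) = (\<Sum>b\<in>T. e b (h (loc_par p v)) * l b)"
            by (simp only: functional_sum[OF l])
          then show ?case using elim by simp
        qed
        moreover have "l (f (loc_par p 0)) = ?A 0"
          using 3 by (simp add: f_def y_def functional_sum[OF l])
        ultimately have "\<forall>\<^sub>F v in nhds 0. l (f (loc_par p v)) = ?A v"
          by (rule ev0)
        moreover have "?A analytic_on {0}"
          by (intro analytic_intros reg)
        ultimately show ?thesis using analytic_at_cong by fast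
      qed
      then show ?thesis by (simp add: regular_at_iff)
    qed
  qed
  then show ?thesis using fin by (intro that[of f]) (auto simp: f_def)
qed

lemma regularise:
  assumes h: "premerom h"
  shows "regularise sg h \<in> merom_maps sg" "finite {p. regularise sg h p \<noteq> h p}"
    and "regular_at sg h p \<Longrightarrow> regularise sg h p = h p"
proof -
  obtain f where f: "f \<in> merom_maps sg" "finite {p. f p \<noteq> h p}" "\<And>p. regular_at sg h p \<Longrightarrow> f p = h p"
    using regularise_exists[OF h] by blast
  have "regularise sg h = f"
    unfolding regularise_def
  proof (rule the_equality)
    fix g assume g: "g \<in> merom_maps sg \<and> finite {p. g p \<noteq> h p}"
    have "{p. g p \<noteq> f p} \<subseteq> {p. g p \<noteq> h p} \<union> {p. f p \<noteq> h p}" by auto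
    then have "finite {p. g p \<noteq> f p}" using g f(2) by (meson finite_Un finite_subset)
    then show "g = f" using g f(1) by (intro merom_maps_eqI) auto
  qed (use f in simp)
  then show "regularise sg h \<in> merom_maps sg" "finite {p. regularise sg h p \<noteq> h p}"
    "regular_at sg h p \<Longrightarrow> regularise sg h p = h p"
    using f by auto
qed

text \<open>A member of \<open>merom_maps\<close> that fails to be regular has a genuine pole under
  some functional, which an analytic function agreeing with it nearby rules out.\<close>

lemma merom_regular_if_removable:
  assumes f: "f \<in> merom_maps sg"
    and ev: "\<And>l. functional l \<Longrightarrow> \<exists>A. A analytic_on {0} \<and> (\<forall>\<^sub>F v in at 0. l (f (loc_par p v)) = A v)"
  shows "regular_at sg f p"
proof (rule ccontr)
  assume "\<not> regular_at sg f p"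
  then obtain l where l: "functional l" "is_pole (\<lambda>v. l (f (loc_par p v))) 0"
    using f unfolding merom_maps_iff by blast
  obtain A where A: "A analytic_on {0}" "\<forall>\<^sub>F v in at 0. l (f (loc_par p v)) = A v"
    using ev[OF l(1)] by blast
  have "is_pole A 0" using is_pole_cong[OF A(2) refl] l(2) by blast
  then show False using analytic_at_imp_no_pole[OF A(1)] by blast
qed

lemma regular_at_regularise:
  assumes h: "premerom h" and reg: "regular_at sg h p"
  shows "regular_at sg (regularise sg h) p"
proof (rule merom_regular_if_removable[OF regularise(1)[OF h]])
  fix l assume l: "functional l"
  have "\<forall>\<^sub>F v in at 0. regularise sg h (loc_par p v) = h (loc_par p v)"
    using eventually_loc_par_notin[OF regularise(2)[OF h], of p] by simp
  then have "\<forall>\<^sub>F v in at 0. l (regularise sg h (loc_par p v)) = l (h (loc_par p v))"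
    by eventually_elim simp
  then show "\<exists>A. A analytic_on {0} \<and> (\<forall>\<^sub>F v in at 0. l (regularise sg h (loc_par p v)) = A v)"
    using regular_atD[OF reg l] by blast
qed

end


context complex_vs
begin

section \<open>The Lie algebra of meromorphic maps\<close>

lemma merom_maps_premerom: "f \<in> merom_maps sg \<Longrightarrow> premerom f"
  by (simp add: merom_maps_iff)

lemma fin_dim_add:
  assumes "fin_dim f" "fin_dim h"
  shows "fin_dim (\<lambda>p. f p + h p)"
proof -
  obtain S S' where S: "finite S" "range f \<subseteq> span S" "finite S'" "range h \<subseteq> span S'"
    using assms by (auto simp: fin_dim_def)
  have "span S \<subseteq> span (S \<union> S')" "span S' \<subseteq> span (S \<union> S')"
    by (intro span_mono; simp)+
  moreover have "f p \<in> span S" "h p \<in> span S'" for p using S by auto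
  ultimately have "f p + h p \<in> span (S \<union> S')" for p
    by (intro span_add) blast+
  then show ?thesis
    unfolding fin_dim_def using S by (intro exI[of _ "S \<union> S'"]) auto
qed

lemma fin_dim_scale:
  assumes "fin_dim f"
  shows "fin_dim (\<lambda>p. sg c (f p))"
proof -
  obtain S where S: "finite S" "range f \<subseteq> span S" using assms by (auto simp: fin_dim_def)
  then have "sg c (f p) \<in> span S" for p by (intro span_scale) auto
  then show ?thesis unfolding fin_dim_def using S by (intro exI[of _ S]) auto
qed

lemma premerom_add: "premerom f \<Longrightarrow> premerom h \<Longrightarrow> premerom (\<lambda>p. f p + h p)"
  unfolding premerom_def by (auto intro!: fin_dim_add meromorphic_intros simp: cf.linear_add)

lemma premerom_scale: "premerom f \<Longrightarrow> premerom (\<lambda>p. sg c (f p))"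
  unfolding premerom_def by (auto intro!: fin_dim_scale meromorphic_intros simp: cf.linear_scale)

lemma regular_at_add: "regular_at sg f p \<Longrightarrow> regular_at sg h p \<Longrightarrow> regular_at sg (\<lambda>p. f p + h p) p"
  unfolding regular_at_iff by (auto intro!: analytic_intros simp: cf.linear_add)

lemma regular_at_scale: "regular_at sg f p \<Longrightarrow> regular_at sg (\<lambda>p. sg c (f p)) p"
  unfolding regular_at_iff by (auto intro!: analytic_intros simp: cf.linear_scale)

text \<open>The operations of the Lie algebra are pointwise off a finite set. Its identities are
  therefore checked pointwise at almost every point.\<close>

lemma merom_eq_cofiniteI:
  assumes "f \<in> merom_maps sg" "h \<in> merom_maps sg" "\<forall>\<^sub>F p in cofinite. f p = h p"
  shows "f = h"
  using assms(3) by (intro merom_maps_eqI assms(1,2)) (simp add: eventually_cofinite)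

lemma regularise_cofinite: "premerom h \<Longrightarrow> \<forall>\<^sub>F p in cofinite. regularise sg h p = h p"
  using regularise(2) by (simp add: eventually_cofinite)

end

sublocale quadratic_lie_algebra \<subseteq> complex_vs sg
  by unfold_locales

context quadratic_lie_algebra
begin

abbreviation "G \<equiv> merom_lie sg br"

lemma G_simps: "carrier G = merom_maps sg" "f \<oplus>\<^bsub>G\<^esub> h = regularise sg (\<lambda>p. f p + h p)"
  "c \<odot>\<^bsub>G\<^esub> f = regularise sg (\<lambda>p. sg c (f p))" "lie_bracket G f h = regularise sg (\<lambda>p. br (f p) (h p))"
  by (simp_all add: merom_lie_def)

lemma br_add_left: "br (x + y) t = br x t + br y t" and br_add_right: "br t (x + y) = br t x + br t y"
  and br_scale_left: "br (sg c x) t = sg c (br x t)" and br_scale_right: "br t (sg c x) = sg c (br t x)"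
  using br_linear by (simp_all add: Vector_Spaces.linear_iff)

lemma br_anti: "br y x = - br x y"
proof -
  have "br y x + br x y = 0"
    using br_alternating[of "x + y"] unfolding br_add_left br_add_right
    by (simp add: br_alternating add.commute)
  then show ?thesis by (simp add: eq_neg_iff_add_eq_0)
qed

lemma br_minus_right: "br x (- y) = - br x y"
  using br_add_right[of x "- y" y] br_add_right[of x 0 0] by (simp add: eq_neg_iff_add_eq_0)

lemma jacobi_derivation: "br (br x y) t = br x (br y t) - br y (br x t)"
proof -
  have "br y (br t x) = - br y (br x t)" "br t (br x y) = - br (br x y) t"
    using br_anti br_minus_right by metis+
  then show ?thesis using jacobi[of x y t] by (simp add: algebra_simps)
qed

lemma bilinear_form_br: "functional l \<Longrightarrow> bilinear_form (\<lambda>x y. l (br x y))"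
  unfolding bilinear_form_def
  by (auto intro!: functionalI simp: br_add_left br_add_right br_scale_left br_scale_right cf.linear_add cf.linear_scale)

lemma bilinear_form_B: "bilinear_form B"
  unfolding bilinear_form_def
proof (intro conjI allI)
  show "functional (B x)" for x by (rule form_linear)
  show "functional (\<lambda>x. B x y)" for y using form_linear[of y] by (simp add: form_sym[of _ y])
qed

lemma fin_dim_br:
  assumes "fin_dim f" "fin_dim h"
  shows "fin_dim (\<lambda>p. br (f p) (h p))"
proof -
  interpret ss: vector_space_pair sg sg by unfold_locales
  obtain T e where T: "finite T" "\<And>p. f p = (\<Sum>b\<in>T. sg (e b (f p)) b)"
    using fin_dim_coordinates[OF assms(1)] by metis
  obtain T' e' where T': "finite T'" "\<And>p. h p = (\<Sum>b\<in>T'. sg (e' b (h p)) b)"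
    using fin_dim_coordinates[OF assms(2)] by metis
  have "br (f p) (h p) \<in> span ((\<lambda>(b, b'). br b b') ` (T \<times> T'))" for p
  proof -
    have "br (f p) (h p) = br (\<Sum>b\<in>T. sg (e b (f p)) b) (\<Sum>b\<in>T'. sg (e' b (h p)) b)"
      using T(2)[of p] T'(2)[of p] by simp
    also have "\<dots> = (\<Sum>b\<in>T. sg (e b (f p)) (br b (\<Sum>b\<in>T'. sg (e' b (h p)) b)))"
      by (simp only: ss.linear_sum[OF br_linear(2)] br_scale_left)
    also have "\<dots> = (\<Sum>b\<in>T. \<Sum>b'\<in>T'. sg (e b (f p)) (sg (e' b' (h p)) (br b b')))"
      by (simp only: ss.linear_sum[OF br_linear(1)] br_scale_right scale_sum_right)
    also have "\<dots> \<in> span ((\<lambda>(b, b'). br b b') ` (T \<times> T'))"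
      by (intro span_sum span_scale span_base) auto
    finally show ?thesis .
  qed
  then show ?thesis
    unfolding fin_dim_def using T(1) T'(1)
    by (intro exI[of _ "(\<lambda>(b, b'). br b b') ` (T \<times> T')"]) auto
qed

lemma premerom_br:
  assumes "premerom f" "premerom h"
  shows "premerom (\<lambda>p. br (f p) (h p))"
  unfolding premerom_def
proof (intro conjI allI impI)
  show "fin_dim (\<lambda>p. br (f p) (h p))" using assms by (intro fin_dim_br premerom_fin_dim)
  fix p l assume l: "functional l"
  obtain T T' e e' where T: "finite T" "finite T'" "\<And>b. functional (e b)" "\<And>b. functional (e' b)"
    "\<And>\<beta> p q. bilinear_form \<beta> \<Longrightarrow> \<beta> (f p) (h q) = (\<Sum>b\<in>T. \<Sum>b'\<in>T'. e b (f p) * (e' b' (h q) * \<beta> b b'))"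
    by (rule bilinear_expand[OF premerom_fin_dim[OF assms(1)] premerom_fin_dim[OF assms(2)]]) (rule that)
  show "(\<lambda>v. l (br (f (loc_par p v)) (h (loc_par p v)))) meromorphic_on {0}"
    unfolding T(5)[OF bilinear_form_br[OF l]]
    by (intro meromorphic_intros premeromD[OF assms(1)] premeromD[OF assms(2)] T)
qed

lemma analytic_bilinear:
  assumes "fin_dim f" "fin_dim h" and reg: "regular_at sg f p" "regular_at sg h p" and \<beta>: "bilinear_form \<beta>"
  shows "(\<lambda>v. \<beta> (f (loc_par p v)) (h (loc_par p v))) analytic_on {0}"
proof -
  obtain T T' e e' where T: "finite T" "finite T'" "\<And>b. functional (e b)" "\<And>b. functional (e' b)"
    "\<And>\<beta> p q. bilinear_form \<beta> \<Longrightarrow> \<beta> (f p) (h q) = (\<Sum>b\<in>T. \<Sum>b'\<in>T'. e b (f p) * (e' b' (h q) * \<beta> b b'))"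
    by (rule bilinear_expand[OF assms(1,2)]) (rule that)
  show ?thesis
    unfolding T(5)[OF \<beta>]
    by (intro analytic_intros regular_atD[OF reg(1)] regular_atD[OF reg(2)] T)
qed

lemma regular_at_br:
  assumes "fin_dim f" "fin_dim h" "regular_at sg f p" "regular_at sg h p"
  shows "regular_at sg (\<lambda>p. br (f p) (h p)) p"
  unfolding regular_at_iff using analytic_bilinear[OF assms bilinear_form_br] by blast

lemma
  assumes f: "f \<in> merom_maps sg"
  shows G_smult_closed: "c \<odot>\<^bsub>G\<^esub> f \<in> merom_maps sg"
    and G_smult_cofinite: "\<forall>\<^sub>F p in cofinite. (c \<odot>\<^bsub>G\<^esub> f) p = sg c (f p)"
    and G_smult_regular: "regular_at sg f q \<Longrightarrow> regular_at sg (c \<odot>\<^bsub>G\<^esub> f) q"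
    and G_smult_eq: "regular_at sg f q \<Longrightarrow> (c \<odot>\<^bsub>G\<^esub> f) q = sg c (f q)"
  unfolding G_simps
  by (intro regularise regularise_cofinite regular_at_regularise regular_at_scale premerom_scale
      merom_maps_premerom f; assumption?)+

lemma
  assumes f: "f \<in> merom_maps sg" and h: "h \<in> merom_maps sg"
  shows G_add_closed: "f \<oplus>\<^bsub>G\<^esub> h \<in> merom_maps sg"
    and G_br_closed: "lie_bracket G f h \<in> merom_maps sg"
    and G_add_cofinite: "\<forall>\<^sub>F p in cofinite. (f \<oplus>\<^bsub>G\<^esub> h) p = f p + h p"
    and G_br_cofinite: "\<forall>\<^sub>F p in cofinite. lie_bracket G f h p = br (f p) (h p)"
  unfolding G_simps
  by (intro regularise regularise_cofinite premerom_add premerom_br merom_maps_premerom f h)+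

lemma
  assumes f: "f \<in> merom_maps sg" "regular_at sg f p" and h: "h \<in> merom_maps sg" "regular_at sg h p"
  shows G_add_regular: "regular_at sg (f \<oplus>\<^bsub>G\<^esub> h) p"
    and G_br_regular: "regular_at sg (lie_bracket G f h) p"
    and G_add_eq: "(f \<oplus>\<^bsub>G\<^esub> h) p = f p + h p"
    and G_br_eq: "lie_bracket G f h p = br (f p) (h p)"
  unfolding G_simps
  by (intro regular_at_regularise regularise(3) premerom_add premerom_br premerom_fin_dim
      regular_at_add regular_at_br merom_maps_premerom f h)+

text \<open>Negation appears as the scalar \<open>-1\<close>, so that the linearity of
  \<open>J\<close> in the map applies to it directly.\<close>

lemma G_bracket_anti:
  assumes f: "f \<in> merom_maps sg" and h: "h \<in> merom_maps sg"
  shows "lie_bracket G h f = (-1) \<odot>\<^bsub>G\<^esub> lie_bracket G f h"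
proof (rule merom_eq_cofiniteI)
  note fh = G_br_closed[OF f h]
  show "\<forall>\<^sub>F p in cofinite. lie_bracket G h f p = ((-1) \<odot>\<^bsub>G\<^esub> lie_bracket G f h) p"
    using G_br_cofinite[OF h f] G_br_cofinite[OF f h] G_smult_cofinite[OF fh, of "-1"]
    by eventually_elim (simp add: br_anti[of "h _"])
qed (intro G_br_closed G_smult_closed f h)+

lemma G_jacobi:
  assumes f: "f \<in> merom_maps sg" and h: "h \<in> merom_maps sg" and k: "k \<in> merom_maps sg"
  shows "lie_bracket G (lie_bracket G f h) k
    = lie_bracket G f (lie_bracket G h k) \<oplus>\<^bsub>G\<^esub> (-1) \<odot>\<^bsub>G\<^esub> lie_bracket G h (lie_bracket G f k)"
proof (rule merom_eq_cofiniteI)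
  note fh = G_br_closed[OF f h] and fk = G_br_closed[OF f k] and hk = G_br_closed[OF h k]
  note hfk = G_br_closed[OF h fk]
  show "\<forall>\<^sub>F p in cofinite. lie_bracket G (lie_bracket G f h) k p
    = (lie_bracket G f (lie_bracket G h k) \<oplus>\<^bsub>G\<^esub> (-1) \<odot>\<^bsub>G\<^esub> lie_bracket G h (lie_bracket G f k)) p"
    using G_br_cofinite[OF f h] G_br_cofinite[OF f k] G_br_cofinite[OF h k] G_br_cofinite[OF fh k]
      G_br_cofinite[OF f hk] G_br_cofinite[OF h fk] G_smult_cofinite[OF hfk, of "-1"]
      G_add_cofinite[OF G_br_closed[OF f hk] G_smult_closed[OF hfk, of "-1"]]
    by eventually_elim (simp add: jacobi_derivation)
qed (intro G_br_closed G_smult_closed G_add_closed f h k)+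

lemma G_bracket_add:
  assumes f: "f \<in> merom_maps sg" and f': "f' \<in> merom_maps sg" and h: "h \<in> merom_maps sg"
  shows "lie_bracket G (f \<oplus>\<^bsub>G\<^esub> f') h = lie_bracket G f h \<oplus>\<^bsub>G\<^esub> lie_bracket G f' h"
proof (rule merom_eq_cofiniteI)
  show "\<forall>\<^sub>F p in cofinite. lie_bracket G (f \<oplus>\<^bsub>G\<^esub> f') h p = (lie_bracket G f h \<oplus>\<^bsub>G\<^esub> lie_bracket G f' h) p"
    using G_add_cofinite[OF f f'] G_br_cofinite[OF f h] G_br_cofinite[OF f' h]
      G_br_cofinite[OF G_add_closed[OF f f'] h] G_add_cofinite[OF G_br_closed[OF f h] G_br_closed[OF f' h]]
    by eventually_elim (simp add: br_add_left)
qed (intro G_br_closed G_add_closed f f' h)+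

abbreviation "L D \<equiv> merom_lie_poles_in sg br D"

lemma L_carrier: "carrier (L D) = {f \<in> merom_maps sg. \<forall>p. p \<notin> D \<longrightarrow> regular_at sg f p}"
  by (auto simp: merom_lie_poles_in_def)

lemma L_simps: "add (L D) = add G" "smult (L D) = smult G" "lie_bracket (L D) = lie_bracket G"
  by (simp_all add: merom_lie_poles_in_def)

lemma closed_lie_alg_L: "closed_lie_alg (L D)"
  by unfold_locales
     (auto simp: L_carrier L_simps intro: G_add_closed G_smult_closed G_br_closed G_add_regular
       G_smult_regular G_br_regular)

lemma const_merom: "(\<lambda>p. x) \<in> merom_maps sg" and const_regular: "regular_at sg (\<lambda>p. x) q"
proof -
  show reg: "regular_at sg (\<lambda>p. x) q" for q
    by (auto simp: regular_at_iff)
  have "fin_dim (\<lambda>p::p1. x)"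
    unfolding fin_dim_def by (intro exI[of _ "{x}"]) (auto intro: span_base)
  then show "(\<lambda>p. x) \<in> merom_maps sg"
    unfolding merom_maps_iff premerom_def using reg by auto
qed

lemma const_hom:
  "(\<lambda>p. x + y) = (\<lambda>p. x) \<oplus>\<^bsub>G\<^esub> (\<lambda>p. y)" "(\<lambda>p. sg c x) = c \<odot>\<^bsub>G\<^esub> (\<lambda>p. x)"
  "(\<lambda>p. br x y) = lie_bracket G (\<lambda>p. x) (\<lambda>p. y)"
  by (rule ext, simp add: G_add_eq G_smult_eq G_br_eq const_merom const_regular)+

lemma closed_lie_alg_of_type: "closed_lie_alg (lie_of_type sg br)"
  by unfold_locales (simp_all add: lie_of_type_def)

lemma const_env_closed:
  assumes "a \<in> carrier (env (lie_of_type sg br))"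
  shows "env_map (L D) (\<lambda>x p. x) a \<in> carrier (env (L D))"
  by (rule env_map_closed[OF closed_lie_alg_of_type closed_lie_alg_L _ _ _ _ assms])
     (auto simp: L_carrier L_simps const_merom const_regular lie_of_type_def const_hom)

end


section \<open>Principal parts\<close>

text \<open>After factoring out the leading power of the Laurent series, the principal part is
  peeled off one power at a time through
  \<open>G v / v ^ (n + 1) = G 0 / v ^ (n + 1) + G1 v / v ^ n\<close>.\<close>

lemma principal_part:
  assumes "F meromorphic_on {0}"
  obtains Q A where "A analytic_on {0}" "\<forall>\<^sub>F v in at 0. F v = poly Q (inverse v) + A v"
proof -
  have *: "\<exists>Q A. A analytic_on {0} \<and> (\<forall>\<^sub>F v in at 0. G v / v ^ n = poly Q (inverse v) + A v)"
    if "G analytic_on {0}" for G :: "complex \<Rightarrow> complex" and n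
    using that
  proof (induction n arbitrary: G)
    case 0
    then show ?case by (intro exI[of _ 0] exI[of _ G]) simp
  next
    case (Suc n)
    \<comment> \<open>The difference quotient of \<open>G\<close> at \<open>0\<close>, completed by
      the derivative; it is holomorphic wherever \<open>G\<close> is.\<close>
    define G1 where "G1 v = (if v = 0 then deriv G 0 else (G v - G 0) / (v - 0))" for v
    obtain S where S: "open S" "0 \<in> S" "G holomorphic_on S"
      using Suc.prems unfolding analytic_at by blast
    have "G1 holomorphic_on S"
      unfolding G1_def using pole_lemma_open[OF S(3,1), of 0] .
    then have "G1 analytic_on {0}"
      using S analytic_at by blast
    from Suc.IH[OF this] obtain Q A where A: "A analytic_on {0}"
        "\<forall>\<^sub>F v in at 0. G1 v / v ^ n = poly Q (inverse v) + A v" by blast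
    have "\<forall>\<^sub>F v in at (0::complex). v \<noteq> 0" by (rule eventually_neq_at_within)
    then have "\<forall>\<^sub>F v in at 0. G v / v ^ Suc n = poly (Q + monom (G 0) (Suc n)) (inverse v) + A v"
      using A(2)
    proof eventually_elim
      case (elim v)
      have "G v / v ^ Suc n = G 0 * inverse v ^ Suc n + G1 v / v ^ n"
        using elim(1) by (simp add: G1_def field_simps)
      then show ?case
        using elim by (simp add: poly_monom)
    qed
    then show ?case using A(1) by blast
  qed
  obtain L where L: "F has_laurent_expansion L"
    using assms unfolding meromorphic_on_def by auto
  let ?k = "fls_subdegree L" and ?G = "eval_fps (fls_base_factor_to_fps L)"
  have r: "fls_conv_radius L > 0" and ev: "\<forall>\<^sub>F v in at 0. eval_fls L v = F v"
    using L by (simp_all add: has_laurent_expansion_def)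
  have G: "?G analytic_on {0}"
    using r by (intro analytic_intros) (auto simp: fls_conv_radius_altdef zero_ereal_def)
  have eval: "eval_fls L v = ?G v * v powi ?k" for v
    by (simp add: eval_fls_def)
  show ?thesis
  proof (cases "?k \<ge> 0")
    case True
    have "(\<lambda>v. ?G v * v ^ nat ?k) analytic_on {0}"
      by (intro analytic_intros G)
    moreover have "\<forall>\<^sub>F v in at 0. F v = poly 0 (inverse v) + ?G v * v ^ nat ?k"
      using ev by eventually_elim (use True in \<open>simp add: eval power_int_def\<close>)
    ultimately show ?thesis by (rule that)
  next
    case False
    obtain Q A where A: "A analytic_on {0}" "\<forall>\<^sub>F v in at 0. ?G v / v ^ nat (- ?k) = poly Q (inverse v) + A v"
      using *[OF G] by blast
    have "\<forall>\<^sub>F v in at 0. F v = poly Q (inverse v) + A v"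
      using ev A(2) by eventually_elim (use False in \<open>simp add: eval power_int_def divide_inverse power_inverse\<close>)
    with A(1) show ?thesis by (rule that)
  qed
qed

text \<open>The inverse of the local parameter at \<open>p\<close>, with the value \<open>0\<close> at its pole \<open>p\<close>.\<close>

definition pole_coord :: "p1 \<Rightarrow> p1 \<Rightarrow> complex" where
  "pole_coord p q = (case p of
      Some b \<Rightarrow> (case q of Some z \<Rightarrow> inverse (z - b) | None \<Rightarrow> 0)
    | None \<Rightarrow> (case q of Some z \<Rightarrow> z | None \<Rightarrow> 0))"

lemma pole_coord_loc_par: "pole_coord p (loc_par p v) = inverse v"
  by (cases p) (auto simp: pole_coord_def loc_par_def)

text \<open>At finite points the formula is visibly analytic. At infinity, with
  \<open>p = Some b\<close>, it reads \<open>1 / (1 / v - b) = v / (1 - b v)\<close>.\<close>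

lemma pole_coord_analytic:
  assumes "q \<noteq> p"
  shows "(\<lambda>v. pole_coord p (loc_par q v)) analytic_on {0}"
proof (cases q)
  case (Some z)
  then show ?thesis
    using assms by (cases p) (auto simp: pole_coord_def loc_par_def intro!: analytic_intros)
next
  case None
  then obtain b where b: "p = Some b" using assms by (cases p) auto
  have "((\<lambda>v. 1 - b * v) \<longlongrightarrow> 1 - b * 0) (nhds 0)"
    by (intro tendsto_intros filterlim_ident)
  then have "\<forall>\<^sub>F v in nhds 0. 1 - b * v \<noteq> 0"
    by (rule tendsto_imp_eventually_ne) simp
  then have "\<forall>\<^sub>F v in nhds 0. pole_coord p (loc_par q v) = v / (1 - b * v)"
  proof eventually_elim
    case (elim v)
    show ?case
    proof (cases "v = 0")
      case False
      have "inverse v - b = (1 - b * v) / v" using False by (simp add: field_simps)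
      then show ?thesis using False None b by (simp add: pole_coord_def loc_par_def)
    qed (simp add: None b pole_coord_def loc_par_def)
  qed
  moreover have "(\<lambda>v. v / (1 - b * v)) analytic_on {0}"
    by (intro analytic_intros) auto
  ultimately show ?thesis using analytic_at_cong by fast
qed

lemma poly_analytic:
  assumes "f analytic_on S"
  shows "(\<lambda>v. poly Q (f v)) analytic_on S"
  by (induction Q) (auto intro!: analytic_intros assms)

lemma poly_meromorphic:
  assumes "f meromorphic_on S"
  shows "(\<lambda>v. poly Q (f v)) meromorphic_on S"
  by (induction Q) (auto intro!: meromorphic_intros assms)

context quadratic_lie_algebra
begin

text \<open>\<open>f1\<close> is the sum of the principal parts of \<open>f\<close> at its poles in \<open>D\<close>.\<close>

lemma principal_decomposition:
  assumes f: "f \<in> merom_maps sg"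
  obtains f1 f2 where "f1 \<in> merom_maps sg" "f2 \<in> merom_maps sg" "f = f1 \<oplus>\<^bsub>G\<^esub> f2"
    "\<And>q. q \<notin> D \<or> regular_at sg f q \<Longrightarrow> regular_at sg f1 q"
    "\<And>q. q \<in> D \<or> regular_at sg f q \<Longrightarrow> regular_at sg f2 q"
proof -
  note pre = merom_maps_premerom[OF f]
  define P where "P = {p \<in> D. \<not> regular_at sg f p}"
  have P: "finite P"
    by (rule finite_subset[OF _ finite_nonregular[OF pre]]) (auto simp: P_def)
  obtain T e where T: "finite T" "\<And>b. functional (e b)" "\<And>p. f p = (\<Sum>b\<in>T. sg (e b (f p)) b)"
    by (rule fin_dim_coordinates[OF premerom_fin_dim[OF pre]]) (rule that)
  \<comment> \<open>A polynomial and an analytic remainder are packed into a pair, so that one use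
    of choice supplies them for all points and coordinates.\<close>
  define good where "good x y \<longleftrightarrow> snd y analytic_on {0} \<and> (\<forall>\<^sub>F v in at 0.
      e (snd x) (f (loc_par (fst x) v)) = poly (fst y) (inverse v) + snd y v)" for x y
  have "\<forall>x. \<exists>y. good x y"
  proof
    fix x
    obtain Q A where "A analytic_on {0}"
        "\<forall>\<^sub>F v in at 0. e (snd x) (f (loc_par (fst x) v)) = poly Q (inverse v) + A v"
      by (rule principal_part[OF premeromD[OF pre T(2)[of "snd x"], of "fst x"]])
    then have "good x (Q, A)" by (simp add: good_def)
    then show "\<exists>y. good x y" ..
  qed
  from choice[OF this] obtain y where y: "\<forall>x. good x (y x)" ..
  define Q where "Q p b = fst (y (p, b))" for p b
  define A where "A p b = snd (y (p, b))" for p b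
  have QA: "A p b analytic_on {0}"
      "\<forall>\<^sub>F v in at 0. e b (f (loc_par p v)) = poly (Q p b) (inverse v) + A p b v" for p b
    using y[rule_format, of "(p, b)"] by (simp_all add: good_def Q_def A_def)
  \<comment> \<open>The principal part at \<open>p\<close> is a polynomial in
    \<open>pole_coord p\<close>. It is thus a rational function on the whole line, analytic away
    from \<open>p\<close>.\<close>
  define a where "a b q = (\<Sum>p\<in>P. poly (Q p b) (pole_coord p q))" for b q
  define h where "h q = (\<Sum>b\<in>T. sg (a b q) b)" for q
  have l_h: "l (h q) = (\<Sum>b\<in>T. a b q * l b)" if "functional l" for l q
    unfolding h_def by (rule functional_sum[OF that])
  have coord_merom: "(\<lambda>v. pole_coord p (loc_par q v)) meromorphic_on {0}" for p q
  proof (cases "q = p")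
    case True
    then show ?thesis by (auto simp: pole_coord_loc_par intro!: meromorphic_intros)
  qed (intro analytic_on_imp_meromorphic_on pole_coord_analytic)
  have pre_h: "premerom h"
    unfolding premerom_def
  proof (intro conjI allI impI)
    show "fin_dim h" by (rule fin_dimI[OF T(1)]) (rule h_def)
    fix p l assume l: "functional l"
    show "(\<lambda>v. l (h (loc_par p v))) meromorphic_on {0}"
      unfolding l_h[OF l] a_def by (intro meromorphic_intros poly_meromorphic coord_merom)
  qed
  have reg_h: "regular_at sg h q" if "q \<notin> P" for q
    unfolding regular_at_iff
  proof (intro allI impI)
    fix l assume l: "functional l"
    have "(\<lambda>v. poly (Q p b) (pole_coord p (loc_par q v))) analytic_on {0}" if "p \<in> P" for p b
      using that \<open>q \<notin> P\<close> by (intro poly_analytic pole_coord_analytic) auto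
    then show "(\<lambda>v. l (h (loc_par q v))) analytic_on {0}"
      unfolding l_h[OF l] a_def by (intro analytic_intros)
  qed
  define f1 where "f1 = regularise sg h"
  have f1: "f1 \<in> merom_maps sg" unfolding f1_def by (rule regularise(1)[OF pre_h])
  have f1_cof: "\<forall>\<^sub>F p in cofinite. f1 p = h p" unfolding f1_def by (rule regularise_cofinite[OF pre_h])
  have reg_f1: "regular_at sg f1 q" if "q \<notin> P" for q
    unfolding f1_def by (rule regular_at_regularise[OF pre_h reg_h[OF that]])
  note m1 = G_smult_closed[OF f1, of "-1"]
  define f2 where "f2 = f \<oplus>\<^bsub>G\<^esub> (-1) \<odot>\<^bsub>G\<^esub> f1"
  have f2: "f2 \<in> merom_maps sg" unfolding f2_def by (intro G_add_closed f m1)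
  have f2_cof: "\<forall>\<^sub>F p in cofinite. f2 p = f p - h p"
    using G_add_cofinite[OF f m1] G_smult_cofinite[OF f1, of "-1"] f1_cof
    by eventually_elim (simp add: f2_def)
  show ?thesis
  proof (rule that[OF f1 f2])
    show "f = f1 \<oplus>\<^bsub>G\<^esub> f2"
    proof (rule merom_eq_cofiniteI[OF f G_add_closed[OF f1 f2]])
      show "\<forall>\<^sub>F p in cofinite. f p = (f1 \<oplus>\<^bsub>G\<^esub> f2) p"
        using G_add_cofinite[OF f1 f2] f1_cof f2_cof by eventually_elim simp
    qed
    show "regular_at sg f1 q" if "q \<notin> D \<or> regular_at sg f q" for q
      using that by (intro reg_f1) (auto simp: P_def)
    show "regular_at sg f2 q" if q: "q \<in> D \<or> regular_at sg f q" for q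
    proof (cases "q \<in> P")
      case False
      then have "regular_at sg f q" using q by (auto simp: P_def)
      then show ?thesis
        unfolding f2_def using reg_f1[OF False] by (intro G_add_regular G_smult_regular f f1 m1)
    next
      case True
      show ?thesis
      proof (rule merom_regular_if_removable[OF f2])
        fix l assume l: "functional l"
        \<comment> \<open>At \<open>q\<close> the principal part of \<open>f\<close> cancels against
          its own copy in \<open>h\<close>. There remain the analytic remainder and the principal
          parts at the other points, which are analytic at \<open>q\<close>.\<close>
        let ?A = "\<lambda>v. \<Sum>b\<in>T. (A q b v - (\<Sum>p\<in>P-{q}. poly (Q p b) (pole_coord p (loc_par q v)))) * l b"
        have "(\<lambda>v. poly (Q p b) (pole_coord p (loc_par q v))) analytic_on {0}" if "p \<in> P - {q}" for p b
          using that by (intro poly_analytic pole_coord_analytic) auto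
        then have "?A analytic_on {0}"
          by (intro analytic_intros QA)
        moreover have "\<forall>\<^sub>F v in at 0. l (f2 (loc_par q v)) = ?A v"
        proof -
          have ev1: "\<forall>\<^sub>F v in at 0. f2 (loc_par q v) = f (loc_par q v) - h (loc_par q v)"
            using eventually_loc_par_notin[of "{p. f2 p \<noteq> f p - h p}" q] f2_cof
            by (simp add: eventually_cofinite)
          have ev2: "\<forall>\<^sub>F v in at 0. \<forall>b\<in>T. e b (f (loc_par q v)) = poly (Q q b) (inverse v) + A q b v"
            by (intro eventually_ball_finite T(1)) (simp add: QA(2))
          show ?thesis
            using ev1 ev2
          proof eventually_elim
            case (elim v)
            have a: "a b (loc_par q v) = poly (Q q b) (inverse v)
                + (\<Sum>p\<in>P-{q}. poly (Q p b) (pole_coord p (loc_par q v)))" for b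
              unfolding a_def by (subst sum.remove[OF P True]) (simp add: pole_coord_loc_par)
            have "l (f (loc_par q v)) = (\<Sum>b\<in>T. e b (f (loc_par q v)) * l b)"
              using arg_cong[OF T(3), of l "loc_par q v"] by (simp only: functional_sum[OF l])
            then have "l (f2 (loc_par q v)) = (\<Sum>b\<in>T. (e b (f (loc_par q v)) - a b (loc_par q v)) * l b)"
              unfolding elim(1) cf.linear_diff[OF l] l_h[OF l] by (simp add: sum_subtractf left_diff_distrib)
            also have "\<dots> = ?A v"
              by (intro sum.cong refl) (simp add: a elim(2))
            finally show ?case .
          qed
        qed
        ultimately show "\<exists>A. A analytic_on {0} \<and> (\<forall>\<^sub>F v in at 0. l (f2 (loc_par q v)) = A v)"
          by blast
      qed
    qed
  qed
qed

end


section \<open>Topology of the projective line\<close>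

lemma eventually_nhds_0_shift:
  "(\<forall>\<^sub>F v in nhds (0::complex). P (a + v)) \<longleftrightarrow> (\<forall>\<^sub>F z in nhds a. P z)"
proof -
  have "filtermap (\<lambda>v. a + v) (nhds 0) = nhds a"
    using filtermap_nhds_shift[of "- a" 0] by (simp add: add.commute)
  from this[symmetric] show ?thesis
    by (rule ssubst) (simp only: eventually_filtermap)
qed

lemma open_iff_eventually: "open S \<longleftrightarrow> (\<forall>x\<in>S. \<forall>\<^sub>F y in nhds x. y \<in> S)"
proof
  assume "\<forall>x\<in>S. \<forall>\<^sub>F y in nhds x. y \<in> S"
  then have "\<forall>x\<in>S. \<exists>T. open T \<and> x \<in> T \<and> T \<subseteq> S"
    by (simp only: eventually_nhds subset_eq)
  then show "open S" by (rule open_subopen[THEN iffD2])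
qed (auto intro: eventually_nhds_in_open)

lemma isCont_tendsto_nhds: "isCont f a \<Longrightarrow> (f \<longlongrightarrow> f a) (nhds a)"
  by (simp only: isCont_def tendsto_at_iff_tendsto_nhds)

text \<open>At infinity the parameter \<open>1 / z\<close> turns complements of compact sets into
  neighbourhoods of \<open>0\<close>: a compact set is bounded, and a closed set avoiding a
  neighbourhood of infinity is compact.\<close>

lemma openin_p1_top:
  "openin p1_top U \<longleftrightarrow> (\<forall>p\<in>U. \<forall>\<^sub>F v in nhds 0. loc_par p v \<in> U)"
proof
  assume U: "openin p1_top U"
  have ev: "\<forall>\<^sub>F v in nhds 0. a + v \<in> V" if "open V" "a \<in> V" for V and a :: complex
    using eventually_nhds_in_open[OF that] eventually_nhds_0_shift[of "\<lambda>z. z \<in> V" a] by simp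
  from U consider V where "open V" "U = Some ` V"
    | C where "compact C" "U = insert None (Some ` (UNIV - C))"
    unfolding p1_top_def openin_Alexandroff_compactification by auto
  then show "\<forall>p\<in>U. \<forall>\<^sub>F v in nhds 0. loc_par p v \<in> U"
  proof cases
    case 1
    have "\<forall>\<^sub>F v in nhds 0. Some (a + v) \<in> U" if "a \<in> V" for a
      using ev[OF 1(1) that] by eventually_elim (simp add: 1(2))
    then show ?thesis by (auto simp: loc_par_def 1(2))
  next
    case 2
    have "\<forall>\<^sub>F v in nhds 0. loc_par (Some a) v \<in> U" if "a \<notin> C" for a
    proof -
      have "\<forall>\<^sub>F v in nhds 0. a + v \<in> - C"
        using that compact_imp_closed[OF 2(1)] by (intro ev) auto
      then show ?thesis by eventually_elim (simp add: loc_par_def 2(2))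
    qed
    moreover have "\<forall>\<^sub>F v in nhds 0. loc_par None v \<in> U"
    proof -
      obtain r where r: "r > 0" "\<And>z. z \<in> C \<Longrightarrow> norm z \<le> r"
        using compact_imp_bounded[OF 2(1)] bounded_pos by blast
      have "\<forall>\<^sub>F v in nhds (0::complex). v \<in> ball 0 (1 / r)"
        using r(1) by (intro eventually_nhds_in_open) auto
      then show ?thesis
      proof eventually_elim
        case (elim v)
        have "inverse v \<notin> C" if "v \<noteq> 0"
        proof
          assume "inverse v \<in> C"
          then have "1 / norm v \<le> r" using r(2) by (fastforce simp: norm_inverse inverse_eq_divide[of "norm v"])
          then show False using elim that r(1) by (simp add: field_simps)
        qed
        then show ?case by (auto simp: loc_par_def 2)
      qed
    qed
    ultimately show ?thesis by (auto simp: 2)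
  qed
next
  assume *: "\<forall>p\<in>U. \<forall>\<^sub>F v in nhds 0. loc_par p v \<in> U"
  define V where "V = {z. Some z \<in> U}"
  have "open V"
    unfolding open_iff_eventually
  proof
    fix a assume "a \<in> V"
    then show "\<forall>\<^sub>F z in nhds a. z \<in> V"
      using *[rule_format, of "Some a"] eventually_nhds_0_shift[of "\<lambda>z. Some z \<in> U" a]
      by (auto simp: V_def loc_par_def)
  qed
  show "openin p1_top U"
  proof (cases "None \<in> U")
    case False
    have "p \<in> Some ` V" if "p \<in> U" for p
      using that False by (cases p) (auto simp: V_def)
    then have "U = Some ` V" by (auto simp: V_def)
    then show ?thesis using \<open>open V\<close> unfolding p1_top_def openin_Alexandroff_compactification by auto
  next
    case True
    obtain r where r: "r > 0" "\<And>v. norm v < r \<Longrightarrow> loc_par None v \<in> U"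
      using *[rule_format, OF True] by (auto simp: eventually_nhds_metric dist_norm)
    have "norm z \<le> 1 / r" if "z \<in> - V" for z
    proof (rule ccontr)
      assume "\<not> norm z \<le> 1 / r"
      then have z: "1 / r < norm z" by simp
      then have pos: "norm z > 0" using r(1) by (smt (verit) divide_pos_pos)
      have "norm (inverse z) = 1 / norm z"
        by (simp add: norm_inverse inverse_eq_divide[of "norm z"])
      also have "\<dots> < r" using z pos r(1) by (simp add: field_simps)
      finally have "loc_par None (inverse z) \<in> U" by (rule r(2))
      then show False using that pos by (auto simp: loc_par_def V_def)
    qed
    then have "bounded (- V)" unfolding bounded_iff by blast
    then have "compact (- V)" using \<open>open V\<close> by (simp add: compact_eq_bounded_closed closed_def)
    moreover have "U = insert None (Some ` (UNIV - (- V)))"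
    proof -
      have "p \<in> insert None (Some ` V)" if "p \<in> U" for p
        using that by (cases p) (auto simp: V_def)
      then show ?thesis using True by (auto simp: V_def)
    qed
    ultimately show ?thesis
      using \<open>open V\<close> unfolding p1_top_def openin_Alexandroff_compactification by (auto simp: closed_def)
  qed
qed

lemma topspace_p1_top [simp]: "topspace p1_top = UNIV"
  by (simp add: p1_top_def UNIV_option_conv)

lemma openin_p1_finite_point:
  assumes "openin p1_top U" "U \<noteq> {}"
  obtains a where "Some a \<in> U"
proof -
  obtain p where p: "p \<in> U" using assms(2) by blast
  show ?thesis
  proof (cases p)
    case None
    obtain r where r: "r > 0" "\<And>v. norm v < r \<Longrightarrow> loc_par None v \<in> U"
      using assms(1) p None unfolding openin_p1_top by (force simp: eventually_nhds_metric dist_norm)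
    have "loc_par None (of_real (r / 2)) \<in> U" using r(1) by (intro r(2)) simp
    then show ?thesis using r(1) that by (auto simp: loc_par_def)
  qed (use p that in blast)
qed

section \<open>An affine chart\<close>

text \<open>The coordinate \<open>pole_coord (Some a)\<close>, which is \<open>1 / (z - a)\<close>, identifies the complement
  of \<open>Some a\<close> with the complex plane; \<open>chart a\<close> is its inverse.\<close>

definition chart :: "complex \<Rightarrow> complex \<Rightarrow> p1" where
  "chart a u = (if u = 0 then None else Some (a + inverse u))"

lemma pole_coord_chart [simp]: "pole_coord (Some a) (chart a u) = u"
  by (auto simp: pole_coord_def chart_def)

lemma chart_pole_coord: "p \<noteq> Some a \<Longrightarrow> chart a (pole_coord (Some a) p) = p"
  by (cases p) (auto simp: pole_coord_def chart_def)

lemma chart_neq [simp]: "chart a u \<noteq> Some a"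
  by (auto simp: chart_def)

lemma loc_par_center: "v \<noteq> 0 \<Longrightarrow> loc_par (Some a) v = chart a (inverse v)"
  by (auto simp: loc_par_def chart_def)

lemma chart_local:
  obtains \<kappa> where "\<kappa> analytic_on {w}" "\<kappa> w = 0" "\<forall>\<^sub>F u in nhds w. chart a u = loc_par (chart a w) (\<kappa> u)"
proof (cases "w = 0")
  case False
  have "\<forall>\<^sub>F u in nhds w. u \<noteq> 0"
    using eventually_nhds_in_open[of "- {0}" w] False by (auto elim!: eventually_mono)
  then have "\<forall>\<^sub>F u in nhds w. chart a u = loc_par (chart a w) (inverse u - inverse w)"
    by eventually_elim (use False in \<open>auto simp: chart_def loc_par_def\<close>)
  moreover have "(\<lambda>u. inverse u - inverse w) analytic_on {w}"
    using False by (intro analytic_intros) auto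
  ultimately show ?thesis by (intro that[of "\<lambda>u. inverse u - inverse w"]) auto
next
  case True
  \<comment> \<open>The point \<open>w = 0\<close> is sent to infinity, whose parameter is
    \<open>1 / (a + 1 / u) = u / (1 + a u)\<close>.\<close>
  have "((\<lambda>u. 1 + a * u) \<longlongrightarrow> 1 + a * 0) (nhds 0)"
    by (intro tendsto_intros filterlim_ident)
  then have "\<forall>\<^sub>F u in nhds 0. 1 + a * u \<noteq> 0"
    by (rule tendsto_imp_eventually_ne) simp
  then have "\<forall>\<^sub>F u in nhds w. chart a u = loc_par (chart a w) (u / (1 + a * u))"
    unfolding True by eventually_elim (auto simp: chart_def loc_par_def field_simps)
  moreover have "(\<lambda>u. u / (1 + a * u)) analytic_on {w}"
    unfolding True by (intro analytic_intros) auto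
  ultimately show ?thesis using True by (intro that[of "\<lambda>u. u / (1 + a * u)"]) auto
qed

lemma eventually_loc_par_neq_nhds: "p \<noteq> q \<Longrightarrow> \<forall>\<^sub>F v in nhds 0. loc_par p v \<noteq> q"
  using eventually_loc_par_neq[of p q] unfolding eventually_at_filter
  by (auto elim!: eventually_mono)

lemma analytic_chart:
  assumes "(\<lambda>v. f (loc_par (chart a w) v)) analytic_on {0}"
  shows "(\<lambda>u. f (chart a u)) analytic_on {w}"
proof -
  obtain \<kappa> where \<kappa>: "\<kappa> analytic_on {w}" "\<kappa> w = 0" "\<forall>\<^sub>F u in nhds w. chart a u = loc_par (chart a w) (\<kappa> u)"
    by (rule chart_local)
  have "(\<lambda>u. f (loc_par (chart a w) (\<kappa> u))) analytic_on {w}"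
    using analytic_on_compose[OF \<kappa>(1), of "\<lambda>v. f (loc_par (chart a w) v)"] assms \<kappa>(2) by (simp add: o_def)
  moreover have "\<forall>\<^sub>F u in nhds w. f (chart a u) = f (loc_par (chart a w) (\<kappa> u))"
    using \<kappa>(3) by eventually_elim simp
  ultimately show ?thesis using analytic_at_cong by fast
qed

lemma open_chart_vimage:
  assumes "openin p1_top U"
  shows "open (chart a -` U)"
  unfolding open_iff_eventually
proof
  fix w assume w: "w \<in> chart a -` U"
  obtain \<kappa> where \<kappa>: "\<kappa> analytic_on {w}" "\<kappa> w = 0" "\<forall>\<^sub>F u in nhds w. chart a u = loc_par (chart a w) (\<kappa> u)"
    by (rule chart_local)
  have "(\<kappa> \<longlongrightarrow> 0) (nhds w)"
    using isCont_tendsto_nhds[OF analytic_at_imp_isCont[OF \<kappa>(1)]] \<kappa>(2) by simp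
  moreover have "\<forall>\<^sub>F v in nhds 0. loc_par (chart a w) v \<in> U"
    using assms w unfolding openin_p1_top by auto
  ultimately have "\<forall>\<^sub>F u in nhds w. loc_par (chart a w) (\<kappa> u) \<in> U"
    by (rule eventually_compose_filterlim[rotated])
  then show "\<forall>\<^sub>F u in nhds w. u \<in> chart a -` U"
    using \<kappa>(3) by eventually_elim simp
qed

lemma pole_coord_tendsto:
  assumes "p \<noteq> Some a"
  shows "((\<lambda>v. pole_coord (Some a) (loc_par p v)) \<longlongrightarrow> pole_coord (Some a) p) (nhds 0)"
  using isCont_tendsto_nhds[OF analytic_at_imp_isCont[OF pole_coord_analytic[OF assms]]] by simp

lemma eventually_pole_coord_in:
  assumes "p \<noteq> Some a" "open V" "pole_coord (Some a) p \<in> V"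
  shows "\<forall>\<^sub>F v in nhds 0. pole_coord (Some a) (loc_par p v) \<in> V"
  using topological_tendstoD[OF pole_coord_tendsto[OF assms(1)] assms(2,3)] .

text \<open>By \<open>loc_par_center\<close>, punctured neighbourhoods of \<open>Some a\<close>
  correspond in the chart to the exteriors of large discs.\<close>

lemma eventually_center_large:
  assumes "\<And>u. norm u \<ge> r \<Longrightarrow> P (chart a u)" "P (Some a)"
  shows "\<forall>\<^sub>F v in nhds 0. P (loc_par (Some a) v)"
proof -
  \<comment> \<open>The maximum with \<open>1\<close> keeps the radius \<open>1 / r'\<close> defined
    and positive.\<close>
  define r' where "r' = max r 1"
  have "\<forall>\<^sub>F v in nhds (0::complex). v \<in> ball 0 (1 / r')"
    by (intro eventually_nhds_in_open) (auto simp: r'_def)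
  then show ?thesis
  proof eventually_elim
    case (elim v)
    show ?case
    proof (cases "v = 0")
      case False
      have "norm (inverse v) = 1 / norm v"
        by (simp add: norm_inverse inverse_eq_divide[of "norm v"])
      moreover have "1 / norm v \<ge> r'"
      proof -
        have "r' > 0" "norm v < 1 / r'" using elim by (auto simp: r'_def)
        then show ?thesis using False by (simp add: field_simps)
      qed
      ultimately show ?thesis
        using False by (auto simp: loc_par_center r'_def intro!: assms(1))
    qed (use assms(2) in simp)
  qed
qed

lemma openin_chart_image:
  assumes "open V"
  shows "openin p1_top (chart a ` V)"
  unfolding openin_p1_top
proof
  fix p assume "p \<in> chart a ` V"
  then obtain u where u: "u \<in> V" "p = chart a u" by blast
  have "\<forall>\<^sub>F v in nhds 0. loc_par p v \<noteq> Some a"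
    using u by (intro eventually_loc_par_neq_nhds) auto
  moreover have "\<forall>\<^sub>F v in nhds 0. pole_coord (Some a) (loc_par p v) \<in> V"
    using u assms by (intro eventually_pole_coord_in) auto
  ultimately show "\<forall>\<^sub>F v in nhds 0. loc_par p v \<in> chart a ` V"
    by eventually_elim (metis chart_pole_coord imageI)
qed

lemma openin_chart_image_insert:
  assumes "open V" "\<And>u. norm u \<ge> r \<Longrightarrow> u \<in> V"
  shows "openin p1_top (insert (Some a) (chart a ` V))"
proof -
  have "\<forall>\<^sub>F v in nhds 0. loc_par (Some a) v \<in> insert (Some a) (chart a ` V)"
    using assms(2) by (intro eventually_center_large[of r]) auto
  moreover have "\<forall>\<^sub>F v in nhds 0. loc_par p v \<in> insert (Some a) (chart a ` V)" if "p \<in> chart a ` V" for p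
  proof -
    have "\<forall>\<^sub>F v in nhds 0. loc_par p v \<in> chart a ` V"
      using openin_chart_image[OF assms(1), of a] that unfolding openin_p1_top by blast
    then show ?thesis by eventually_elim simp
  qed
  ultimately show ?thesis unfolding openin_p1_top by blast
qed

lemma open_frontier_partition:
  assumes "openin p1_top D"
  shows "D \<inter> p1_top frontier_of D = {}" "D \<inter> outer D = {}" "p1_top frontier_of D \<inter> outer D = {}"
    "D \<union> p1_top frontier_of D \<union> outer D = UNIV" "openin p1_top (outer D)"
proof -
  have cl: "p1_top closure_of D = D \<union> p1_top frontier_of D"
    using closure_of_subset[of D p1_top] assms by (auto simp: frontier_of_def interior_of_openin)
  show "D \<inter> p1_top frontier_of D = {}"
    using assms by (auto simp: frontier_of_def interior_of_openin)
  show "D \<inter> outer D = {}" "p1_top frontier_of D \<inter> outer D = {}" "D \<union> p1_top frontier_of D \<union> outer D = UNIV"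
    by (auto simp: outer_def cl)
  show "openin p1_top (outer D)"
    using openin_diff[OF openin_topspace closedin_closure_of[of p1_top D]] by (simp add: outer_def)
qed

section \<open>The boundary curve\<close>

locale boundary_curve =
  fixes D :: "p1 set" and \<gamma> :: "real \<Rightarrow> p1"
  assumes pos_boundary: "pos_boundary D \<gamma>"
begin

lemma periodic: "\<gamma> (t + 1) = \<gamma> t" and inj_curve: "inj_on \<gamma> {0..<1}"
  and image_curve: "\<gamma> ` {0..<1} = p1_top frontier_of D"
  using pos_boundary unfolding pos_boundary_def by blast+

lemma curve_frontier: "\<gamma> t \<in> p1_top frontier_of D"
proof -
  have shift: "\<gamma> (s + real n) = \<gamma> s" for s n
    by (induction n) (simp_all add: periodic add.assoc[symmetric] add.commute[of 1])
  have "\<gamma> (frac t) = \<gamma> t"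
  proof (cases "\<lfloor>t\<rfloor> \<ge> 0")
    case True
    then have "t = frac t + real (nat \<lfloor>t\<rfloor>)" by (simp add: frac_def)
    then show ?thesis using shift by metis
  next
    case False
    then have "frac t = t + real (nat (- \<lfloor>t\<rfloor>))" by (simp add: frac_def)
    then show ?thesis using shift by metis
  qed
  moreover have "frac t \<in> {0..<1}" using frac_ge_0 frac_lt_1 by auto
  ultimately show ?thesis using image_curve by (metis imageI)
qed

text \<open>Near \<open>t\<close> the curve is a smooth \<open>g\<close> in the local parameter at
  \<open>\<gamma> t\<close>, with \<open>g t = 0\<close>. So \<open>H\<close> along the curve is an
  analytic function after \<open>g\<close>, and the chain rule applies.\<close>

lemma C1_along:
  assumes H: "\<And>t. (\<lambda>v. H (loc_par (\<gamma> t) v)) analytic_on {0}"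
  shows "((\<lambda>s. H (\<gamma> s) :: complex) has_vector_derivative vector_derivative (\<lambda>s. H (\<gamma> s)) (at t)) (at t)" (is ?D)
    and "isCont (\<lambda>t. vector_derivative (\<lambda>s. H (\<gamma> s)) (at t)) t" (is ?C)
proof -
  obtain g where g: "smooth_at g t" "\<forall>\<^sub>F s in nhds t. \<gamma> s = loc_par (\<gamma> t) (g s)"
    using pos_boundary unfolding pos_boundary_def by blast
  define F where "F v = H (loc_par (\<gamma> t) v)" for v
  have F: "F analytic_on {0}" using H[of t] by (simp add: F_def[abs_def])
  have g0: "g t = 0"
    using eventually_nhds_x_imp_x[OF g(2)] loc_par_inj[of "\<gamma> t" "g t" 0] by simp
  obtain e where e: "e > 0" "\<And>n s. s \<in> ball t e \<Longrightarrow> ((\<lambda>h x. vector_derivative h (at x)) ^^ n) g differentiable (at s)"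
    using g(1) unfolding smooth_at_def by blast
  have g_deriv: "(g has_vector_derivative vector_derivative g (at s)) (at s)" if "s \<in> ball t e" for s
    using e(2)[OF that, of 0] by (simp add: vector_derivative_works)
  \<comment> \<open>The case \<open>n = 1\<close> of smoothness: the derivative of \<open>g\<close>
    is again differentiable, hence continuous.\<close>
  have g'_cont: "isCont (\<lambda>s. vector_derivative g (at s)) t"
    using e(2)[of t 1] e(1) by (simp add: differentiable_imp_continuous_within)
  have g_cont: "isCont g t"
    using e(2)[of t 0] e(1) by (simp add: differentiable_imp_continuous_within)
  obtain S where S: "open S" "0 \<in> S" "F holomorphic_on S"
    using F unfolding analytic_at by blast
  have ev1: "\<forall>\<^sub>F s in nhds t. s \<in> ball t e"
    using e(1) by (intro eventually_nhds_in_open) auto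
  have ev2: "\<forall>\<^sub>F s in nhds t. g s \<in> S"
  proof -
    have "(g \<longlongrightarrow> 0) (nhds t)" using isCont_tendsto_nhds[OF g_cont] g0 by simp
    then show ?thesis using S(1,2) by (rule topological_tendstoD)
  qed
  \<comment> \<open>The formula for the derivative is obtained on a whole neighbourhood of
    \<open>t\<close>, since continuity of the derivative at \<open>t\<close> compares values at
    nearby points.\<close>
  have deriv: "\<forall>\<^sub>F s in nhds t. ((\<lambda>s. H (\<gamma> s)) has_vector_derivative vector_derivative g (at s) * deriv F (g s)) (at s)"
    using eventually_eventually[THEN iffD2, OF g(2)] ev1 ev2
  proof eventually_elim
    case (elim s)
    have "(F has_field_derivative deriv F (g s)) (at (g s))"
      using holomorphic_derivI[OF S(3,1) elim(3)] .
    then have "((F \<circ> g) has_vector_derivative vector_derivative g (at s) * deriv F (g s)) (at s)"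
      using field_vector_diff_chain_at[OF g_deriv[OF elim(2)]] by blast
    moreover have "\<forall>\<^sub>F x in nhds s. (F \<circ> g) x = H (\<gamma> x)"
      using elim(1) by eventually_elim (simp add: F_def)
    moreover from this have "(F \<circ> g) s = H (\<gamma> s)"
      by (rule eventually_nhds_x_imp_x)
    ultimately show ?case
      using has_vector_derivative_cong_ev[of UNIV "F \<circ> g" "\<lambda>s. H (\<gamma> s)" s] by simp
  qed
  show ?D
    using eventually_nhds_x_imp_x[OF deriv] by (metis vector_derivative_at)
  have "\<forall>\<^sub>F s in nhds t. vector_derivative (\<lambda>s. H (\<gamma> s)) (at s) = vector_derivative g (at s) * deriv F (g s)"
    using deriv by eventually_elim (rule vector_derivative_at)
  moreover have "isCont (\<lambda>s. vector_derivative g (at s) * deriv F (g s)) t"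
  proof (intro continuous_intros g'_cont isCont_o2[OF g_cont])
    show "isCont (deriv F) (g t)"
      unfolding g0 by (intro analytic_at_imp_isCont analytic_deriv F)
  qed
  ultimately show ?C using isCont_cong by fast
qed

lemma closed_integral_zero:
  assumes "\<And>t. ((\<lambda>s. H (\<gamma> s) :: complex) has_vector_derivative h' t) (at t)"
  shows "(h' has_integral 0) {0..1}"
proof -
  have "(h' has_integral H (\<gamma> 1) - H (\<gamma> 0)) {0..1}"
    by (rule fundamental_theorem_of_calculus) (auto intro: has_vector_derivative_at_within assms)
  then show ?thesis using periodic[of 0] by simp
qed

end


section \<open>The boundary curve in an affine chart\<close>

locale affine_curve = boundary_curve D \<gamma> for D \<gamma> +
  fixes a :: complex
  assumes center: "Some a \<notin> p1_top frontier_of D"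
begin

abbreviation "\<phi> \<equiv> pole_coord (Some a)"

definition \<delta> :: "real \<Rightarrow> complex" where
  "\<delta> t = \<phi> (\<gamma> t)"

lemma curve_neq: "\<gamma> t \<noteq> Some a"
  using curve_frontier center by metis

lemma chart_\<delta>: "chart a (\<delta> t) = \<gamma> t"
  by (simp add: \<delta>_def chart_pole_coord curve_neq)

lemma \<delta>_C1: "(\<delta> has_vector_derivative vector_derivative \<delta> (at t)) (at t)"
    "isCont (\<lambda>t. vector_derivative \<delta> (at t)) t"
proof -
  have H: "(\<lambda>v. \<phi> (loc_par (\<gamma> t) v)) analytic_on {0}" for t
    by (rule pole_coord_analytic[OF curve_neq])
  show "(\<delta> has_vector_derivative vector_derivative \<delta> (at t)) (at t)"
    "isCont (\<lambda>t. vector_derivative \<delta> (at t)) t"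
    using C1_along[of \<phi>, OF H] unfolding \<delta>_def[abs_def] by blast+
qed

lemma valid_path_\<delta>: "valid_path \<delta>"
  unfolding valid_path_def
proof (rule C1_differentiable_imp_piecewise)
  show "\<delta> C1_differentiable_on {0..1}"
    unfolding C1_differentiable_on_def
    by (intro exI[of _ "\<lambda>t. vector_derivative \<delta> (at t)"])
       (auto intro!: continuous_at_imp_continuous_on \<delta>_C1)
qed

lemma path_\<delta>: "path \<delta>"
  by (rule valid_path_imp_path[OF valid_path_\<delta>])

lemma loop_\<delta>: "pathfinish \<delta> = pathstart \<delta>"
  using periodic[of 0] by (simp add: pathfinish_def pathstart_def \<delta>_def)

lemma mem_path_image: "u \<in> path_image \<delta> \<longleftrightarrow> chart a u \<in> p1_top frontier_of D"
proof
  assume "u \<in> path_image \<delta>"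
  then obtain t where "u = \<delta> t" by (auto simp: path_image_def)
  then show "chart a u \<in> p1_top frontier_of D" by (simp add: chart_\<delta> curve_frontier)
next
  assume "chart a u \<in> p1_top frontier_of D"
  then obtain t where t: "t \<in> {0..<1}" "chart a u = \<gamma> t"
    using image_curve by (metis imageE)
  then have "u = \<delta> t" by (metis \<delta>_def pole_coord_chart)
  then show "u \<in> path_image \<delta>" using t(1) by (auto simp: path_image_def)
qed

lemma simple_path_\<delta>: "simple_path \<delta>"
  unfolding simple_path_def loop_free_def
proof (intro conjI path_\<delta> ballI impI)
  fix x y :: real assume xy: "x \<in> {0..1}" "y \<in> {0..1}" "\<delta> x = \<delta> y"
  then have \<gamma>: "\<gamma> x = \<gamma> y" using chart_\<delta> by metis
  have one: "\<gamma> 1 = \<gamma> 0" using periodic[of 0] by simp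
  have eq: "u = v" if "u \<in> {0..<1}" "v \<in> {0..<1}" "\<gamma> u = \<gamma> v" for u v
    using inj_curve that by (auto dest: inj_onD)
  show "x = y \<or> x = 0 \<and> y = 1 \<or> x = 1 \<and> y = 0"
  proof (cases "x = 1"; cases "y = 1")
    assume "x = 1" "y \<noteq> 1"
    then show ?thesis using eq[of 0 y] xy \<gamma> one by auto
  next
    assume "x \<noteq> 1" "y = 1"
    then show ?thesis using eq[of x 0] xy \<gamma> one by auto
  next
    assume "x \<noteq> 1" "y \<noteq> 1"
    then show ?thesis using eq[of x y] xy \<gamma> by auto
  qed simp
qed

text \<open>The winding number is locally constant, and vanishes near \<open>Some a\<close>, which the chart sends
  to infinity.\<close>

lemma winding_number_zero:
  assumes E: "connectedin p1_top E" "openin p1_top E" "E \<inter> p1_top frontier_of D = {}" "Some a \<in> E"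
    and u: "chart a u \<in> E"
  shows "winding_number \<delta> u = 0"
proof (rule ccontr)
  assume nonzero: "winding_number \<delta> u \<noteq> 0"
  \<comment> \<open>The first disjunct assigns winding number zero to the point
    \<open>Some a\<close>, which the chart omits. Both \<open>Z\<close> and its negation are open
    conditions on \<open>E\<close>.\<close>
  define Z where "Z p \<longleftrightarrow> p = Some a \<or> winding_number \<delta> (\<phi> p) = 0" for p
  have E_ev: "\<forall>\<^sub>F v in nhds 0. loc_par p v \<in> E" if "p \<in> E" for p
    using E(2) that unfolding openin_p1_top by blast
  have locally: "\<forall>\<^sub>F v in nhds 0. Z (loc_par p v) \<longleftrightarrow> Z p" if p: "p \<in> E" "p \<noteq> Some a" for p
  proof -
    have "\<phi> p \<notin> path_image \<delta>"
      unfolding mem_path_image chart_pole_coord[OF p(2)] using p(1) E(3) by blast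
    moreover have "open (- path_image \<delta>)"
      using closed_path_image[OF path_\<delta>] by (simp add: open_Compl)
    ultimately obtain r where r: "r > 0" "ball (\<phi> p) r \<subseteq> - path_image \<delta>"
      by (meson ComplI open_contains_ball)
    have "winding_number \<delta> constant_on ball (\<phi> p) r"
      using r(2) by (intro winding_number_constant path_\<delta> loop_\<delta>) auto
    then have const: "winding_number \<delta> w = winding_number \<delta> (\<phi> p)" if "w \<in> ball (\<phi> p) r" for w
      using that r(1) unfolding constant_on_def by (metis centre_in_ball)
    have "\<forall>\<^sub>F v in nhds 0. \<phi> (loc_par p v) \<in> ball (\<phi> p) r"
      using r(1) by (intro eventually_pole_coord_in p(2)) auto
    then show ?thesis
      using eventually_loc_par_neq_nhds[OF p(2)]
      by eventually_elim (simp add: Z_def p(2) const)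
  qed
  obtain K where K: "\<And>w. K \<le> norm w \<Longrightarrow> winding_number \<delta> w = 0"
    using winding_number_zero_at_infinity[OF path_\<delta> loop_\<delta>] by blast
  have infinity: "\<forall>\<^sub>F v in nhds 0. Z (loc_par (Some a) v)"
    by (rule eventually_center_large[of K]) (simp_all add: Z_def K)
  have "openin p1_top {p \<in> E. Z p}"
    unfolding openin_p1_top
  proof
    fix p assume p: "p \<in> {p \<in> E. Z p}"
    show "\<forall>\<^sub>F v in nhds 0. loc_par p v \<in> {p \<in> E. Z p}"
    proof (cases "p = Some a")
      case True
      then show ?thesis using E_ev[OF E(4)] infinity by (auto elim: eventually_elim2)
    next
      case False
      from p have "p \<in> E" by simp
      from locally[OF this False] E_ev[OF this] show ?thesis
        by eventually_elim (use p in simp)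
    qed
  qed
  moreover have "openin p1_top {p \<in> E. \<not> Z p}"
    unfolding openin_p1_top
  proof
    fix p assume p: "p \<in> {p \<in> E. \<not> Z p}"
    then have "p \<in> E" "p \<noteq> Some a" by (auto simp: Z_def)
    from locally[OF this] E_ev[OF this(1)] show "\<forall>\<^sub>F v in nhds 0. loc_par p v \<in> {p \<in> E. \<not> Z p}"
      by eventually_elim (use p in simp)
  qed
  moreover have "Some a \<in> {p \<in> E. Z p} \<inter> E" "chart a u \<in> {p \<in> E. \<not> Z p} \<inter> E"
    using E(4) u nonzero by (auto simp: Z_def)
  ultimately show False
    using E(1) unfolding connectedin by blast
qed

text \<open>In the chart the form \<open>f dg\<close> becomes \<open>f (g)' du\<close>, holomorphic
  wherever both functions are analytic. Any point where this fails lies in \<open>E\<close>, where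
  the winding number vanishes, so the global Cauchy theorem applies.\<close>

lemma Cauchy:
  assumes E: "connectedin p1_top E" "openin p1_top E" "E \<inter> p1_top frontier_of D = {}" "Some a \<in> E"
    and f: "\<And>p. p \<notin> E \<Longrightarrow> (\<lambda>v. f (loc_par p v)) analytic_on {0}"
    and g: "\<And>p. p \<notin> E \<Longrightarrow> (\<lambda>v. g (loc_par p v)) analytic_on {0}"
  shows "((\<lambda>t. f (\<gamma> t) * vector_derivative (\<lambda>s. g (\<gamma> s)) (at t)) has_integral 0) {0..1}"
proof -
  \<comment> \<open>Taking all points of analyticity gives an open set containing the closed
    preimage of the complement of \<open>E\<close>.\<close>
  define S where "S = {u. (\<lambda>u. f (chart a u)) analytic_on {u} \<and> (\<lambda>u. g (chart a u)) analytic_on {u}}"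
  have "open S"
    unfolding open_iff_eventually
  proof
    fix u assume "u \<in> S"
    then obtain A A' where A: "open A" "u \<in> A" "(\<lambda>u. f (chart a u)) holomorphic_on A"
        "open A'" "u \<in> A'" "(\<lambda>u. g (chart a u)) holomorphic_on A'"
      unfolding S_def mem_Collect_eq analytic_at by auto
    have "\<forall>\<^sub>F w in nhds u. w \<in> A" "\<forall>\<^sub>F w in nhds u. w \<in> A'"
      using A by (auto intro: eventually_nhds_in_open)
    then show "\<forall>\<^sub>F w in nhds u. w \<in> S"
      by eventually_elim (use A in \<open>auto simp: S_def analytic_at\<close>)
  qed
  have notE: "u \<in> S" if "chart a u \<notin> E" for u
    unfolding S_def using analytic_chart[of f a u] analytic_chart[of g a u] f[OF that] g[OF that] by simp
  have hol: "(\<lambda>u. f (chart a u)) holomorphic_on S" "(\<lambda>u. g (chart a u)) holomorphic_on S"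
    by (auto intro!: analytic_imp_holomorphic simp: S_def analytic_on_analytic_at[of _ "{u. _ u}"])
  have image: "path_image \<delta> \<subseteq> S"
    using mem_path_image E(3) by (auto intro!: notE)
  have "((\<lambda>u. f (chart a u) * deriv (\<lambda>u. g (chart a u)) u) has_contour_integral 0) \<delta>"
  proof (rule Cauchy_theorem_global[OF \<open>open S\<close> _ valid_path_\<delta> loop_\<delta> image])
    show "(\<lambda>u. f (chart a u) * deriv (\<lambda>u. g (chart a u)) u) holomorphic_on S"
      by (intro holomorphic_intros hol \<open>open S\<close>)
    show "winding_number \<delta> w = 0" if "w \<notin> S" for w
      using that notE by (intro winding_number_zero[OF E]) auto
  qed
  then have "((\<lambda>t. f (chart a (\<delta> t)) * deriv (\<lambda>u. g (chart a u)) (\<delta> t) * vector_derivative \<delta> (at t within {0..1}))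
      has_integral 0) {0..1}"
    by (simp add: has_contour_integral_def)
  moreover have "f (chart a (\<delta> t)) * deriv (\<lambda>u. g (chart a u)) (\<delta> t) * vector_derivative \<delta> (at t within {0..1})
      = f (\<gamma> t) * vector_derivative (\<lambda>s. g (\<gamma> s)) (at t)" if t: "t \<in> {0..1}" for t
  proof -
    have "\<delta> t \<in> S" using image t by (auto simp: path_image_def)
    then have "((\<lambda>u. g (chart a u)) has_field_derivative deriv (\<lambda>u. g (chart a u)) (\<delta> t)) (at (\<delta> t))"
      by (rule holomorphic_derivI[OF hol(2) \<open>open S\<close>])
    then have "((\<lambda>u. g (chart a u)) \<circ> \<delta> has_vector_derivative
        vector_derivative \<delta> (at t) * deriv (\<lambda>u. g (chart a u)) (\<delta> t)) (at t)"
      using field_vector_diff_chain_at[OF \<delta>_C1(1)] by blast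
    then have "vector_derivative (\<lambda>s. g (\<gamma> s)) (at t) = vector_derivative \<delta> (at t) * deriv (\<lambda>u. g (chart a u)) (\<delta> t)"
      by (intro vector_derivative_at) (simp add: o_def chart_\<delta>)
    moreover have "vector_derivative \<delta> (at t within {0..1}) = vector_derivative \<delta> (at t)"
      using t by (intro vector_derivative_at_within_ivl \<delta>_C1) auto
    ultimately show ?thesis by (simp add: chart_\<delta>)
  qed
  ultimately show ?thesis
    by (rule has_integral_eq[rotated])
qed

text \<open>The chart centred at a point of \<open>D\<close> makes \<open>D\<close> a neighbourhood
  of infinity. The outside of the Jordan curve then belongs to \<open>D\<close>, and its inside is
  exactly the image of \<open>outer D\<close>.\<close>

lemma outer_connected:
  assumes D: "connectedin p1_top D" "openin p1_top D" "Some a \<in> D"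
  shows "connectedin p1_top (outer D)" "outer D \<noteq> {}"
proof -
  note part = open_frontier_partition[OF D(2)]
  let ?I = "inside (path_image \<delta>)" and ?O = "outside (path_image \<delta>)"
  have J: "?I \<noteq> {}" "open ?I" "connected ?I" "open ?O" "connected ?O" "bounded ?I" "\<not> bounded ?O"
      "?I \<inter> ?O = {}" "?I \<union> ?O = - path_image \<delta>"
    using Jordan_inside_outside[OF simple_path_\<delta> loop_\<delta>] by auto
  let ?V = "chart a -` D" and ?U = "chart a -` outer D"
  have open_VU: "open ?V" "open ?U" by (intro open_chart_vimage D part)+
  have disj: "?V \<inter> ?U = {}" using part(2) by auto
  have cover: "?V \<union> ?U = - path_image \<delta>"
    using part by (auto simp: mem_path_image)
  \<comment> \<open>The preimages of \<open>D\<close> and \<open>outer D\<close> are disjoint open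
    sets covering the complement of the curve, so a connected set off the curve lies in one of
    them.\<close>
  have either: "T \<subseteq> ?V \<or> T \<subseteq> ?U" if "connected T" "T \<subseteq> - path_image \<delta>" for T
  proof -
    have "T \<subseteq> ?V \<union> ?U" using that(2) cover by simp
    moreover from this have "?V \<inter> T = {} \<or> ?U \<inter> T = {}"
      using connectedD[OF that(1) open_VU] disj by blast
    ultimately show ?thesis by blast
  qed
  have large_O: "\<exists>r. \<forall>u. norm u \<ge> r \<longrightarrow> u \<in> ?O"
  proof -
    have "bounded (?I \<union> path_image \<delta>)"
      using J(6) bounded_path_image[OF path_\<delta>] by simp
    then obtain r where r: "\<And>u. u \<in> ?I \<union> path_image \<delta> \<Longrightarrow> norm u \<le> r"
      unfolding bounded_iff by blast
    have "u \<in> ?O" if "norm u \<ge> r + 1" for u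
    proof -
      have "u \<notin> ?I \<union> path_image \<delta>" using r[of u] that by linarith
      then show ?thesis using J(9) by blast
    qed
    then show ?thesis by blast
  qed
  then obtain r where r: "\<And>u. norm u \<ge> r \<Longrightarrow> u \<in> ?O" by blast
  have "?O \<subseteq> ?V"
  proof -
    obtain e where e: "e > 0" "\<And>v. norm v < e \<Longrightarrow> loc_par (Some a) v \<in> D"
      using D(2,3) unfolding openin_p1_top by (force simp: eventually_nhds_metric dist_norm)
    \<comment> \<open>A point far enough out to be outside the curve, with \<open>1 / u\<close>
      inside the disc of radius \<open>e\<close> around the centre; the factor \<open>2\<close>
      makes that inequality strict.\<close>
    define u :: complex where "u = of_real (max r (2 / e))"
    have "2 / e > 0" using e(1) by simp
    then have pos: "max r (2 / e) > 0" by (simp add: less_max_iff_disj)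
    then have "norm u = max r (2 / e)" unfolding u_def norm_of_real by (rule abs_of_pos)
    then have u: "norm u \<ge> r" "norm u \<ge> 2 / e" "norm u > 0" using pos by simp_all
    have "norm (inverse u) = 1 / norm u"
      by (simp add: norm_inverse inverse_eq_divide[of "norm u"])
    also have "\<dots> < e" using u(2,3) e(1) by (simp add: field_simps)
    finally have "loc_par (Some a) (inverse u) \<in> D" by (rule e(2))
    then have "u \<in> ?V" using u(3) by (simp add: loc_par_center)
    moreover have "u \<in> ?O" using r u(1) by blast
    ultimately show ?thesis using either[OF J(5)] J(9) disj by blast
  qed
  \<comment> \<open>If the inside also lay in \<open>D\<close>, then \<open>D\<close> would be
    separated by the images of the two sides, the centre \<open>Some a\<close> being added to the
    outer one.\<close>
  have "?I \<subseteq> ?U"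
  proof (rule ccontr)
    assume "\<not> ?I \<subseteq> ?U"
    then have "?I \<subseteq> ?V" using either[OF J(3)] J(9) by blast
    have "openin p1_top (chart a ` ?I)" "openin p1_top (insert (Some a) (chart a ` ?O))"
      by (intro openin_chart_image openin_chart_image_insert[of _ r] J r)+
    moreover have "D \<subseteq> chart a ` ?I \<union> insert (Some a) (chart a ` ?O)"
    proof
      fix p assume p: "p \<in> D"
      have "\<phi> p \<in> ?I \<union> ?O" if "p \<noteq> Some a"
        using p part(1) chart_pole_coord[OF that] unfolding J(9) by (auto simp: mem_path_image)
      then have "p \<noteq> Some a \<Longrightarrow> chart a (\<phi> p) \<in> chart a ` ?I \<union> chart a ` ?O"
        by blast
      then show "p \<in> chart a ` ?I \<union> insert (Some a) (chart a ` ?O)"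
        using chart_pole_coord[of p a] by auto
    qed
    moreover have "chart a ` ?I \<inter> insert (Some a) (chart a ` ?O) = {}"
    proof -
      have "False" if "u \<in> ?I" "v \<in> ?O" "chart a u = chart a v" for u v
        using that J(8) pole_coord_chart by (metis disjoint_iff)
      then show ?thesis by (auto simp: chart_neq[symmetric] dest: sym)
    qed
    moreover have "chart a ` ?I \<inter> D \<noteq> {}" using \<open>?I \<subseteq> ?V\<close> J(1) by auto
    moreover have "insert (Some a) (chart a ` ?O) \<inter> D \<noteq> {}" using D(3) by auto
    ultimately show False
      using D(1) unfolding connectedin by blast
  qed
  have eq: "outer D = chart a ` ?I"
  proof
    show "chart a ` ?I \<subseteq> outer D" using \<open>?I \<subseteq> ?U\<close> by auto
    show "outer D \<subseteq> chart a ` ?I"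
    proof
      fix p assume p: "p \<in> outer D"
      then have "p \<noteq> Some a" using D(3) part(2) by blast
      note ch = chart_pole_coord[OF this]
      have "\<phi> p \<in> ?U" using p ch by simp
      then have "\<phi> p \<in> ?I" using cover disj J(9) \<open>?O \<subseteq> ?V\<close> by blast
      then show "p \<in> chart a ` ?I" using ch by (metis imageI)
    qed
  qed
  show "outer D \<noteq> {}" using J(1) eq by simp
  have "continuous_map euclidean p1_top (chart a)"
    using open_chart_vimage by (simp add: continuous_map vimage_def)
  then have "connectedin p1_top (chart a ` ?I)"
    by (rule connectedin_continuous_map_image) (simp add: J(3))
  then show "connectedin p1_top (outer D)" by (simp add: eq)
qed

end


section \<open>The boundary cocycle\<close>

context quadratic_lie_algebra
begin

text \<open>Differentiation of vector-valued functions, tested on linear functionals because the target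
  carries no topology.\<close>

definition curve_deriv :: "(real \<Rightarrow> 'g) \<Rightarrow> (real \<Rightarrow> 'g) \<Rightarrow> bool" where
  "curve_deriv x dx \<longleftrightarrow> fin_dim x \<and> fin_dim dx \<and> (\<forall>l. functional l \<longrightarrow>
     (\<forall>t. ((\<lambda>s. l (x s)) has_vector_derivative l (dx t)) (at t)) \<and> continuous_on UNIV (\<lambda>t. l (dx t)))"

lemma curve_derivD:
  assumes "curve_deriv x dx"
  shows "fin_dim x" "fin_dim dx"
    and "functional l \<Longrightarrow> ((\<lambda>s. l (x s)) has_vector_derivative l (dx t)) (at t)"
    and "functional l \<Longrightarrow> continuous_on UNIV (\<lambda>t. l (dx t))"
  using assms unfolding curve_deriv_def by blast+

lemma curve_deriv_continuous:
  assumes "curve_deriv x dx" "functional l"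
  shows "continuous_on UNIV (\<lambda>t. l (x t))"
  using curve_derivD(3)[OF assms]
  by (intro continuous_at_imp_continuous_on ballI has_vector_derivative_continuous)

text \<open>One coordinate system on the span of all four ranges expands \<open>x\<close>,
  \<open>dx\<close>, \<open>y\<close> and \<open>dy\<close> together. The product rule is then the
  scalar one, term by term.\<close>

lemma
  assumes x: "curve_deriv x dx" and y: "curve_deriv y dy" and \<beta>: "bilinear_form \<beta>"
  shows product_rule: "((\<lambda>s. \<beta> (x s) (y s)) has_vector_derivative \<beta> (dx t) (y t) + \<beta> (x t) (dy t)) (at t)"
    and product_continuous: "continuous_on UNIV (\<lambda>t. \<beta> (x t) (dy t))" "continuous_on UNIV (\<lambda>t. \<beta> (dx t) (y t))"
proof -
  obtain S1 S2 S3 S4 where S: "finite S1" "range x \<subseteq> span S1" "finite S2" "range dx \<subseteq> span S2"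
      "finite S3" "range y \<subseteq> span S3" "finite S4" "range dy \<subseteq> span S4"
    using curve_derivD(1,2)[OF x] curve_derivD(1,2)[OF y] unfolding fin_dim_def by blast
  let ?S = "S1 \<union> S2 \<union> S3 \<union> S4"
  have mono: "span S1 \<subseteq> span ?S" "span S2 \<subseteq> span ?S" "span S3 \<subseteq> span ?S" "span S4 \<subseteq> span ?S"
    by (intro span_mono; blast)+
  have mem: "x t \<in> span ?S" "dx t \<in> span ?S" "y t \<in> span ?S" "dy t \<in> span ?S" for t
    using S mono by blast+
  have fin: "finite ?S" using S by simp
  obtain T e where T: "finite T" "T \<subseteq> ?S" "\<And>b. functional (e b)"
      "\<And>v. v \<in> span ?S \<Longrightarrow> v = (\<Sum>b\<in>T. sg (e b v) b)"
    by (rule coordinates[OF fin]) (rule that)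
  have expand: "\<beta> v w = (\<Sum>b\<in>T. \<Sum>b'\<in>T. e b v * (e b' w * \<beta> b b'))" if "v \<in> span ?S" "w \<in> span ?S" for v w
  proof -
    have "\<beta> v w = (\<Sum>b\<in>T. e b v * \<beta> b w)"
      using \<beta> functional_sum[of "\<lambda>x. \<beta> x w"] arg_cong[OF T(4)[OF that(1)], of "\<lambda>x. \<beta> x w"]
      unfolding bilinear_form_def by simp
    moreover have "\<beta> b w = (\<Sum>b'\<in>T. e b' w * \<beta> b b')" for b
      using \<beta> functional_sum[of "\<beta> b"] arg_cong[OF T(4)[OF that(2)], of "\<beta> b"]
      unfolding bilinear_form_def by simp
    ultimately show ?thesis by (simp add: sum_distrib_left)
  qed
  show "((\<lambda>s. \<beta> (x s) (y s)) has_vector_derivative \<beta> (dx t) (y t) + \<beta> (x t) (dy t)) (at t)"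
  proof -
    have "((\<lambda>s. e b (x s) * (e b' (y s) * \<beta> b b')) has_vector_derivative
        e b (dx t) * (e b' (y t) * \<beta> b b') + e b (x t) * (e b' (dy t) * \<beta> b b')) (at t)" for b b'
      using has_vector_derivative_mult[OF curve_derivD(3)[OF x T(3)[of b]]
          has_vector_derivative_mult_left[OF curve_derivD(3)[OF y T(3)[of b']], of "\<beta> b b'"], of t]
      by (simp add: add.commute)
    then have "((\<lambda>s. \<Sum>b\<in>T. \<Sum>b'\<in>T. e b (x s) * (e b' (y s) * \<beta> b b')) has_vector_derivative
        (\<Sum>b\<in>T. \<Sum>b'\<in>T. e b (dx t) * (e b' (y t) * \<beta> b b') + e b (x t) * (e b' (dy t) * \<beta> b b'))) (at t)"
      by (intro has_vector_derivative_sum)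
    then show ?thesis
      by (simp add: expand mem sum.distrib)
  qed
  show "continuous_on UNIV (\<lambda>t. \<beta> (x t) (dy t))" "continuous_on UNIV (\<lambda>t. \<beta> (dx t) (y t))"
    unfolding expand[OF mem(1) mem(4)] expand[OF mem(2) mem(3)]
    by (intro continuous_intros curve_deriv_continuous[OF x] curve_deriv_continuous[OF y]
        curve_derivD(4)[OF x] curve_derivD(4)[OF y] T)+
qed

lemma curve_deriv_br:
  assumes x: "curve_deriv x dx" and y: "curve_deriv y dy"
  shows "curve_deriv (\<lambda>t. br (x t) (y t)) (\<lambda>t. br (dx t) (y t) + br (x t) (dy t))"
  unfolding curve_deriv_def
proof (intro conjI allI impI)
  show "fin_dim (\<lambda>t. br (x t) (y t))" "fin_dim (\<lambda>t. br (dx t) (y t) + br (x t) (dy t))"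
    by (intro fin_dim_add fin_dim_br curve_derivD(1,2)[OF x] curve_derivD(1,2)[OF y])+
  fix l assume l: "functional l"
  note \<beta> = bilinear_form_br[OF l]
  show "((\<lambda>s. l (br (x s) (y s))) has_vector_derivative l (br (dx t) (y t) + br (x t) (dy t))) (at t)" for t
    using product_rule[OF x y \<beta>] by (simp add: cf.linear_add[OF l])
  show "continuous_on UNIV (\<lambda>t. l (br (dx t) (y t) + br (x t) (dy t)))"
    unfolding cf.linear_add[OF l] by (intro continuous_intros product_continuous[OF x y \<beta>])
qed

end

section \<open>The pairing of maps along the boundary\<close>

locale quadratic_lie_curve = quadratic_lie_algebra sg br B + boundary_curve D \<gamma>
  for sg :: "complex \<Rightarrow> 'g::ab_group_add \<Rightarrow> 'g" and br B D \<gamma>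
begin

abbreviation "R \<equiv> regular_on_boundary sg D"
abbreviation "c \<equiv> boundary_pairing B \<gamma>"

lemma R_iff: "\<nu> \<in> R \<longleftrightarrow> \<nu> \<in> merom_maps sg \<and> (\<forall>p\<in>p1_top frontier_of D. regular_at sg \<nu> p)"
  by (simp add: regular_on_boundary_def)

lemma R_merom: "\<nu> \<in> R \<Longrightarrow> \<nu> \<in> merom_maps sg" and R_regular: "\<nu> \<in> R \<Longrightarrow> regular_at sg \<nu> (\<gamma> t)"
  using curve_frontier by (simp_all add: R_iff)

text \<open>The derivative is assembled from those of the finitely many coordinates, each
  continuously differentiable along the curve by regularity on the boundary.\<close>

lemma curve_deriv_exists:
  assumes \<nu>: "\<nu> \<in> R"
  obtains d where "curve_deriv (\<lambda>t. \<nu> (\<gamma> t)) d"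
proof -
  have fd: "fin_dim \<nu>" by (intro premerom_fin_dim merom_maps_premerom R_merom \<nu>)
  obtain T e where T: "finite T" "\<And>b. functional (e b)" "\<And>p. \<nu> p = (\<Sum>b\<in>T. sg (e b (\<nu> p)) b)"
    by (rule fin_dim_coordinates[OF fd]) (rule that)
  define d where "d t = (\<Sum>b\<in>T. sg (vector_derivative (\<lambda>s. e b (\<nu> (\<gamma> s))) (at t)) b)" for t
  have H: "(\<lambda>v. e b (\<nu> (loc_par (\<gamma> t) v))) analytic_on {0}" for b t
    by (rule regular_atD[OF R_regular[OF \<nu>] T(2)])
  note C1 = C1_along[of "\<lambda>p. e b (\<nu> p)" for b, OF H]
  have "curve_deriv (\<lambda>t. \<nu> (\<gamma> t)) d"
    unfolding curve_deriv_def
  proof (intro conjI allI impI)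
    show "fin_dim (\<lambda>t. \<nu> (\<gamma> t))" by (rule fin_dimI[OF T(1)]) (rule T(3))
    show "fin_dim d" by (rule fin_dimI[OF T(1)]) (rule d_def)
    fix l assume l: "functional l"
    have l_d: "l (d t) = (\<Sum>b\<in>T. vector_derivative (\<lambda>s. e b (\<nu> (\<gamma> s))) (at t) * l b)" for t
      unfolding d_def by (rule functional_sum[OF l])
    have l_\<nu>: "l (\<nu> (\<gamma> s)) = (\<Sum>b\<in>T. e b (\<nu> (\<gamma> s)) * l b)" for s
      using arg_cong[OF T(3), of l "\<gamma> s"] by (simp only: functional_sum[OF l])
    show "((\<lambda>s. l (\<nu> (\<gamma> s))) has_vector_derivative l (d t)) (at t)" for t
      unfolding l_d l_\<nu> by (intro has_vector_derivative_sum has_vector_derivative_mult_left C1)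
    show "continuous_on UNIV (\<lambda>t. l (d t))"
      unfolding l_d by (intro continuous_intros continuous_at_imp_continuous_on ballI C1)
  qed
  then show ?thesis by (rule that)
qed

text \<open>Replaces the coordinate-free integrand by \<open>B (\<mu>, d)\<close> for any derivative
  \<open>d\<close> of \<open>\<nu>\<close> along the curve, and records integrability so that
  integrals can be added.\<close>

lemma pairing_has_integral:
  assumes \<mu>: "\<mu> \<in> R" and \<nu>: "\<nu> \<in> R" and d: "curve_deriv (\<lambda>t. \<nu> (\<gamma> t)) d"
  shows "((\<lambda>t. B (\<mu> (\<gamma> t)) (d t)) has_integral 2 * of_real pi * \<i> * c \<mu> \<nu>) {0..1}"
proof -
  obtain d' where d': "curve_deriv (\<lambda>t. \<mu> (\<gamma> t)) d'" using curve_deriv_exists[OF \<mu>] .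
  have "vector_derivative (\<lambda>s. B (\<mu> (\<gamma> t)) (\<nu> (\<gamma> s))) (at t) = B (\<mu> (\<gamma> t)) (d t)" for t
    by (intro vector_derivative_at curve_derivD(3)[OF d] form_linear)
  then have "2 * of_real pi * \<i> * c \<mu> \<nu> = integral {0..1} (\<lambda>t. B (\<mu> (\<gamma> t)) (d t))"
    by (simp add: boundary_pairing_def)
  moreover have "(\<lambda>t. B (\<mu> (\<gamma> t)) (d t)) integrable_on {0..1}"
    using product_continuous(1)[OF d' d bilinear_form_B]
    by (intro integrable_continuous_real) (rule continuous_on_subset, auto)
  ultimately show ?thesis by (simp add: integrable_integral)
qed

lemma pairing_add:
  assumes \<mu>: "\<mu> \<in> R" and \<mu>': "\<mu>' \<in> R" and \<mu>\<mu>': "\<mu> \<oplus>\<^bsub>G\<^esub> \<mu>' \<in> R" and \<nu>: "\<nu> \<in> R"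
  shows "c (\<mu> \<oplus>\<^bsub>G\<^esub> \<mu>') \<nu> = c \<mu> \<nu> + c \<mu>' \<nu>"
proof -
  obtain d where d: "curve_deriv (\<lambda>t. \<nu> (\<gamma> t)) d" using curve_deriv_exists[OF \<nu>] .
  have "B ((\<mu> \<oplus>\<^bsub>G\<^esub> \<mu>') (\<gamma> t)) (d t) = B (\<mu> (\<gamma> t)) (d t) + B (\<mu>' (\<gamma> t)) (d t)" for t
  proof -
    have "(\<mu> \<oplus>\<^bsub>G\<^esub> \<mu>') (\<gamma> t) = \<mu> (\<gamma> t) + \<mu>' (\<gamma> t)"
      by (intro G_add_eq R_merom R_regular \<mu> \<mu>')
    then show ?thesis
      using bilinear_form_B unfolding bilinear_form_def by (simp add: cf.linear_add[of "\<lambda>x. B x (d t)"])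
  qed
  then have "((\<lambda>t. B (\<mu> (\<gamma> t)) (d t) + B (\<mu>' (\<gamma> t)) (d t)) has_integral
      2 * of_real pi * \<i> * c (\<mu> \<oplus>\<^bsub>G\<^esub> \<mu>') \<nu>) {0..1}"
    using pairing_has_integral[OF \<mu>\<mu>' \<nu> d] by simp
  moreover have "((\<lambda>t. B (\<mu> (\<gamma> t)) (d t) + B (\<mu>' (\<gamma> t)) (d t)) has_integral
      2 * of_real pi * \<i> * c \<mu> \<nu> + 2 * of_real pi * \<i> * c \<mu>' \<nu>) {0..1}"
    by (intro has_integral_add pairing_has_integral \<mu> \<mu>' \<nu> d)
  ultimately have "2 * of_real pi * \<i> * c (\<mu> \<oplus>\<^bsub>G\<^esub> \<mu>') \<nu> = 2 * of_real pi * \<i> * (c \<mu> \<nu> + c \<mu>' \<nu>)"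
    unfolding distrib_left by (rule has_integral_unique)
  then show ?thesis by simp
qed

lemma pairing_anti:
  assumes \<mu>: "\<mu> \<in> R" and \<nu>: "\<nu> \<in> R"
  shows "c \<nu> \<mu> = - c \<mu> \<nu>"
proof -
  obtain d where d: "curve_deriv (\<lambda>t. \<nu> (\<gamma> t)) d" using curve_deriv_exists[OF \<nu>] .
  obtain d' where d': "curve_deriv (\<lambda>t. \<mu> (\<gamma> t)) d'" using curve_deriv_exists[OF \<mu>] .
  have "((\<lambda>t. B (d' t) (\<nu> (\<gamma> t)) + B (\<mu> (\<gamma> t)) (d t)) has_integral 0) {0..1}"
    by (rule closed_integral_zero[of "\<lambda>p. B (\<mu> p) (\<nu> p)"]) (rule product_rule[OF d' d bilinear_form_B])
  moreover have "((\<lambda>t. B (d' t) (\<nu> (\<gamma> t)) + B (\<mu> (\<gamma> t)) (d t)) has_integral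
      2 * of_real pi * \<i> * c \<nu> \<mu> + 2 * of_real pi * \<i> * c \<mu> \<nu>) {0..1}"
    unfolding form_sym[of "d' _"] by (intro has_integral_add pairing_has_integral \<mu> \<nu> d d')
  ultimately have "2 * of_real pi * \<i> * (c \<nu> \<mu> + c \<mu> \<nu>) = 0"
    unfolding distrib_left by (rule has_integral_unique[rotated])
  then show ?thesis by (simp add: eq_neg_iff_add_eq_0)
qed

lemma pairing_cocycle:
  assumes \<mu>: "\<mu> \<in> R" and \<nu>: "\<nu> \<in> R" and \<alpha>: "\<alpha> \<in> R"
    and br: "lie_bracket G \<mu> \<nu> \<in> R" "lie_bracket G \<nu> \<alpha> \<in> R" "lie_bracket G \<mu> \<alpha> \<in> R"
  shows "c (lie_bracket G \<mu> \<nu>) \<alpha> = c \<mu> (lie_bracket G \<nu> \<alpha>) - c \<nu> (lie_bracket G \<mu> \<alpha>)"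
proof -
  obtain dm where dm: "curve_deriv (\<lambda>t. \<mu> (\<gamma> t)) dm" using curve_deriv_exists[OF \<mu>] .
  obtain dn where dn: "curve_deriv (\<lambda>t. \<nu> (\<gamma> t)) dn" using curve_deriv_exists[OF \<nu>] .
  obtain da where da: "curve_deriv (\<lambda>t. \<alpha> (\<gamma> t)) da" using curve_deriv_exists[OF \<alpha>] .
  define m n a where "m t = \<mu> (\<gamma> t)" and "n t = \<nu> (\<gamma> t)" and "a t = \<alpha> (\<gamma> t)" for t
  note defs = m_def n_def a_def
  have eq: "lie_bracket G \<mu> \<nu> (\<gamma> t) = br (m t) (n t)" "lie_bracket G \<nu> \<alpha> (\<gamma> t) = br (n t) (a t)"
      "lie_bracket G \<mu> \<alpha> (\<gamma> t) = br (m t) (a t)" for t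
    unfolding defs by (intro G_br_eq R_merom R_regular \<mu> \<nu> \<alpha>)+
  have d_na: "curve_deriv (\<lambda>t. lie_bracket G \<nu> \<alpha> (\<gamma> t)) (\<lambda>t. br (dn t) (a t) + br (n t) (da t))"
    unfolding eq unfolding defs by (rule curve_deriv_br[OF dn da])
  have d_ma: "curve_deriv (\<lambda>t. lie_bracket G \<mu> \<alpha> (\<gamma> t)) (\<lambda>t. br (dm t) (a t) + br (m t) (da t))"
    unfolding eq unfolding defs by (rule curve_deriv_br[OF dm da])
  let ?k = "2 * of_real pi * \<i>"
  have 1: "((\<lambda>t. B (br (m t) (n t)) (da t)) has_integral ?k * c (lie_bracket G \<mu> \<nu>) \<alpha>) {0..1}"
    using pairing_has_integral[OF br(1) \<alpha> da] by (simp only: eq)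
  have 2: "((\<lambda>t. B (m t) (br (dn t) (a t) + br (n t) (da t))) has_integral ?k * c \<mu> (lie_bracket G \<nu> \<alpha>)) {0..1}"
    using pairing_has_integral[OF \<mu> br(2) d_na] by (simp only: m_def)
  have 3: "((\<lambda>t. B (n t) (br (dm t) (a t) + br (m t) (da t))) has_integral ?k * c \<nu> (lie_bracket G \<mu> \<alpha>)) {0..1}"
    using pairing_has_integral[OF \<nu> br(3) d_ma] by (simp only: n_def)
  have 4: "((\<lambda>t. B (br (dm t) (n t) + br (m t) (dn t)) (a t) + B (br (m t) (n t)) (da t)) has_integral 0) {0..1}"
    unfolding defs
    by (rule closed_integral_zero[of "\<lambda>p. B (br (\<mu> p) (\<nu> p)) (\<alpha> p)"])
       (rule product_rule[OF curve_deriv_br[OF dm dn] da bilinear_form_B])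
  have B_add: "B (x + y) z = B x z + B y z" "B z (x + y) = B z x + B z y" for x y z
    using bilinear_form_B unfolding bilinear_form_def
    by (simp_all add: cf.linear_add[of "\<lambda>x. B x z"] cf.linear_add[of "B z"])
  have B_neg: "B (- x) y = - B x y" for x y
    using bilinear_form_B unfolding bilinear_form_def by (simp add: cf.linear_neg[of "\<lambda>x. B x y"])
  \<comment> \<open>Invariance of the form followed by antisymmetry of the bracket.\<close>
  have swap: "B (n t) (br y z) = - B (br y (n t)) z" for t y z
    by (simp only: form_invariant[symmetric] br_anti[of "n t" y] B_neg)
  \<comment> \<open>The first two integrands contain \<open>B ([m, n], da)\<close> twice, next to
    the terms with \<open>dm\<close> and \<open>dn\<close>. Subtracting the derivative of
    \<open>B ([m, n], a)\<close> leaves exactly one copy.\<close>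
  have "((\<lambda>t. B (m t) (br (dn t) (a t) + br (n t) (da t)) - B (n t) (br (dm t) (a t) + br (m t) (da t))
      - (B (br (dm t) (n t) + br (m t) (dn t)) (a t) + B (br (m t) (n t)) (da t))) has_integral
      ?k * c \<mu> (lie_bracket G \<nu> \<alpha>) - ?k * c \<nu> (lie_bracket G \<mu> \<alpha>) - 0) {0..1}"
    by (intro has_integral_diff 2 3 4)
  also have "(\<lambda>t. B (m t) (br (dn t) (a t) + br (n t) (da t)) - B (n t) (br (dm t) (a t) + br (m t) (da t))
      - (B (br (dm t) (n t) + br (m t) (dn t)) (a t) + B (br (m t) (n t)) (da t)))
    = (\<lambda>t. B (br (m t) (n t)) (da t))"
    by (rule ext) (simp add: B_add swap form_invariant[of "m _" "dn _"] form_invariant[of "m _" "n _"])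
  finally have "?k * c (lie_bracket G \<mu> \<nu>) \<alpha> = ?k * c \<mu> (lie_bracket G \<nu> \<alpha>) - ?k * c \<nu> (lie_bracket G \<mu> \<alpha>) - 0"
    using 1 by (rule has_integral_unique[rotated])
  then have "?k * c (lie_bracket G \<mu> \<nu>) \<alpha> = ?k * (c \<mu> (lie_bracket G \<nu> \<alpha>) - c \<nu> (lie_bracket G \<mu> \<alpha>))"
    by (simp only: right_diff_distrib diff_0_right)
  then show ?thesis by simp
qed

text \<open>Cauchy's theorem in a chart that sends a point of \<open>E\<close> to infinity.\<close>

lemma pairing_zero:
  assumes \<mu>: "\<mu> \<in> R" and \<nu>: "\<nu> \<in> R"
    and E: "connectedin p1_top E" "openin p1_top E" "E \<inter> p1_top frontier_of D = {}" "E \<noteq> {}"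
    and reg: "\<And>p. p \<notin> E \<Longrightarrow> regular_at sg \<mu> p" "\<And>p. p \<notin> E \<Longrightarrow> regular_at sg \<nu> p"
  shows "c \<mu> \<nu> = 0"
proof -
  obtain a where a: "Some a \<in> E" by (rule openin_p1_finite_point[OF E(2,4)])
  interpret affine_curve D \<gamma> a
    by unfold_locales (use a E(3) in blast)
  have fd: "fin_dim \<mu>" "fin_dim \<nu>" by (intro premerom_fin_dim merom_maps_premerom R_merom \<mu> \<nu>)+
  obtain T T' e e' where T: "finite T" "finite T'" "\<And>b. functional (e b)" "\<And>b. functional (e' b)"
    "\<And>\<beta> p q. bilinear_form \<beta> \<Longrightarrow> \<beta> (\<mu> p) (\<nu> q) = (\<Sum>b\<in>T. \<Sum>b'\<in>T'. e b (\<mu> p) * (e' b' (\<nu> q) * \<beta> b b'))"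
    by (rule bilinear_expand[OF fd]) (rule that)
  \<comment> \<open>In coordinates the integrand is a finite combination of scalar forms
    \<open>f dg\<close>, and Cauchy's theorem applies to each of them.\<close>
  have "vector_derivative (\<lambda>s. B (\<mu> (\<gamma> t)) (\<nu> (\<gamma> s))) (at t) =
      (\<Sum>b\<in>T. \<Sum>b'\<in>T'. e b (\<mu> (\<gamma> t)) * vector_derivative (\<lambda>s. e' b' (\<nu> (\<gamma> s))) (at t) * B b b')" for t
  proof (rule vector_derivative_at)
    have H: "(\<lambda>v. e' b' (\<nu> (loc_par (\<gamma> t) v))) analytic_on {0}" for b' t
      by (rule regular_atD[OF R_regular[OF \<nu>] T(4)])
    note C1 = C1_along(1)[of "\<lambda>p. e' b' (\<nu> p)" for b', OF H]
    have "((\<lambda>s. \<Sum>b\<in>T. \<Sum>b'\<in>T'. e b (\<mu> (\<gamma> t)) * e' b' (\<nu> (\<gamma> s)) * B b b') has_vector_derivative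
      (\<Sum>b\<in>T. \<Sum>b'\<in>T'. e b (\<mu> (\<gamma> t)) * vector_derivative (\<lambda>s. e' b' (\<nu> (\<gamma> s))) (at t) * B b b')) (at t)"
      by (intro has_vector_derivative_sum has_vector_derivative_mult_left has_vector_derivative_mult_right C1)
    then show "((\<lambda>s. B (\<mu> (\<gamma> t)) (\<nu> (\<gamma> s))) has_vector_derivative
      (\<Sum>b\<in>T. \<Sum>b'\<in>T'. e b (\<mu> (\<gamma> t)) * vector_derivative (\<lambda>s. e' b' (\<nu> (\<gamma> s))) (at t) * B b b')) (at t)"
      unfolding T(5)[OF bilinear_form_B] mult.assoc .
  qed
  moreover have "((\<lambda>t. \<Sum>b\<in>T. \<Sum>b'\<in>T'. e b (\<mu> (\<gamma> t)) * vector_derivative (\<lambda>s. e' b' (\<nu> (\<gamma> s))) (at t) * B b b')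
      has_integral (\<Sum>b\<in>T. \<Sum>b'\<in>T'. 0 * B b b')) {0..1}"
    by (intro has_integral_sum has_integral_mult_left Cauchy[OF E(1-3) a] regular_atD[OF reg(1) T(3)]
        regular_atD[OF reg(2) T(4)] T(1,2))
  ultimately have "((\<lambda>t. vector_derivative (\<lambda>s. B (\<mu> (\<gamma> t)) (\<nu> (\<gamma> s))) (at t)) has_integral 0) {0..1}"
    by simp
  then show ?thesis
    by (simp add: boundary_pairing_def integral_unique)
qed

end


section \<open>The commutation relation\<close>

lemma (in quadratic_lie_algebra) induced_module:
  assumes "\<And>k. lie_rep sg br (W k) (\<rho> k)"
  shows "induced_module sg br W \<rho> D"
  by (intro induced_module.intro lie_reps.intro induced_module_axioms.intro assms closed_lie_alg_L const_env_closed)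

locale DJ_operators = quadratic_lie_curve sg br B D \<gamma> + induced_module sg br W \<rho> D
  for sg :: "complex \<Rightarrow> 'g::ab_group_add \<Rightarrow> 'g" and br B D \<gamma>
    and W :: "'n::finite \<Rightarrow> (complex, 'w) module" and \<rho> :: "'n \<Rightarrow> 'g \<Rightarrow> 'w \<Rightarrow> 'w" +
  fixes z :: "'n \<Rightarrow> p1" and J
  assumes open_D: "openin p1_top D" and connected_D: "connectedin p1_top D" and nonempty_D: "D \<noteq> {}"
    and is_DJ: "is_DJ sg br B W \<rho> z D \<gamma> J"
begin

lemma
  shows J_lin_operator: "\<nu> \<in> R \<Longrightarrow> lin_operator M (J \<nu>)"
    and J_add: "\<nu> \<in> R \<Longrightarrow> \<nu>' \<in> R \<Longrightarrow> X \<in> carrier M \<Longrightarrow> J (\<nu> \<oplus>\<^bsub>G\<^esub> \<nu>') X = J \<nu> X \<oplus>\<^bsub>M\<^esub> J \<nu>' X"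
    and J_smult: "\<nu> \<in> R \<Longrightarrow> X \<in> carrier M \<Longrightarrow> J (a \<odot>\<^bsub>G\<^esub> \<nu>) X = a \<odot>\<^bsub>M\<^esub> J \<nu> X"
    and J_lact: "\<nu> \<in> R \<Longrightarrow> \<alpha> \<in> carrier LD \<Longrightarrow> X \<in> carrier M \<Longrightarrow>
      J \<nu> (lact \<alpha> X) \<ominus>\<^bsub>M\<^esub> lact \<alpha> (J \<nu> X) = J (lie_bracket G \<nu> \<alpha>) X \<oplus>\<^bsub>M\<^esub> c \<nu> \<alpha> \<odot>\<^bsub>M\<^esub> X"
    and J_one_tens_outer: "\<nu> \<in> R \<Longrightarrow> w \<in> tuples W \<Longrightarrow> (\<And>p. p \<in> outer D \<Longrightarrow> regular_at sg \<nu> p) \<Longrightarrow>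
      J \<nu> (one_tens w) = tens (env_in LD \<nu>) (pure_tensor W w) \<ominus>\<^bsub>M\<^esub>
        (\<Oplus>\<^bsub>M\<^esub>k\<in>{k. z k \<in> outer D}. one_tens (w(k := \<rho> k (\<nu> (z k)) (w k))))"
    and J_one_tens_inner: "\<nu> \<in> R \<Longrightarrow> w \<in> tuples W \<Longrightarrow> (\<And>p. p \<in> D \<Longrightarrow> regular_at sg \<nu> p) \<Longrightarrow>
      J \<nu> (one_tens w) = (\<Oplus>\<^bsub>M\<^esub>k\<in>{k. z k \<in> D}. one_tens (w(k := \<rho> k (\<nu> (z k)) (w k))))"
  using is_DJ unfolding is_DJ_def Let_def by blast+

lemmas partition = open_frontier_partition[OF open_D]

lemma R_add_closed: "\<mu> \<in> R \<Longrightarrow> \<nu> \<in> R \<Longrightarrow> \<mu> \<oplus>\<^bsub>G\<^esub> \<nu> \<in> R"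
  and R_smult_closed: "\<mu> \<in> R \<Longrightarrow> a \<odot>\<^bsub>G\<^esub> \<mu> \<in> R"
  and R_br_closed: "\<mu> \<in> R \<Longrightarrow> \<nu> \<in> R \<Longrightarrow> lie_bracket G \<mu> \<nu> \<in> R"
  unfolding R_iff by (auto intro: G_add_closed G_smult_closed G_br_closed G_add_regular G_smult_regular G_br_regular)

text \<open>By the partition of the line, these are the meromorphic maps with all poles in
  \<open>outer D\<close>, the mirror image of \<open>carrier LD\<close>.\<close>

definition "R_in = {\<nu> \<in> R. \<forall>p\<in>D. regular_at sg \<nu> p}"

lemma R_in_iff: "\<nu> \<in> R_in \<longleftrightarrow> \<nu> \<in> merom_maps sg \<and> (\<forall>p. p \<notin> outer D \<longrightarrow> regular_at sg \<nu> p)"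
  unfolding R_in_def mem_Collect_eq R_iff using partition by blast

lemma LD_iff: "\<nu> \<in> carrier LD \<longleftrightarrow> \<nu> \<in> R \<and> (\<forall>p\<in>outer D. regular_at sg \<nu> p)"
  unfolding L_carrier mem_Collect_eq R_iff using partition by blast

lemma R_in_br_closed: "\<mu> \<in> R_in \<Longrightarrow> \<nu> \<in> R_in \<Longrightarrow> lie_bracket G \<mu> \<nu> \<in> R_in"
  unfolding R_in_iff by (auto intro: G_br_closed G_br_regular)

lemma pairing_zero_LD:
  assumes "\<mu> \<in> carrier LD" "\<nu> \<in> carrier LD"
  shows "c \<mu> \<nu> = 0"
proof (rule pairing_zero[OF _ _ connected_D open_D partition(1) nonempty_D])
  show "\<mu> \<in> R" "\<nu> \<in> R" using assms LD_iff by blast+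
qed (use assms in \<open>auto simp: L_carrier\<close>)

lemma pairing_zero_R_in:
  assumes "\<mu> \<in> R_in" "\<nu> \<in> R_in"
  shows "c \<mu> \<nu> = 0"
proof -
  obtain a where a: "Some a \<in> D" by (rule openin_p1_finite_point[OF open_D nonempty_D])
  interpret affine_curve D \<gamma> a by unfold_locales (use a partition(1) in blast)
  show ?thesis
  proof (rule pairing_zero[OF _ _ outer_connected(1)[OF connected_D open_D a] partition(5) _
        outer_connected(2)[OF connected_D open_D a]])
    show "\<mu> \<in> R" "\<nu> \<in> R" using assms by (auto simp: R_in_def)
    show "outer D \<inter> p1_top frontier_of D = {}" using partition(3) by blast
  qed (use assms in \<open>auto simp: R_in_iff\<close>)
qed

lemma decompose:
  assumes \<mu>: "\<mu> \<in> R"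
  shows "\<exists>\<mu>1\<in>carrier LD. \<exists>\<mu>2\<in>R_in. \<mu> = \<mu>1 \<oplus>\<^bsub>G\<^esub> \<mu>2"
proof -
  obtain f1 f2 where f: "f1 \<in> merom_maps sg" "f2 \<in> merom_maps sg" "\<mu> = f1 \<oplus>\<^bsub>G\<^esub> f2"
    "\<And>q. q \<notin> D \<or> regular_at sg \<mu> q \<Longrightarrow> regular_at sg f1 q"
    "\<And>q. q \<in> D \<or> regular_at sg \<mu> q \<Longrightarrow> regular_at sg f2 q"
    by (rule principal_decomposition[OF R_merom[OF \<mu>], of D]) (rule that)
  have "f1 \<in> carrier LD" using f(1,4) by (simp add: L_carrier)
  moreover have "f2 \<in> R_in" using f(2,5) \<mu> by (simp add: R_in_def R_iff)
  ultimately show ?thesis using f(3) by blast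
qed

text \<open>The representation identity in slot \<open>k\<close>, inserted into a pure tensor.
  Regularity at \<open>z k\<close> ensures that the value of the bracket is the bracket of the
  values.\<close>

lemma one_tens_bracket:
  assumes w: "w \<in> tuples W" and "\<mu> \<in> merom_maps sg" "\<nu> \<in> merom_maps sg"
    and "regular_at sg \<mu> (z k)" "regular_at sg \<nu> (z k)"
  shows "one_tens (w(k := \<rho> k (\<mu> (z k)) (\<rho> k (\<nu> (z k)) (w k))))
    = one_tens (w(k := \<rho> k (lie_bracket G \<mu> \<nu> (z k)) (w k)))
      \<oplus>\<^bsub>M\<^esub> one_tens (w(k := \<rho> k (\<nu> (z k)) (\<rho> k (\<mu> (z k)) (w k))))"
proof -
  have wk: "w k \<in> carrier (W k)" using w by (simp add: tuples_def)
  have "\<rho> k (lie_bracket G \<mu> \<nu> (z k)) (w k) =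
      \<rho> k (\<mu> (z k)) (\<rho> k (\<nu> (z k)) (w k)) \<ominus>\<^bsub>W k\<^esub> \<rho> k (\<nu> (z k)) (\<rho> k (\<mu> (z k)) (w k))"
    using lie_rep_bracket[OF rep wk] by (simp only: G_br_eq assms)
  then show ?thesis
    by (simp only:) (intro one_tens_diff w lie_rep_closed[OF rep] wk)
qed

text \<open>\<open>E\<close> embeds the module linearly into a type and \<open>Q\<close> recovers
  its elements. The abstract commutator computation is carried out on the image and brought back by
  \<open>Q\<close>.\<close>

theorem commutator_relation:
  assumes \<mu>: "\<mu> \<in> R" and \<nu>: "\<nu> \<in> R" and X: "X \<in> carrier M"
  shows "J \<mu> (J \<nu> X) \<ominus>\<^bsub>M\<^esub> J \<nu> (J \<mu> X) \<ominus>\<^bsub>M\<^esub> J (lie_bracket G \<mu> \<nu>) X = c \<mu> \<nu> \<odot>\<^bsub>M\<^esub> X"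
proof -
  interpret M: Module.module complex_field M by (rule M_module)
  obtain Q :: "((((p1 \<Rightarrow> 'g) letters \<Rightarrow>\<^sub>0 complex) set \<times> (('n \<Rightarrow> 'w) \<Rightarrow>\<^sub>0 complex) set) \<Rightarrow>\<^sub>0 complex) \<Rightarrow> _" and E
    where Q_closed: "\<And>v. Q v \<in> carrier M"
    and Q_E: "\<And>X. X \<in> carrier M \<Longrightarrow> Q (E X) = X"
    and E_add: "\<And>X Y. X \<in> carrier M \<Longrightarrow> Y \<in> carrier M \<Longrightarrow> E (X \<oplus>\<^bsub>M\<^esub> Y) = E X + E Y"
    and E_smult: "\<And>a X. X \<in> carrier M \<Longrightarrow> E (a \<odot>\<^bsub>M\<^esub> X) = scale_pm a (E X)"
    and Q_add: "\<And>u v. Q (u + v) = Q u \<oplus>\<^bsub>M\<^esub> Q v"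
    and Q_smult: "\<And>a v. Q (scale_pm a v) = a \<odot>\<^bsub>M\<^esub> Q v"
    by (rule dw.embedding[folded DW_def]) (rule that)
  have smult_closed: "a \<odot>\<^bsub>M\<^esub> X \<in> carrier M" if "X \<in> carrier M" for a X
    using that by (intro M.smult_closed) simp
  have E_minus: "E (X \<ominus>\<^bsub>M\<^esub> Y) = E X - E Y" if "X \<in> carrier M" "Y \<in> carrier M" for X Y
    using that smult_closed by (simp add: a_minus_def smult_minus_one[OF M_module, symmetric] E_add E_smult)
  have E_zero: "E \<zero>\<^bsub>M\<^esub> = 0"
    using E_add[of "\<zero>\<^bsub>M\<^esub>" "\<zero>\<^bsub>M\<^esub>"] by simp
  have E_finsum: "E (\<Oplus>\<^bsub>M\<^esub>k\<in>K. f k) = (\<Sum>k\<in>K. E (f k))"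
    if "finite K" "\<And>k. k \<in> K \<Longrightarrow> f k \<in> carrier M" for K :: "'n set" and f
    using that
  proof (induction K rule: finite_induct)
    case (insert k K)
    then show ?case
      by (subst M.finsum_insert) (auto simp: E_add M.finsum_closed)
  qed (simp add: E_zero)
  \<comment> \<open>Passing through \<open>Q\<close> defines the lifted operator on every vector of
    the type, so that it is linear everywhere as \<open>current_operators\<close> demands.\<close>
  define lift where "lift F v = E (F (Q v))" for F :: "_ \<Rightarrow> _" and v
  have lift_E: "lift F (E X) = E (F X)" if "X \<in> carrier M" for F X
    using that by (simp add: lift_def Q_E)
  have lift_linear: "pm_linear (lift F)" if "lin_operator M F" for F
    using that unfolding lin_operator_def
    by (intro pm_linearI) (simp_all add: lift_def Q_add Q_smult Q_closed E_add E_smult)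
  have op_closed: "F X \<in> carrier M" if "lin_operator M F" "X \<in> carrier M" for F X
    using that unfolding lin_operator_def by blast
  note J_closed = op_closed[OF J_lin_operator] and lact_closed = op_closed[OF lin_operator_lact]
  define mv where "mv k \<kappa> w = w(k := \<rho> k (\<kappa> (z k)) (w k))" for k :: 'n and \<kappa> and w :: "'n \<Rightarrow> 'w"
  have mv_tuples: "mv k \<kappa> w \<in> tuples W" if "w \<in> tuples W" for k \<kappa> w
    unfolding mv_def using that by (intro tuples_upd tuples_rho)
  have mv_bracket: "E (one_tens (mv k \<mu> (mv k \<nu> w))) = E (one_tens (mv k (lie_bracket G \<mu> \<nu>) w)) + E (one_tens (mv k \<nu> (mv k \<mu> w)))"
    if "w \<in> tuples W" "\<mu> \<in> merom_maps sg" "\<nu> \<in> merom_maps sg" "regular_at sg \<mu> (z k)" "regular_at sg \<nu> (z k)" for k \<mu> \<nu> w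
  proof -
    have "one_tens (mv k \<mu> (mv k \<nu> w)) = one_tens (mv k (lie_bracket G \<mu> \<nu>) w) \<oplus>\<^bsub>M\<^esub> one_tens (mv k \<nu> (mv k \<mu> w))"
      using one_tens_bracket[OF that] by (simp add: mv_def)
    then show ?thesis
      using that(1) by (simp only: E_add one_tens_closed mv_tuples)
  qed
  have LD_R: "\<alpha> \<in> R" if "\<alpha> \<in> carrier LD" for \<alpha> using that LD_iff by blast
  \<comment> \<open>Maps regular in \<open>outer D\<close> form \<open>carrier LD\<close> and act by
    left multiplication; those regular in \<open>D\<close> form \<open>R_in\<close>. The generators
    are the images of the vectors \<open>1 \<otimes> w\<close>.\<close>
  interpret ops: current_operators scale_pm "\<lambda>\<mu>. lift (J \<mu>)" "\<lambda>\<alpha>. lift (lact \<alpha>)" "E ` carrier M"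
    R "carrier LD" R_in "lie_bracket G" "\<lambda>\<mu> \<nu>. \<mu> \<oplus>\<^bsub>G\<^esub> \<nu>" c "tuples W" "\<lambda>w. E (one_tens w)" mv
    "{k. z k \<in> outer D}" "{k. z k \<in> D}"
  proof (intro current_operators.intro current_operators_axioms.intro)
    show "vector_space (scale_pm :: complex \<Rightarrow> _)" by (rule pm.vector_space_axioms)
    show "carrier LD \<subseteq> R" using LD_R by blast
    show "R_in \<subseteq> R" by (auto simp: R_in_def)
    show "lie_bracket G \<mu> \<nu> \<in> R" if "\<mu> \<in> R" "\<nu> \<in> R" for \<mu> \<nu> using that by (rule R_br_closed)
    show "lie_bracket G \<mu> \<nu> \<in> carrier LD" if "\<mu> \<in> carrier LD" "\<nu> \<in> carrier LD" for \<mu> \<nu>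
      using L.bracket_closed[OF that] by (simp add: L_simps)
    show "lie_bracket G \<mu> \<nu> \<in> R_in" if "\<mu> \<in> R_in" "\<nu> \<in> R_in" for \<mu> \<nu>
      using that by (rule R_in_br_closed)
    show "pm_linear (lift (J \<mu>))" if "\<mu> \<in> R" for \<mu> using that by (intro lift_linear J_lin_operator)
    show "pm_linear (lift (lact \<alpha>))" if "\<alpha> \<in> carrier LD" for \<alpha> using that by (intro lift_linear lin_operator_lact)
    show "lift (J \<mu>) x \<in> E ` carrier M" if "\<mu> \<in> R" for \<mu> x
      unfolding lift_def by (intro imageI J_closed that Q_closed)
    show "E (one_tens w) \<in> E ` carrier M" if "w \<in> tuples W" for w
      by (intro imageI one_tens_closed that)
    show "lift (J (\<mu> \<oplus>\<^bsub>G\<^esub> \<nu>)) x = lift (J \<mu>) x + lift (J \<nu>) x" if "\<mu> \<in> R" "\<nu> \<in> R" for \<mu> \<nu> x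
      using that by (simp add: lift_def J_add J_closed Q_closed E_add)
    show anti: "lift (J (lie_bracket G \<nu> \<mu>)) x = - lift (J (lie_bracket G \<mu> \<nu>)) x" if "\<mu> \<in> R" "\<nu> \<in> R" for \<mu> \<nu> x
      using that by (simp add: lift_def G_bracket_anti[OF R_merom[OF that(1)] R_merom[OF that(2)]]
          J_smult R_br_closed Q_closed E_smult J_closed)
    show "lift (J (lie_bracket G (lie_bracket G \<mu> \<nu>) \<alpha>)) x = lift (J (lie_bracket G \<mu> (lie_bracket G \<nu> \<alpha>))) x
        - lift (J (lie_bracket G \<nu> (lie_bracket G \<mu> \<alpha>))) x"
      if "\<mu> \<in> R" "\<nu> \<in> R" "\<alpha> \<in> carrier LD" for \<mu> \<nu> \<alpha> x
      unfolding G_jacobi[OF R_merom[OF that(1)] R_merom[OF that(2)] R_merom[OF LD_R[OF that(3)]]]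
      using that LD_R[OF that(3)]
      by (simp add: lift_def J_add J_smult R_br_closed R_smult_closed Q_closed E_add E_smult J_closed smult_closed)
    show "lift (J (lie_bracket G (\<mu> \<oplus>\<^bsub>G\<^esub> \<mu>') \<nu>)) x = lift (J (lie_bracket G \<mu> \<nu>)) x + lift (J (lie_bracket G \<mu>' \<nu>)) x"
      if "\<mu> \<in> R" "\<mu>' \<in> R" "\<nu> \<in> R" for \<mu> \<mu>' \<nu> x
      using that by (simp add: lift_def G_bracket_add[OF R_merom R_merom R_merom] J_add R_br_closed J_closed Q_closed E_add)
    show "lift (lact (lie_bracket G \<alpha> \<beta>)) x = lift (lact \<alpha>) (lift (lact \<beta>) x) - lift (lact \<beta>) (lift (lact \<alpha>) x)"
      if "\<alpha> \<in> carrier LD" "\<beta> \<in> carrier LD" for \<alpha> \<beta> x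
    proof -
      have br: "lie_bracket G \<alpha> \<beta> \<in> carrier LD" using L.bracket_closed[OF that] by (simp add: L_simps)
      have "E (lact (lie_bracket G \<alpha> \<beta>) (Q x) \<oplus>\<^bsub>M\<^esub> lact \<beta> (lact \<alpha> (Q x))) = E (lact \<alpha> (lact \<beta> (Q x)))"
        using lact_bracket[OF that Q_closed] by (simp only: L_simps)
      then show ?thesis
        using that br by (simp add: lift_def Q_E Q_closed lact_closed E_add eq_diff_eq)
    qed
    show "lift (J \<nu>) (lift (lact \<alpha>) x) = lift (lact \<alpha>) (lift (J \<nu>) x) + lift (J (lie_bracket G \<nu> \<alpha>)) x + scale_pm (c \<nu> \<alpha>) x"
      if "\<nu> \<in> R" "\<alpha> \<in> carrier LD" "x \<in> E ` carrier M" for \<nu> \<alpha> x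
    proof -
      from that(3) obtain X where X: "X \<in> carrier M" "x = E X" by blast
      note \<alpha> = LD_R[OF that(2)]
      have "E (J \<nu> (lact \<alpha> X) \<ominus>\<^bsub>M\<^esub> lact \<alpha> (J \<nu> X)) = E (J (lie_bracket G \<nu> \<alpha>) X \<oplus>\<^bsub>M\<^esub> c \<nu> \<alpha> \<odot>\<^bsub>M\<^esub> X)"
        using J_lact[OF that(1,2) X(1)] by simp
      then have "E (J \<nu> (lact \<alpha> X)) - E (lact \<alpha> (J \<nu> X)) = E (J (lie_bracket G \<nu> \<alpha>) X) + scale_pm (c \<nu> \<alpha>) (E X)"
        using that(1,2) \<alpha> X(1) by (simp add: E_minus E_add E_smult J_closed lact_closed smult_closed R_br_closed)
      then show ?thesis
        using that(1,2) X(1) by (simp add: X(2) lift_E J_closed lact_closed algebra_simps)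
    qed
    show "\<exists>\<mu>1\<in>carrier LD. \<exists>\<mu>2\<in>R_in. \<mu> = \<mu>1 \<oplus>\<^bsub>G\<^esub> \<mu>2" if "\<mu> \<in> R" for \<mu> using that by (rule decompose)
    show "c \<nu> \<mu> = - c \<mu> \<nu>" if "\<mu> \<in> R" "\<nu> \<in> R" for \<mu> \<nu> using that by (rule pairing_anti)
    show "c (\<mu> \<oplus>\<^bsub>G\<^esub> \<mu>') \<nu> = c \<mu> \<nu> + c \<mu>' \<nu>" if "\<mu> \<in> R" "\<mu>' \<in> R" "\<nu> \<in> R" for \<mu> \<mu>' \<nu>
      using that by (intro pairing_add R_add_closed)
    show "c (lie_bracket G \<mu> \<nu>) \<alpha> = c \<mu> (lie_bracket G \<nu> \<alpha>) - c \<nu> (lie_bracket G \<mu> \<alpha>)"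
      if "\<mu> \<in> R" "\<nu> \<in> R" "\<alpha> \<in> carrier LD" for \<mu> \<nu> \<alpha>
      using that LD_R[OF that(3)] by (intro pairing_cocycle R_br_closed)
    show "c \<mu> \<nu> = 0" if "\<mu> \<in> carrier LD" "\<nu> \<in> carrier LD" for \<mu> \<nu> using that by (rule pairing_zero_LD)
    show "c \<mu> \<nu> = 0" if "\<mu> \<in> R_in" "\<nu> \<in> R_in" for \<mu> \<nu> using that by (rule pairing_zero_R_in)
    show "lift (J \<nu>) (E (one_tens w)) = lift (lact \<nu>) (E (one_tens w)) - (\<Sum>k\<in>{k. z k \<in> outer D}. E (one_tens (mv k \<nu> w)))"
      if \<nu>: "\<nu> \<in> carrier LD" and w: "w \<in> tuples W" for \<nu> w
    proof -
      have "J \<nu> (one_tens w) = lact \<nu> (one_tens w) \<ominus>\<^bsub>M\<^esub> (\<Oplus>\<^bsub>M\<^esub>k\<in>{k. z k \<in> outer D}. one_tens (mv k \<nu> w))"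
        unfolding mv_def lact_one_tens[OF \<nu>] by (rule J_one_tens_outer[OF LD_R[OF \<nu>] w]) (use \<nu> LD_iff in blast)
      then show ?thesis
        using \<nu> w by (simp add: lift_E one_tens_closed E_minus E_finsum lact_closed mv_tuples M.finsum_closed)
    qed
    show "lift (J \<nu>) (E (one_tens w)) = (\<Sum>k\<in>{k. z k \<in> D}. E (one_tens (mv k \<nu> w)))"
      if \<nu>: "\<nu> \<in> R_in" and w: "w \<in> tuples W" for \<nu> w
    proof -
      have "J \<nu> (one_tens w) = (\<Oplus>\<^bsub>M\<^esub>k\<in>{k. z k \<in> D}. one_tens (mv k \<nu> w))"
        unfolding mv_def by (rule J_one_tens_inner[OF _ w]) (use \<nu> in \<open>auto simp: R_in_def\<close>)
      then show ?thesis
        using w by (simp add: lift_E one_tens_closed E_finsum mv_tuples)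
    qed
    show "mv k \<nu> w \<in> tuples W" if "w \<in> tuples W" for k \<nu> w using that by (rule mv_tuples)
    show "mv k \<mu> (mv l \<nu> w) = mv l \<nu> (mv k \<mu> w)" if "k \<noteq> l" for k l \<mu> \<nu> w
      using that by (simp add: mv_def fun_upd_twist)
    show "E (one_tens (mv k \<mu> (mv k \<nu> w))) = E (one_tens (mv k (lie_bracket G \<mu> \<nu>) w)) + E (one_tens (mv k \<nu> (mv k \<mu> w)))"
      if "\<mu> \<in> carrier LD" "\<nu> \<in> carrier LD" "k \<in> {k. z k \<in> outer D}" "w \<in> tuples W" for \<mu> \<nu> k w
      using that by (intro mv_bracket) (auto simp: LD_iff R_merom)
    show "E (one_tens (mv k \<mu> (mv k \<nu> w))) = E (one_tens (mv k (lie_bracket G \<mu> \<nu>) w)) + E (one_tens (mv k \<nu> (mv k \<mu> w)))"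
      if "\<mu> \<in> R_in" "\<nu> \<in> R_in" "k \<in> {k. z k \<in> D}" "w \<in> tuples W" for \<mu> \<nu> k w
      using that by (intro mv_bracket) (auto simp: R_in_def R_merom)
    show "finite {k. z k \<in> outer D}" "finite {k. z k \<in> D}" by simp_all
    show "{k. z k \<in> outer D} \<inter> {k. z k \<in> D} = {}" using partition(2) by blast
    fix P x
    assume x: "x \<in> E ` carrier M" and P: "P 0" "\<And>x y. P x \<Longrightarrow> P y \<Longrightarrow> P (x + y)" "\<And>a x. P x \<Longrightarrow> P (scale_pm a x)"
      "\<And>w. w \<in> tuples W \<Longrightarrow> P (E (one_tens w))"
      "\<And>\<alpha> x. \<alpha> \<in> carrier LD \<Longrightarrow> x \<in> E ` carrier M \<Longrightarrow> P x \<Longrightarrow> P (lift (lact \<alpha>) x)"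
    obtain X where X: "X \<in> carrier M" "x = E X" using x by blast
    \<comment> \<open>The generation principle is pulled back along \<open>E\<close> to the
      induction on the module itself.\<close>
    have "P (E X)"
      using X(1)
    proof (induction X rule: M_induct)
      case (lact \<alpha> X)
      then show ?case using P(5)[of \<alpha> "E X"] by (simp add: lift_E)
    qed (simp_all add: E_zero E_add E_smult P)
    then show "P x" using X(2) by simp
  qed
  have JX: "J \<mu> X \<in> carrier M" if "\<mu> \<in> R" "X \<in> carrier M" for \<mu> X using that by (rule J_closed)
  have "E (J \<mu> (J \<nu> X) \<ominus>\<^bsub>M\<^esub> J \<nu> (J \<mu> X) \<ominus>\<^bsub>M\<^esub> J (lie_bracket G \<mu> \<nu>) X)
      = E (J \<mu> (J \<nu> X)) - E (J \<nu> (J \<mu> X)) - E (J (lie_bracket G \<mu> \<nu>) X)"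
    using \<mu> \<nu> X by (simp add: E_minus JX R_br_closed)
  also have "\<dots> = E (c \<mu> \<nu> \<odot>\<^bsub>M\<^esub> X)"
    using ops.commutator[OF imageI[OF X] \<mu> \<nu>] \<mu> \<nu> X by (simp add: lift_E JX E_smult)
  finally have "Q (E (J \<mu> (J \<nu> X) \<ominus>\<^bsub>M\<^esub> J \<nu> (J \<mu> X) \<ominus>\<^bsub>M\<^esub> J (lie_bracket G \<mu> \<nu>) X)) = Q (E (c \<mu> \<nu> \<odot>\<^bsub>M\<^esub> X))"
    by simp
  then show ?thesis
    using \<mu> \<nu> X by (simp add: Q_E JX R_br_closed smult_closed)
qed

end

theorem proposition12p2:
  fixes sg :: "complex \<Rightarrow> 'g::ab_group_add \<Rightarrow> 'g" and br :: "'g \<Rightarrow> 'g \<Rightarrow> 'g" and B :: "'g \<Rightarrow> 'g \<Rightarrow> complex"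
    and W :: "'n::finite \<Rightarrow> (complex, 'w) module" and \<rho> :: "'n \<Rightarrow> 'g \<Rightarrow> 'w \<Rightarrow> 'w" and z :: "'n \<Rightarrow> p1"
    and D :: "p1 set" and \<gamma> :: "real \<Rightarrow> p1" and J and \<mu> \<nu> :: "p1 \<Rightarrow> 'g"
  assumes "quadratic_lie_algebra sg br B"
    and "openin p1_top D" and "connectedin p1_top D" and "biholomorphic_to_disc D"
    and "pos_boundary D \<gamma>"
    and "\<And>k. lie_rep sg br (W k) (\<rho> k)"
    and "inj z" and "\<And>k. z k \<notin> p1_top frontier_of D"
    and "is_DJ sg br B W \<rho> z D \<gamma> J"
    and "\<mu> \<in> regular_on_boundary sg D" and "\<nu> \<in> regular_on_boundary sg D"
  shows "let M = DW sg br W \<rho> D;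
             \<Delta> = (\<lambda>X. J \<mu> (J \<nu> X) \<ominus>\<^bsub>M\<^esub> J \<nu> (J \<mu> X) \<ominus>\<^bsub>M\<^esub> J (lie_bracket (merom_lie sg br) \<mu> \<nu>) X)
         in ((\<forall>p\<in>outer D. regular_at sg \<mu> p \<and> regular_at sg \<nu> p) \<or>
             (\<forall>p\<in>D. regular_at sg \<mu> p \<and> regular_at sg \<nu> p)
               \<longrightarrow> (\<forall>X\<in>carrier M. \<Delta> X = \<zero>\<^bsub>M\<^esub>)) \<and>
            (\<forall>X\<in>carrier M. \<Delta> X = boundary_pairing B \<gamma> \<mu> \<nu> \<odot>\<^bsub>M\<^esub> X)"
proof -
  \<comment> \<open>\<open>D\<close> is in bijection with the unit ball. A point of \<open>D\<close>
    is later used as centre of a chart.\<close>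
  have "D \<noteq> {}"
    using assms(4) unfolding biholomorphic_to_disc_def by (auto simp: bij_betw_def)
  then interpret DJ_operators sg br B D \<gamma> W \<rho> z J
    by (intro DJ_operators.intro quadratic_lie_curve.intro boundary_curve.intro DJ_operators_axioms.intro
        quadratic_lie_algebra.induced_module[OF assms(1)] assms)
  interpret M: Module.module complex_field M by (rule M_module)
  \<comment> \<open>Parts (a) and (b) are read off the general formula: with all poles on one side
    of the curve, the constant vanishes.\<close>
  have "c \<mu> \<nu> \<odot>\<^bsub>M\<^esub> X = \<zero>\<^bsub>M\<^esub>"
    if "(\<forall>p\<in>outer D. regular_at sg \<mu> p \<and> regular_at sg \<nu> p) \<or> (\<forall>p\<in>D. regular_at sg \<mu> p \<and> regular_at sg \<nu> p)"
      and "X \<in> carrier M" for X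
  proof -
    have "\<mu> \<in> carrier LD \<and> \<nu> \<in> carrier LD \<or> \<mu> \<in> R_in \<and> \<nu> \<in> R_in"
      using that(1) assms(10,11) unfolding LD_iff R_in_def by blast
    then have "c \<mu> \<nu> = 0" using pairing_zero_LD pairing_zero_R_in by blast
    then show ?thesis using M.smult_l_null[OF that(2)] by simp
  qed
  then show ?thesis
    unfolding Let_def using commutator_relation[OF assms(10,11)] by (metis (no_types, lifting))
qed

end
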